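(* Let $R$ be a ring and let $C$ be the category of finite $R$-modules. Let $(M_N)_N$ be a tuple of real numbers indexed by the isomorphism classes of finite $R$-modules. If $M_N=O(|N|^n)$ for some real $n$, then $(M_N)_N$ is well-behaved.
   Context: Rings are not necessarily commutative. $M_N=O(|N|^n)$ means there is a constant $c$ with $|M_N|\le c|N|^n$ for all finite $R$-modules $N$. In the category of finite $R$-modules, epimorphisms are surjections and $\mathrm{Epi}(L,N)$ is the set of surjective homomorphisms. Quotients of a module $L$, up to isomorphism under $L$, form a finite modular lattice (dual to the lattice of submodules), where $H\ge H'$ if $L\to H'$ factors through $L\to H$; for $N$ a quotient of $L$, $[N,L]$ is the poset of quotients of $L$ that are $\ge N$. A level is a set of isomorphism classes of finite $R$-modules that is the smallest set containing a given finite set of modules and the zero module and closed under quotients and under joins (if $H,F$ in the set are quotients of a common module, then so is the join $H\vee F$ in its lattice of quotients); equivalently, the set of isomorphism classes of finite $S$-modules for some finite quotient ring $S$ of $R$. For $\pi:L\to N$ a surjection, $\mu(\pi)$ is the M\"obius function of the poset of quotients of $L$ evaluated at the quotients $(N,\pi)$ and $L$; $Z(\pi)$ is the number of $H\in[N,L]$ with $H\vee(K\wedge K')=(H\vee K)\wedge(H\vee K')$ for all $K,K'\in[N,L]$. The tuple $(M_N)_N$ is well-behaved if for every level $\mathcal{L}$ and all $N\in\mathcal{L}$, $\sum_{L\in\mathcal{L}}\sum_{\pi\in\mathrm{Epi}(L,N)}\frac{|\mu(\pi)|}{|\mathrm{Aut}(L)|}Z(\pi)^3|M_L|<\infty$ (sum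 over isomorphism classes $L$). *)

theory Defs
  imports "HOL-Algebra.Module" "HOL-Algebra.Lattice" "HOL-Analysis.Infinite_Sum"
begin

text \<open>
  The library locale \<open>module\<close> assumes a commutative ring of scalars. This is the same list of axioms
  over an arbitrary (associative, unital) ring: unital left modules. The fields \<open>mult\<close> and \<open>one\<close>
  of the record \<open>module\<close> are not used.
\<close>

locale left_module = R?: ring R + M?: abelian_group M for R (structure) and M (structure) +
  assumes smult_closed:
      "\<lbrakk> a \<in> carrier R; x \<in> carrier M \<rbrakk> \<Longrightarrow> a \<odot>\<^bsub>M\<^esub> x \<in> carrier M"
    and smult_l_distr:
      "\<lbrakk> a \<in> carrier R; b \<in> carrier R; x \<in> carrier M \<rbrakk> \<Longrightarrow>
      (a \<oplus>\<^bsub>R\<^esub> b) \<odot>\<^bsub>M\<^esub> x = a \<odot>\<^bsub>M\<^esub> x \<oplus>\<^bsub>M\<^esub> b \<odot>\<^bsub>M\<^esub> x"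
    and smult_r_distr:
      "\<lbrakk> a \<in> carrier R; x \<in> carrier M; y \<in> carrier M \<rbrakk> \<Longrightarrow>
      a \<odot>\<^bsub>M\<^esub> (x \<oplus>\<^bsub>M\<^esub> y) = a \<odot>\<^bsub>M\<^esub> x \<oplus>\<^bsub>M\<^esub> a \<odot>\<^bsub>M\<^esub> y"
    and smult_assoc:
      "\<lbrakk> a \<in> carrier R; b \<in> carrier R; x \<in> carrier M \<rbrakk> \<Longrightarrow>
      (a \<otimes>\<^bsub>R\<^esub> b) \<odot>\<^bsub>M\<^esub> x = a \<odot>\<^bsub>M\<^esub> (b \<odot>\<^bsub>M\<^esub> x)"
    and smult_one:
      "x \<in> carrier M \<Longrightarrow> \<one>\<^bsub>R\<^esub> \<odot>\<^bsub>M\<^esub> x = x"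

text \<open>
  Every finite module is isomorphic to one whose carrier is a finite set of natural numbers, so
  carriers of type \<^typ>\<open>nat\<close> suffice to represent all isomorphism classes of finite modules.
\<close>

definition finite_module :: "('r, 'x) ring_scheme \<Rightarrow> ('r, nat) module \<Rightarrow> bool" where
  "finite_module R L \<longleftrightarrow> left_module R L \<and> finite (carrier L)"

text \<open>
  Homomorphisms are extensional functions, so that a homomorphism is determined by its values on
  the carrier and sets of homomorphisms between finite modules are finite.
\<close>

definition Hom :: "('r, 'x) ring_scheme \<Rightarrow> ('r, nat) module \<Rightarrow> ('r, nat) module \<Rightarrow> (nat \<Rightarrow> nat) set" where
  "Hom R L N = {f \<in> carrier L \<rightarrow>\<^sub>E carrier N.
     (\<forall>x \<in> carrier L. \<forall>y \<in> carrier L. f (x \<oplus>\<^bsub>L\<^esub> y) = f x \<oplus>\<^bsub>N\<^esub> f y) \<and>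
     (\<forall>a \<in> carrier R. \<forall>x \<in> carrier L. f (a \<odot>\<^bsub>L\<^esub> x) = a \<odot>\<^bsub>N\<^esub> f x)}"

definition Epi :: "('r, 'x) ring_scheme \<Rightarrow> ('r, nat) module \<Rightarrow> ('r, nat) module \<Rightarrow> (nat \<Rightarrow> nat) set" where
  "Epi R L N = {f \<in> Hom R L N. f ` carrier L = carrier N}"

definition Iso :: "('r, 'x) ring_scheme \<Rightarrow> ('r, nat) module \<Rightarrow> ('r, nat) module \<Rightarrow> (nat \<Rightarrow> nat) set" where
  "Iso R L N = {f \<in> Hom R L N. bij_betw f (carrier L) (carrier N)}"

abbreviation Aut :: "('r, 'x) ring_scheme \<Rightarrow> ('r, nat) module \<Rightarrow> (nat \<Rightarrow> nat) set" where
  "Aut R L \<equiv> Iso R L L"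

definition iso_class :: "('r, 'x) ring_scheme \<Rightarrow> ('r, nat) module \<Rightarrow> ('r, nat) module set" where
  "iso_class R L = {L'. finite_module R L' \<and> Iso R L L' \<noteq> {}}"

text \<open>
  Quotients of \<open>L\<close> are pairs \<open>(H, h)\<close> of a module and a surjection \<open>h : L \<rightarrow> H\<close>, up to
  isomorphism under \<open>L\<close>; \<open>quotient_class R L H h\<close> is the class of \<open>(H, h)\<close>. In the lattice,
  \<open>Q' \<sqsubseteq> Q\<close> means that \<open>L \<rightarrow> H'\<close> factors through \<open>L \<rightarrow> H\<close>, so \<open>L\<close> is the top and \<open>\<squnion>\<close> is the
  join \<open>\<or>\<close> of quotients.
\<close>

definition quotient_class ::
    "('r, 'x) ring_scheme \<Rightarrow> ('r, nat) module \<Rightarrow> ('r, nat) module \<Rightarrow> (nat \<Rightarrow> nat)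
      \<Rightarrow> (('r, nat) module \<times> (nat \<Rightarrow> nat)) set" where
  "quotient_class R L H h = {(H', h'). finite_module R H' \<and> h' \<in> Epi R L H' \<and>
     (\<exists>f \<in> Iso R H H'. \<forall>x \<in> carrier L. f (h x) = h' x)}"

definition quotient_lattice ::
    "('r, 'x) ring_scheme \<Rightarrow> ('r, nat) module \<Rightarrow> (('r, nat) module \<times> (nat \<Rightarrow> nat)) set gorder" where
  "quotient_lattice R L =
    \<lparr> carrier = {quotient_class R L H h | H h. finite_module R H \<and> h \<in> Epi R L H},
      eq = (=),
      le = (\<lambda>Q' Q. \<exists>(H', h') \<in> Q'. \<exists>(H, h) \<in> Q.
              \<exists>f \<in> Hom R H H'. \<forall>x \<in> carrier L. f (h x) = h' x) \<rparr>"

definition top_quotient ::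
    "('r, 'x) ring_scheme \<Rightarrow> ('r, nat) module \<Rightarrow> (('r, nat) module \<times> (nat \<Rightarrow> nat)) set" where
  "top_quotient R L = quotient_class R L L (\<lambda>x \<in> carrier L. x)"

text \<open>
  Well-definedness: comparison of quotients amounts to comparison of kernel congruences, and
  quotients of a finite module form a finite partial order.
\<close>

lemma factor_iff:
  assumes L: "finite_module R L" and h: "h \<in> Epi R L H" and h': "h' \<in> Epi R L H'"
  shows "(\<exists>f \<in> Hom R H H'. \<forall>x \<in> carrier L. f (h x) = h' x) \<longleftrightarrow>
    (\<forall>x \<in> carrier L. \<forall>y \<in> carrier L. h x = h y \<longrightarrow> h' x = h' y)" (is "?l \<longleftrightarrow> ?r")
proof
  show "?l \<Longrightarrow> ?r" by metis
  assume r: ?r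
  interpret L: left_module R L using L by (simp add: finite_module_def)
  have hL: "h x \<in> carrier H" and hL': "h' x \<in> carrier H'" if "x \<in> carrier L" for x
    using h h' that by (auto simp: Epi_def Hom_def)
  define f where "f = (\<lambda>y \<in> carrier H. h' (SOME x. x \<in> carrier L \<and> h x = y))"
  have fh: "f (h x) = h' x" if x: "x \<in> carrier L" for x
  proof -
    define z where "z = (SOME z. z \<in> carrier L \<and> h z = h x)"
    have z: "z \<in> carrier L \<and> h z = h x"
      unfolding z_def by (rule someI [where x = x]) (use x in simp)
    have "f (h x) = h' z"
      using hL [OF x] by (simp add: f_def z_def)
    also have "\<dots> = h' x" using r z x by blast
    finally show ?thesis .
  qed
  have surj: "\<exists>x \<in> carrier L. y = h x" if "y \<in> carrier H" for y
    using h that by (auto simp: Epi_def)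
  have "f \<in> Hom R H H'"
  proof -
    have "f y \<in> carrier H'" if "y \<in> carrier H" for y
      using surj [OF that] fh hL' by auto
    moreover have "f y = undefined" if "y \<notin> carrier H" for y
      using that by (simp add: f_def)
    moreover have "f (y \<oplus>\<^bsub>H\<^esub> z) = f y \<oplus>\<^bsub>H'\<^esub> f z" if yz: "y \<in> carrier H" "z \<in> carrier H" for y z
    proof -
      obtain u v where uv: "u \<in> carrier L" "v \<in> carrier L" "y = h u" "z = h v"
        using surj yz by metis
      have "y \<oplus>\<^bsub>H\<^esub> z = h (u \<oplus>\<^bsub>L\<^esub> v)" using uv h by (auto simp: Epi_def Hom_def)
      then show ?thesis using uv h' by (simp add: fh L.M.a_closed Epi_def Hom_def)
    qed
    moreover have "f (a \<odot>\<^bsub>H\<^esub> y) = a \<odot>\<^bsub>H'\<^esub> f y" if ay: "a \<in> carrier R" "y \<in> carrier H" for a y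
    proof -
      obtain u where u: "u \<in> carrier L" "y = h u"
        using surj ay by metis
      have "a \<odot>\<^bsub>H\<^esub> y = h (a \<odot>\<^bsub>L\<^esub> u)" using u ay h by (auto simp: Epi_def Hom_def)
      then show ?thesis using u ay h' by (simp add: fh L.smult_closed Epi_def Hom_def)
    qed
    ultimately show ?thesis by (auto simp: Hom_def)
  qed
  then show ?l using fh by blast
qed

lemma iso_under_iff:
  assumes L: "finite_module R L" and h: "h \<in> Epi R L H" and h': "h' \<in> Epi R L H'"
  shows "(\<exists>f \<in> Iso R H H'. \<forall>x \<in> carrier L. f (h x) = h' x) \<longleftrightarrow>
    (\<forall>x \<in> carrier L. \<forall>y \<in> carrier L. h x = h y \<longleftrightarrow> h' x = h' y)" (is "?l \<longleftrightarrow> ?r")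
proof
  assume ?l
  then obtain f where f: "f \<in> Iso R H H'" "\<forall>x \<in> carrier L. f (h x) = h' x" by blast
  have hL: "h x \<in> carrier H" if "x \<in> carrier L" for x
    using h that by (auto simp: Epi_def)
  have "inj_on f (carrier H)" using f by (simp add: Iso_def bij_betw_def)
  then show ?r using f(2) hL by (metis inj_on_eq_iff)
next
  assume r: ?r
  then obtain f where f: "f \<in> Hom R H H'" "\<forall>x \<in> carrier L. f (h x) = h' x"
    using factor_iff [OF L h h'] by auto
  have im: "carrier H = h ` carrier L" "carrier H' = h' ` carrier L"
    using h h' unfolding Epi_def by blast+
  have "inj_on f (carrier H)"
  proof (rule inj_onI)
    fix a b assume ab: "a \<in> carrier H" "b \<in> carrier H" "f a = f b"
    obtain x y where xy: "x \<in> carrier L" "y \<in> carrier L" "a = h x" "b = h y"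
      using ab(1,2) im(1) by blast
    have "h' x = h' y" using xy ab(3) f(2) by metis
    then show "a = b" using r xy by blast
  qed
  moreover have "f ` carrier H = carrier H'"
  proof -
    have "(\<lambda>x. f (h x)) ` carrier L = h' ` carrier L"
      by (rule image_cong) (use f(2) in blast)+
    then show ?thesis by (metis im image_image)
  qed
  ultimately have "f \<in> Iso R H H'" using f(1) by (simp add: Iso_def bij_betw_def)
  then show ?l using f(2) by blast
qed

lemma mem_quotient_class_iff:
  assumes "finite_module R L" "h \<in> Epi R L H"
  shows "(H', h') \<in> quotient_class R L H h \<longleftrightarrow> finite_module R H' \<and> h' \<in> Epi R L H' \<and>
    (\<forall>x \<in> carrier L. \<forall>y \<in> carrier L. h x = h y \<longleftrightarrow> h' x = h' y)"
  unfolding quotient_class_def using iso_under_iff [OF assms, of h' H'] by blast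

lemma quotient_class_eq_iff:
  assumes L: "finite_module R L"
    and H: "finite_module R H" "h \<in> Epi R L H" and H': "finite_module R H'" "h' \<in> Epi R L H'"
  shows "quotient_class R L H h = quotient_class R L H' h' \<longleftrightarrow>
    (\<forall>x \<in> carrier L. \<forall>y \<in> carrier L. h x = h y \<longleftrightarrow> h' x = h' y)" (is "?l \<longleftrightarrow> ?r")
proof
  assume l: ?l
  have "(H', h') \<in> quotient_class R L H h"
    unfolding l mem_quotient_class_iff [OF L H'(2)] using H' by blast
  then show ?r unfolding mem_quotient_class_iff [OF L H(2)] by iprover
next
  assume ?r
  then show ?l
    unfolding set_eq_iff split_paired_All mem_quotient_class_iff [OF L H(2)]
      mem_quotient_class_iff [OF L H'(2)] by blast
qed

lemma le_quotient_lattice_iff: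
  "Q' \<sqsubseteq>\<^bsub>quotient_lattice R L\<^esub> Q \<longleftrightarrow>
    (\<exists>H' h' H h. (H', h') \<in> Q' \<and> (H, h) \<in> Q \<and>
      (\<exists>f \<in> Hom R H H'. \<forall>x \<in> carrier L. f (h x) = h' x))"
  unfolding quotient_lattice_def gorder.simps Bex_def split_paired_Ex prod.case by iprover

lemma le_quotient_class_iff:
  assumes L: "finite_module R L"
    and H: "finite_module R H" "h \<in> Epi R L H" and H': "finite_module R H'" "h' \<in> Epi R L H'"
  shows "quotient_class R L H' h' \<sqsubseteq>\<^bsub>quotient_lattice R L\<^esub> quotient_class R L H h \<longleftrightarrow>
    (\<forall>x \<in> carrier L. \<forall>y \<in> carrier L. h x = h y \<longrightarrow> h' x = h' y)" (is "?l \<longleftrightarrow> ?r")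
proof
  assume ?l
  then obtain G' g' G g where g: "(G', g') \<in> quotient_class R L H' h'" "(G, g) \<in> quotient_class R L H h"
    and f: "\<exists>f \<in> Hom R G G'. \<forall>x \<in> carrier L. f (g x) = g' x"
    unfolding le_quotient_lattice_iff by iprover
  have g': "g' \<in> Epi R L G'" "\<forall>x \<in> carrier L. \<forall>y \<in> carrier L. h' x = h' y \<longleftrightarrow> g' x = g' y"
    and g: "g \<in> Epi R L G" "\<forall>x \<in> carrier L. \<forall>y \<in> carrier L. h x = h y \<longleftrightarrow> g x = g y"
    using g unfolding mem_quotient_class_iff [OF L H(2)] mem_quotient_class_iff [OF L H'(2)] by iprover+
  show ?r
    using f g(2) g'(2) unfolding factor_iff [OF L g(1) g'(1)] by blast
next
  assume ?r
  then have "\<exists>f \<in> Hom R H H'. \<forall>x \<in> carrier L. f (h x) = h' x"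
    unfolding factor_iff [OF L H(2) H'(2)] .
  moreover have "(H', h') \<in> quotient_class R L H' h'" "(H, h) \<in> quotient_class R L H h"
    using H H' unfolding mem_quotient_class_iff [OF L H(2)] mem_quotient_class_iff [OF L H'(2)] by blast+
  ultimately show ?l unfolding le_quotient_lattice_iff by iprover
qed

lemma partial_order_quotient_lattice:
  assumes L: "finite_module R L"
  shows "partial_order (quotient_lattice R L)"
proof -
  let ?P = "quotient_lattice R L"
  have eq: "(.=\<^bsub>?P\<^esub>) = (=)" by (simp add: quotient_lattice_def)
  have car: "\<exists>H h. Q = quotient_class R L H h \<and> finite_module R H \<and> h \<in> Epi R L H"
    if "Q \<in> carrier ?P" for Q
    using that by (auto simp: quotient_lattice_def)
  show ?thesis
  proof (unfold_locales, simp_all add: eq)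
    show "x \<sqsubseteq>\<^bsub>?P\<^esub> x" if "x \<in> carrier ?P" for x
      using car [OF that] le_quotient_class_iff [OF L] by auto
    show "x = y" if le: "x \<sqsubseteq>\<^bsub>?P\<^esub> y" "y \<sqsubseteq>\<^bsub>?P\<^esub> x"
      and c: "x \<in> carrier ?P" "y \<in> carrier ?P" for x y
    proof -
      obtain H h where x: "x = quotient_class R L H h" and H: "finite_module R H" "h \<in> Epi R L H"
        using car [OF c(1)] by iprover
      obtain F f where y: "y = quotient_class R L F f" and F: "finite_module R F" "f \<in> Epi R L F"
        using car [OF c(2)] by iprover
      show ?thesis
        using le unfolding x y le_quotient_class_iff [OF L H F] le_quotient_class_iff [OF L F H]
          quotient_class_eq_iff [OF L H F] by blast
    qed
    show "x \<sqsubseteq>\<^bsub>?P\<^esub> z" if le: "x \<sqsubseteq>\<^bsub>?P\<^esub> y" "y \<sqsubseteq>\<^bsub>?P\<^esub> z"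
      and c: "x \<in> carrier ?P" "y \<in> carrier ?P" "z \<in> carrier ?P" for x y z
    proof -
      obtain H h where x: "x = quotient_class R L H h" and H: "finite_module R H" "h \<in> Epi R L H"
        using car [OF c(1)] by iprover
      obtain F f where y: "y = quotient_class R L F f" and F: "finite_module R F" "f \<in> Epi R L F"
        using car [OF c(2)] by iprover
      obtain G g where z: "z = quotient_class R L G g" and G: "finite_module R G" "g \<in> Epi R L G"
        using car [OF c(3)] by iprover
      show ?thesis
        using le unfolding x y z le_quotient_class_iff [OF L F H] le_quotient_class_iff [OF L G F]
          le_quotient_class_iff [OF L G H] by blast
    qed
  qed
qed

lemma finite_carrier_quotient_lattice:
  assumes L: "finite_module R L"
  shows "finite (carrier (quotient_lattice R L))"
proof -
  let ?k = "\<lambda>Q. {(x, y) \<in> carrier L \<times> carrier L. \<exists>(H, h) \<in> Q. h x = h y}"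
  have k: "?k (quotient_class R L H h) = {(x, y) \<in> carrier L \<times> carrier L. h x = h y}"
    if "finite_module R H" "h \<in> Epi R L H" for H h
  proof -
    have "(H, h) \<in> quotient_class R L H h" using that by (simp add: mem_quotient_class_iff [OF L])
    then show ?thesis by (auto simp: mem_quotient_class_iff [OF L that(2)])
  qed
  have "inj_on ?k (carrier (quotient_lattice R L))"
  proof (rule inj_onI)
    fix Q Q' assume Q: "Q \<in> carrier (quotient_lattice R L)" "Q' \<in> carrier (quotient_lattice R L)" "?k Q = ?k Q'"
    obtain H h F f where x: "Q = quotient_class R L H h" "finite_module R H" "h \<in> Epi R L H"
      and y: "Q' = quotient_class R L F f" "finite_module R F" "f \<in> Epi R L F"
      using Q by (auto simp: quotient_lattice_def)
    show "Q = Q'" using Q(3) unfolding x(1) y(1) k [OF x(2,3)] k [OF y(2,3)]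
        quotient_class_eq_iff [OF L x(2,3) y(2,3)] by blast
  qed
  moreover have "?k ` carrier (quotient_lattice R L) \<subseteq> Pow (carrier L \<times> carrier L)" by auto
  moreover have "finite (carrier L)" using L by (simp add: finite_module_def)
  ultimately show ?thesis by (meson finite_SigmaI finite_Pow_iff finite_subset inj_on_finite)
qed

lemma id_in_Epi:
  assumes "finite_module R L"
  shows "(\<lambda>x \<in> carrier L. x) \<in> Epi R L L"
proof -
  interpret left_module R L using assms by (simp add: finite_module_def)
  show ?thesis by (auto simp: Epi_def Hom_def smult_closed M.a_closed)
qed

text \<open>
  The Moebius function of a finite partial order; values outside the order, or for a structure that
  is not a finite partial order, are \<open>0\<close>.
\<close>

function moebius :: "'a gorder \<Rightarrow> 'a \<Rightarrow> 'a \<Rightarrow> int" where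
  "moebius P x y =
    (if partial_order P \<and> finite (carrier P) \<and> x \<in> carrier P \<and> y \<in> carrier P \<and> x \<sqsubseteq>\<^bsub>P\<^esub> y
     then if x = y then 1 else - (\<Sum>z \<in> {z \<in> \<lbrace>x..y\<rbrace>\<^bsub>P\<^esub>. z \<noteq> y}. moebius P x z)
     else 0)"
  by pat_completeness auto
termination
proof (relation "measure (\<lambda>(P, x, y). card \<lbrace>x..y\<rbrace>\<^bsub>P\<^esub>)", simp)
  fix P :: "'a gorder" and x y z
  assume P: "partial_order P \<and> finite (carrier P) \<and> x \<in> carrier P \<and> y \<in> carrier P \<and> x \<sqsubseteq>\<^bsub>P\<^esub> y"
    and z: "z \<in> {z \<in> \<lbrace>x..y\<rbrace>\<^bsub>P\<^esub>. z \<noteq> y}"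
  interpret partial_order P using P by blast
  have zc: "z \<in> carrier P" "z \<sqsubseteq>\<^bsub>P\<^esub> y" "z \<noteq> y" using z by (auto simp: at_least_at_most_def)
  have "\<lbrace>x..z\<rbrace>\<^bsub>P\<^esub> \<subseteq> \<lbrace>x..y\<rbrace>\<^bsub>P\<^esub>"
    using P zc by (auto simp: at_least_at_most_def intro: le_trans)
  moreover have "y \<in> \<lbrace>x..y\<rbrace>\<^bsub>P\<^esub>" "y \<notin> \<lbrace>x..z\<rbrace>\<^bsub>P\<^esub>"
    using P zc le_antisym by (auto simp: at_least_at_most_def)
  moreover have "finite \<lbrace>x..y\<rbrace>\<^bsub>P\<^esub>"
    using P by (auto simp: at_least_at_most_def)
  ultimately show "((P, x, z), P, x, y) \<in> measure (\<lambda>(P, x, y). card \<lbrace>x..y\<rbrace>\<^bsub>P\<^esub>)"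
    by (auto intro!: psubset_card_mono)
qed

declare moebius.simps [simp del]

definition mu ::
    "('r, 'x) ring_scheme \<Rightarrow> ('r, nat) module \<Rightarrow> ('r, nat) module \<Rightarrow> (nat \<Rightarrow> nat) \<Rightarrow> int" where
  "mu R L N \<pi> = moebius (quotient_lattice R L) (quotient_class R L N \<pi>) (top_quotient R L)"

definition quotients_above ::
    "('r, 'x) ring_scheme \<Rightarrow> ('r, nat) module \<Rightarrow> ('r, nat) module \<Rightarrow> (nat \<Rightarrow> nat)
      \<Rightarrow> (('r, nat) module \<times> (nat \<Rightarrow> nat)) set set" where
  "quotients_above R L N \<pi> =
    {Q \<in> carrier (quotient_lattice R L). quotient_class R L N \<pi> \<sqsubseteq>\<^bsub>quotient_lattice R L\<^esub> Q}"

definition Z ::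
    "('r, 'x) ring_scheme \<Rightarrow> ('r, nat) module \<Rightarrow> ('r, nat) module \<Rightarrow> (nat \<Rightarrow> nat) \<Rightarrow> nat" where
  "Z R L N \<pi> = (let P = quotient_lattice R L in
     card {H \<in> quotients_above R L N \<pi>.
       \<forall>K \<in> quotients_above R L N \<pi>. \<forall>K' \<in> quotients_above R L N \<pi>.
         H \<squnion>\<^bsub>P\<^esub> (K \<sqinter>\<^bsub>P\<^esub> K') = (H \<squnion>\<^bsub>P\<^esub> K) \<sqinter>\<^bsub>P\<^esub> (H \<squnion>\<^bsub>P\<^esub> K')})"

inductive_set generated_level :: "('r, 'x) ring_scheme \<Rightarrow> ('r, nat) module set \<Rightarrow> ('r, nat) module set set"
  for R :: "('r, 'x) ring_scheme" and G :: "('r, nat) module set" where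
  generator: "N \<in> G \<Longrightarrow> iso_class R N \<in> generated_level R G"
| zero: "\<lbrakk> finite_module R N; carrier N = {\<zero>\<^bsub>N\<^esub>} \<rbrakk> \<Longrightarrow> iso_class R N \<in> generated_level R G"
| quotient: "\<lbrakk> finite_module R L; iso_class R L \<in> generated_level R G; finite_module R N; Epi R L N \<noteq> {} \<rbrakk>
    \<Longrightarrow> iso_class R N \<in> generated_level R G"
| join: "\<lbrakk> finite_module R L;
      finite_module R H; h \<in> Epi R L H; iso_class R H \<in> generated_level R G;
      finite_module R F; f \<in> Epi R L F; iso_class R F \<in> generated_level R G;
      (J, j) \<in> quotient_class R L H h \<squnion>\<^bsub>quotient_lattice R L\<^esub> quotient_class R L F f \<rbrakk>
    \<Longrightarrow> iso_class R J \<in> generated_level R G"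

definition level :: "('r, 'x) ring_scheme \<Rightarrow> ('r, nat) module set set \<Rightarrow> bool" where
  "level R \<L> \<longleftrightarrow>
     (\<exists>G. finite G \<and> (\<forall>N \<in> G. finite_module R N) \<and> \<L> = generated_level R G)"

text \<open>
  In the outer sum over isomorphism classes \<open>C\<close>, \<open>L\<close> is an arbitrary representative of \<open>C\<close>;
  the inner sum is finite. As all terms are nonnegative, summability
  is finiteness of the sum.
\<close>

definition well_behaved :: "('r, 'x) ring_scheme \<Rightarrow> (('r, nat) module set \<Rightarrow> real) \<Rightarrow> bool" where
  "well_behaved R M \<longleftrightarrow>
    (\<forall>\<L>. level R \<L> \<longrightarrow>
      (\<forall>N. finite_module R N \<and> iso_class R N \<in> \<L> \<longrightarrow>
        (\<lambda>C. let L = (SOME L. L \<in> C) in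
           \<Sum>\<pi> \<in> Epi R L N.
             \<bar>real_of_int (mu R L N \<pi>)\<bar> / real (card (Aut R L)) * real (Z R L N \<pi>) ^ 3 * \<bar>M C\<bar>)
        summable_on \<L>))"

end

theory Submission
  imports Defs
begin

text \<open>
  Let \<open>\<L>\<close> be a level and \<open>N\<close> a finite module. The quotients of \<open>L\<close> above \<open>\<pi> : L \<rightarrow> N\<close> are the
  submodules of \<open>K = ker \<pi>\<close> with the order reversed, so \<open>\<mu>(\<pi>)\<close> and \<open>Z(\<pi>)\<close> are invariants of the
  lattice of submodules of \<open>L\<close> contained in \<open>K\<close>. All modules in \<open>\<L>\<close> see only finitely many scalars:
  there is a finite \<open>F \<subseteq> R\<close> such that every element of \<open>R\<close> acts on all of \<open>\<L>\<close> like an element of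
  \<open>F\<close>. Hence \<open>\<L>\<close> has finitely many members of each cardinality, cyclic submodules have at most
  \<open>|F|\<close> elements, and only finitely many subsets of \<open>R\<close> are annihilators of elements.

  The factor \<open>Z(\<pi>)\<^sup>3\<close> is bounded on \<open>\<L>\<close>. A distributive submodule \<open>U\<close> of \<open>K\<close> absorbs the image of
  every homomorphism from a submodule of \<open>U\<close> to \<open>K\<close> (\<open>distributive_hom_invariant\<close>), hence contains,
  with \<open>x\<close>, every \<open>y \<in> K\<close> with the same annihilator as \<open>x\<close>. So \<open>U\<close> is determined by the set of
  annihilators of its elements. As \<open>|M\<^sub>L|\<close> is at most a constant times \<open>|L| ^ A\<close> for a natural number
  \<open>A\<close>, it remains to bound the finite partial sums of
  \<open>\<Sum>\<^sub>L \<Sum>\<^sub>\<pi> |\<mu>(\<pi>)| |L| ^ A / |Aut L|\<close>.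

  Weisner's theorem, applied to a maximal submodule \<open>V\<close> of \<open>K\<close>, bounds \<open>|\<mu>(\<pi>)|\<close> by the sum of
  \<open>|\<mu>(L/T \<rightarrow> N)|\<close> over the complements \<open>T\<close> of \<open>V\<close> in \<open>K\<close>. Let \<open>\<tau>(\<pi>)\<close> be the number of maximal
  submodules of \<open>K\<close>. Summing over \<open>V\<close> bounds \<open>\<tau>(\<pi>) |\<mu>(\<pi>)|\<close> by a sum over pairs \<open>(V, T)\<close>. For such
  a pair, \<open>L\<close> is the fibre product over \<open>N\<close> of \<open>L' = L/T\<close> and of \<open>E = L/V\<close>, an extension of \<open>N\<close> by a
  module with at most \<open>|F|\<close> elements. There are only finitely many such \<open>E \<rightarrow> N\<close>, say \<open>D\<close>. For given
  \<open>L' \<rightarrow> N\<close> and \<open>E \<rightarrow> N\<close> the fibre product \<open>L\<close> is determined up to isomorphism, and the pairs of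
  projections \<open>L \<rightarrow> L'\<close>, \<open>L \<rightarrow> E\<close> form a torsor under \<open>Aut L\<close>. So the weights \<open>1 / |Aut L|\<close> cancel,
  and with \<open>|L| \<le> |F| |L'|\<close> one obtains the self-bound
    \<open>\<Sum>\<^sub>L \<Sum>\<^sub>\<pi> \<tau>(\<pi>) |\<mu>(\<pi>)| |L| ^ A / |Aut L| \<le> D |F| ^ A \<cdot> \<Sum>\<^sub>L \<Sum>\<^sub>\<pi> |\<mu>(\<pi>)| |L| ^ A / |Aut L|\<close>
  for the sums over all \<open>L\<close> with at most \<open>m\<close> elements (\<open>weighted_moment_le\<close>).

  Finally, \<open>|K| \<le> |F| ^ \<tau>(\<pi>)\<close> whenever \<open>\<mu>(\<pi>) \<noteq> 0\<close> (\<open>card_le_of_mob_nonzero\<close>), so \<open>\<tau>(\<pi>)\<close> exceeds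
  \<open>2 D |F| ^ A\<close> for all large \<open>L\<close>. The self-bound then shows that the large \<open>L\<close> contribute at most
  half of the sum, whatever \<open>m\<close> is, and the sum stays bounded as \<open>m\<close> grows.
\<close>

section \<open>Submodules of modules over an arbitrary ring\<close>

definition submodules :: "('r, 'x) ring_scheme \<Rightarrow> ('r, 'a, 'm) module_scheme \<Rightarrow> 'a set set" where
  "submodules R L = {U. U \<subseteq> carrier L \<and> \<zero>\<^bsub>L\<^esub> \<in> U \<and> (\<forall>x \<in> U. \<forall>y \<in> U. x \<oplus>\<^bsub>L\<^esub> y \<in> U) \<and>
     (\<forall>a \<in> carrier R. \<forall>x \<in> U. a \<odot>\<^bsub>L\<^esub> x \<in> U)}"

definition submodule_sum :: "('r, 'a, 'm) module_scheme \<Rightarrow> 'a set \<Rightarrow> 'a set \<Rightarrow> 'a set" where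
  "submodule_sum L U W = {x \<oplus>\<^bsub>L\<^esub> y | x y. x \<in> U \<and> y \<in> W}"

definition cyclic_submodule :: "('r, 'x) ring_scheme \<Rightarrow> ('r, 'a, 'm) module_scheme \<Rightarrow> 'a \<Rightarrow> 'a set" where
  "cyclic_submodule R L x = (\<lambda>a. a \<odot>\<^bsub>L\<^esub> x) ` carrier R"

definition annihilator :: "('r, 'x) ring_scheme \<Rightarrow> ('r, 'a, 'm) module_scheme \<Rightarrow> 'a \<Rightarrow> 'r set" where
  "annihilator R L x = {a \<in> carrier R. a \<odot>\<^bsub>L\<^esub> x = \<zero>\<^bsub>L\<^esub>}"

text \<open>
  Written with \<open>h \<zero>\<close> in place of the zero of the target, so that the target need not be
  mentioned; for homomorphisms \<open>kernel_iff\<close> gives the usual description.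
\<close>

definition ker :: "('r, 'a, 'm) module_scheme \<Rightarrow> ('a \<Rightarrow> 'b) \<Rightarrow> 'a set" where
  "ker L h = {x \<in> carrier L. h x = h \<zero>\<^bsub>L\<^esub>}"

context left_module
begin

lemma smult_zero_left: "x \<in> carrier M \<Longrightarrow> \<zero>\<^bsub>R\<^esub> \<odot>\<^bsub>M\<^esub> x = \<zero>\<^bsub>M\<^esub>"
proof -
  assume x: "x \<in> carrier M"
  have "\<zero>\<^bsub>R\<^esub> \<odot>\<^bsub>M\<^esub> x \<oplus>\<^bsub>M\<^esub> \<zero>\<^bsub>R\<^esub> \<odot>\<^bsub>M\<^esub> x = \<zero>\<^bsub>R\<^esub> \<odot>\<^bsub>M\<^esub> x \<oplus>\<^bsub>M\<^esub> \<zero>\<^bsub>M\<^esub>"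
    using smult_l_distr [OF R.zero_closed R.zero_closed x] smult_closed [OF R.zero_closed x] by simp
  then show ?thesis using smult_closed [OF R.zero_closed x]
    by (simp add: M.add.l_cancel_one)
qed

lemma smult_zero_right: "a \<in> carrier R \<Longrightarrow> a \<odot>\<^bsub>M\<^esub> \<zero>\<^bsub>M\<^esub> = \<zero>\<^bsub>M\<^esub>"
proof -
  assume a: "a \<in> carrier R"
  have "a \<odot>\<^bsub>M\<^esub> \<zero>\<^bsub>M\<^esub> \<oplus>\<^bsub>M\<^esub> a \<odot>\<^bsub>M\<^esub> \<zero>\<^bsub>M\<^esub> = a \<odot>\<^bsub>M\<^esub> \<zero>\<^bsub>M\<^esub> \<oplus>\<^bsub>M\<^esub> \<zero>\<^bsub>M\<^esub>"
    using smult_r_distr [OF a M.zero_closed M.zero_closed] smult_closed [OF a M.zero_closed] by simp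
  then show ?thesis using smult_closed [OF a M.zero_closed]
    by (simp add: M.add.l_cancel_one)
qed

lemma smult_l_minus:
  assumes a: "a \<in> carrier R" and x: "x \<in> carrier M"
  shows "(\<ominus>\<^bsub>R\<^esub> a) \<odot>\<^bsub>M\<^esub> x = \<ominus>\<^bsub>M\<^esub> (a \<odot>\<^bsub>M\<^esub> x)"
proof -
  have "(\<ominus>\<^bsub>R\<^esub> a) \<odot>\<^bsub>M\<^esub> x \<oplus>\<^bsub>M\<^esub> a \<odot>\<^bsub>M\<^esub> x = \<zero>\<^bsub>M\<^esub>"
    using smult_l_distr [of "\<ominus>\<^bsub>R\<^esub> a" a x] a x by (simp add: R.l_neg smult_zero_left)
  then show ?thesis using a x by (metis M.minus_equality R.a_inv_closed smult_closed)
qed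

lemma smult_r_minus:
  assumes a: "a \<in> carrier R" and x: "x \<in> carrier M"
  shows "a \<odot>\<^bsub>M\<^esub> (\<ominus>\<^bsub>M\<^esub> x) = \<ominus>\<^bsub>M\<^esub> (a \<odot>\<^bsub>M\<^esub> x)"
proof -
  have "a \<odot>\<^bsub>M\<^esub> (\<ominus>\<^bsub>M\<^esub> x) \<oplus>\<^bsub>M\<^esub> a \<odot>\<^bsub>M\<^esub> x = \<zero>\<^bsub>M\<^esub>"
    using smult_r_distr [of a "\<ominus>\<^bsub>M\<^esub> x" x] a x by (simp add: M.l_neg smult_zero_right)
  then show ?thesis using a x by (metis M.minus_equality M.a_inv_closed smult_closed)
qed

lemma smult_minus_right:
  assumes "a \<in> carrier R" "x \<in> carrier M" "y \<in> carrier M"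
  shows "a \<odot>\<^bsub>M\<^esub> (x \<ominus>\<^bsub>M\<^esub> y) = a \<odot>\<^bsub>M\<^esub> x \<ominus>\<^bsub>M\<^esub> a \<odot>\<^bsub>M\<^esub> y"
  using assms by (simp add: a_minus_def smult_r_distr smult_r_minus)

lemma smult_minus_left:
  assumes "a \<in> carrier R" "b \<in> carrier R" "x \<in> carrier M"
  shows "(a \<ominus>\<^bsub>R\<^esub> b) \<odot>\<^bsub>M\<^esub> x = a \<odot>\<^bsub>M\<^esub> x \<ominus>\<^bsub>M\<^esub> b \<odot>\<^bsub>M\<^esub> x"
  using assms by (simp add: a_minus_def smult_l_distr smult_l_minus)

lemma minus_zero_right: "x \<in> carrier M \<Longrightarrow> x \<ominus>\<^bsub>M\<^esub> \<zero>\<^bsub>M\<^esub> = x"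
  by (simp add: M.minus_eq)

lemma minus_eq_zero_iff:
  assumes "x \<in> carrier M" "y \<in> carrier M"
  shows "x \<ominus>\<^bsub>M\<^esub> y = \<zero>\<^bsub>M\<^esub> \<longleftrightarrow> x = y"
  using assms by (metis M.add.inv_closed M.minus_equality M.minus_minus M.minus_eq M.r_neg)

lemma add_minus_cancel:
  assumes "x \<in> carrier M" "y \<in> carrier M"
  shows "(x \<oplus>\<^bsub>M\<^esub> y) \<ominus>\<^bsub>M\<^esub> x = y" "(x \<oplus>\<^bsub>M\<^esub> y) \<ominus>\<^bsub>M\<^esub> y = x"
proof -
  have 1: "(x \<oplus>\<^bsub>M\<^esub> y) \<ominus>\<^bsub>M\<^esub> y = x" if "x \<in> carrier M" "y \<in> carrier M" for x y
    using that by (simp add: M.minus_eq M.a_assoc M.r_neg)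
  show "(x \<oplus>\<^bsub>M\<^esub> y) \<ominus>\<^bsub>M\<^esub> x = y" using 1 [of y x] assms by (simp add: M.a_comm)
  show "(x \<oplus>\<^bsub>M\<^esub> y) \<ominus>\<^bsub>M\<^esub> y = x" using 1 assms by simp
qed

lemma submoduleD:
  assumes "U \<in> submodules R M"
  shows "U \<subseteq> carrier M" "\<zero>\<^bsub>M\<^esub> \<in> U" "\<And>x y. x \<in> U \<Longrightarrow> y \<in> U \<Longrightarrow> x \<oplus>\<^bsub>M\<^esub> y \<in> U"
    "\<And>a x. a \<in> carrier R \<Longrightarrow> x \<in> U \<Longrightarrow> a \<odot>\<^bsub>M\<^esub> x \<in> U"
    "\<And>x. x \<in> U \<Longrightarrow> \<ominus>\<^bsub>M\<^esub> x \<in> U" "\<And>x y. x \<in> U \<Longrightarrow> y \<in> U \<Longrightarrow> x \<ominus>\<^bsub>M\<^esub> y \<in> U"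
proof -
  show 1: "U \<subseteq> carrier M" "\<zero>\<^bsub>M\<^esub> \<in> U" and add: "\<And>x y. x \<in> U \<Longrightarrow> y \<in> U \<Longrightarrow> x \<oplus>\<^bsub>M\<^esub> y \<in> U"
    and sm: "\<And>a x. a \<in> carrier R \<Longrightarrow> x \<in> U \<Longrightarrow> a \<odot>\<^bsub>M\<^esub> x \<in> U"
    using assms by (auto simp: submodules_def)
  show inv: "\<ominus>\<^bsub>M\<^esub> x \<in> U" if "x \<in> U" for x
  proof -
    have "(\<ominus>\<^bsub>R\<^esub> \<one>\<^bsub>R\<^esub>) \<odot>\<^bsub>M\<^esub> x = \<ominus>\<^bsub>M\<^esub> x"
      using that 1(1) by (simp add: smult_l_minus smult_one subset_iff)
    then show ?thesis using sm [of "\<ominus>\<^bsub>R\<^esub> \<one>\<^bsub>R\<^esub>" x] that by simp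
  qed
  show "\<And>x y. x \<in> U \<Longrightarrow> y \<in> U \<Longrightarrow> x \<ominus>\<^bsub>M\<^esub> y \<in> U" using add inv by (simp add: a_minus_def)
qed

lemma zero_submodule: "{\<zero>\<^bsub>M\<^esub>} \<in> submodules R M"
  by (auto simp: submodules_def smult_zero_right)

lemma Int_submodule: "U \<in> submodules R M \<Longrightarrow> W \<in> submodules R M \<Longrightarrow> U \<inter> W \<in> submodules R M"
  by (auto simp: submodules_def)

lemma cyclic_submodule: "x \<in> carrier M \<Longrightarrow> cyclic_submodule R M x \<in> submodules R M"
proof -
  assume x: "x \<in> carrier M"
  have "a \<odot>\<^bsub>M\<^esub> x \<oplus>\<^bsub>M\<^esub> b \<odot>\<^bsub>M\<^esub> x \<in> cyclic_submodule R M x" if "a \<in> carrier R" "b \<in> carrier R" for a b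
    unfolding cyclic_submodule_def
    by (rule image_eqI [where x = "a \<oplus>\<^bsub>R\<^esub> b"]) (use that x in \<open>simp_all add: smult_l_distr\<close>)
  moreover have "a \<odot>\<^bsub>M\<^esub> (b \<odot>\<^bsub>M\<^esub> x) \<in> cyclic_submodule R M x" if "a \<in> carrier R" "b \<in> carrier R" for a b
    unfolding cyclic_submodule_def
    by (rule image_eqI [where x = "a \<otimes>\<^bsub>R\<^esub> b"]) (use that x in \<open>simp_all add: smult_assoc\<close>)
  moreover have "\<zero>\<^bsub>M\<^esub> \<in> cyclic_submodule R M x"
    unfolding cyclic_submodule_def
    by (rule image_eqI [where x = "\<zero>\<^bsub>R\<^esub>"]) (use x in \<open>simp_all add: smult_zero_left\<close>)
  ultimately show ?thesis
    using x by (auto simp: submodules_def cyclic_submodule_def smult_closed)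
qed

lemma mem_cyclic_submodule: "x \<in> carrier M \<Longrightarrow> x \<in> cyclic_submodule R M x"
  unfolding cyclic_submodule_def by (rule image_eqI [where x = "\<one>\<^bsub>R\<^esub>"]) (simp_all add: smult_one)

lemma sum_submodule:
  assumes U: "U \<in> submodules R M" and W: "W \<in> submodules R M"
  shows "submodule_sum M U W \<in> submodules R M"
proof -
  note U' = submoduleD [OF U] and W' = submoduleD [OF W]
  have "(x \<oplus>\<^bsub>M\<^esub> y) \<oplus>\<^bsub>M\<^esub> (x' \<oplus>\<^bsub>M\<^esub> y') \<in> submodule_sum M U W"
    if "x \<in> U" "x' \<in> U" "y \<in> W" "y' \<in> W" for x y x' y'
  proof -
    have "(x \<oplus>\<^bsub>M\<^esub> y) \<oplus>\<^bsub>M\<^esub> (x' \<oplus>\<^bsub>M\<^esub> y') = (x \<oplus>\<^bsub>M\<^esub> x') \<oplus>\<^bsub>M\<^esub> (y \<oplus>\<^bsub>M\<^esub> y')"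
      using that U'(1) W'(1) by (simp add: M.a_ac subset_iff)
    then show ?thesis using U'(3) [OF that(1,2)] W'(3) [OF that(3,4)]
      unfolding submodule_sum_def by blast
  qed
  moreover have "a \<odot>\<^bsub>M\<^esub> (x \<oplus>\<^bsub>M\<^esub> y) \<in> submodule_sum M U W"
    if "x \<in> U" "y \<in> W" "a \<in> carrier R" for x y a
    using U'(4) [OF that(3,1)] W'(4) [OF that(3,2)] that U'(1) W'(1)
    by (simp add: submodule_sum_def smult_r_distr subset_iff) blast
  moreover have "\<zero>\<^bsub>M\<^esub> \<in> submodule_sum M U W"
    using U'(2) W'(2) by (auto simp: submodule_sum_def intro!: exI [of _ "\<zero>\<^bsub>M\<^esub>"])
  ultimately show ?thesis
    using U'(1) W'(1) by (auto simp: submodules_def submodule_sum_def subset_iff)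
qed

lemma sum_upper:
  assumes U: "U \<in> submodules R M" and W: "W \<in> submodules R M"
  shows "U \<subseteq> submodule_sum M U W" "W \<subseteq> submodule_sum M U W"
proof -
  note U' = submoduleD [OF U] and W' = submoduleD [OF W]
  show "U \<subseteq> submodule_sum M U W"
    using U'(1) W'(2) by (force simp: submodule_sum_def subset_iff)
  show "W \<subseteq> submodule_sum M U W"
    using W'(1) U'(2) by (force simp: submodule_sum_def subset_iff)
qed

lemma sum_least:
  assumes "D \<in> submodules R M" "U \<subseteq> D" "W \<subseteq> D"
  shows "submodule_sum M U W \<subseteq> D"
  using assms submoduleD(3) [OF assms(1)] by (auto simp: submodule_sum_def)

end

section \<open>Homomorphisms, kernels and quotient modules\<close>

lemma finite_moduleD:
  assumes "finite_module R L"
  shows "left_module R L" "finite (carrier L)"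
  using assms by (auto simp: finite_module_def)

lemma HomD:
  assumes "f \<in> Hom R L N"
  shows "\<And>x. x \<in> carrier L \<Longrightarrow> f x \<in> carrier N"
    "\<And>x y. x \<in> carrier L \<Longrightarrow> y \<in> carrier L \<Longrightarrow> f (x \<oplus>\<^bsub>L\<^esub> y) = f x \<oplus>\<^bsub>N\<^esub> f y"
    "\<And>a x. a \<in> carrier R \<Longrightarrow> x \<in> carrier L \<Longrightarrow> f (a \<odot>\<^bsub>L\<^esub> x) = a \<odot>\<^bsub>N\<^esub> f x"
    "f \<in> extensional (carrier L)"
  using assms by (auto simp: Hom_def PiE_def)

lemma EpiD:
  assumes "f \<in> Epi R L N"
  shows "f \<in> Hom R L N" "f ` carrier L = carrier N"
  using assms by (auto simp: Epi_def)

lemma Iso_imp_Epi: "f \<in> Iso R L N \<Longrightarrow> f \<in> Epi R L N"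
  by (auto simp: Iso_def Epi_def bij_betw_def)

lemma Hom_zero:
  assumes L: "left_module R L" and N: "left_module R N" and f: "f \<in> Hom R L N"
  shows "f \<zero>\<^bsub>L\<^esub> = \<zero>\<^bsub>N\<^esub>"
proof -
  interpret L: left_module R L by fact
  interpret N: left_module R N by fact
  have "f \<zero>\<^bsub>L\<^esub> = f (\<zero>\<^bsub>R\<^esub> \<odot>\<^bsub>L\<^esub> \<zero>\<^bsub>L\<^esub>)" by (simp add: L.smult_zero_left)
  also have "\<dots> = \<zero>\<^bsub>R\<^esub> \<odot>\<^bsub>N\<^esub> f \<zero>\<^bsub>L\<^esub>" using HomD(3) [OF f] by simp
  also have "\<dots> = \<zero>\<^bsub>N\<^esub>" using HomD(1) [OF f] by (simp add: N.smult_zero_left)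
  finally show ?thesis .
qed

lemma Hom_minus:
  assumes L: "left_module R L" and N: "left_module R N" and f: "f \<in> Hom R L N"
    and xy: "x \<in> carrier L" "y \<in> carrier L"
  shows "f (x \<ominus>\<^bsub>L\<^esub> y) = f x \<ominus>\<^bsub>N\<^esub> f y"
proof -
  interpret L: left_module R L by fact
  interpret N: left_module R N by fact
  have "f (\<ominus>\<^bsub>L\<^esub> y) \<oplus>\<^bsub>N\<^esub> f y = \<zero>\<^bsub>N\<^esub>"
    using HomD(2) [OF f, of "\<ominus>\<^bsub>L\<^esub> y" y] xy Hom_zero [OF L N f] by (simp add: L.M.l_neg)
  then have "f (\<ominus>\<^bsub>L\<^esub> y) = \<ominus>\<^bsub>N\<^esub> f y"
    using xy HomD(1) [OF f] by (metis L.M.a_inv_closed N.M.minus_equality)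
  then show ?thesis using xy HomD(2) [OF f] by (simp add: a_minus_def)
qed

lemma kernel_iff:
  assumes "left_module R L" "left_module R N" "f \<in> Hom R L N"
  shows "x \<in> ker L f \<longleftrightarrow> x \<in> carrier L \<and> f x = \<zero>\<^bsub>N\<^esub>"
  using Hom_zero [OF assms] by (auto simp: ker_def)

lemma Hom_eq_iff:
  assumes L: "left_module R L" and N: "left_module R N" and f: "f \<in> Hom R L N"
    and xy: "x \<in> carrier L" "y \<in> carrier L"
  shows "f x = f y \<longleftrightarrow> x \<ominus>\<^bsub>L\<^esub> y \<in> ker L f"
proof -
  interpret L: left_module R L by fact
  interpret N: left_module R N by fact
  show ?thesis
    using xy HomD(1) [OF f] by (simp add: kernel_iff [OF L N f] Hom_minus [OF L N f] N.minus_eq_zero_iff)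
qed

lemma kernel_submodule:
  assumes L: "left_module R L" and N: "left_module R N" and f: "f \<in> Hom R L N"
  shows "ker L f \<in> submodules R L"
proof -
  interpret L: left_module R L by fact
  interpret N: left_module R N by fact
  show ?thesis
    using HomD(2,3) [OF f] Hom_zero [OF L N f]
    by (auto simp: submodules_def kernel_iff [OF L N f] L.smult_closed N.smult_zero_right)
qed

lemma Epi_compose:
  assumes L: "left_module R L" and f: "f \<in> Epi R L N" and g: "g \<in> Epi R N P"
  shows "compose (carrier L) g f \<in> Epi R L P"
proof -
  interpret L: left_module R L by fact
  note f' = HomD [OF EpiD(1) [OF f]] and g' = HomD [OF EpiD(1) [OF g]]
  have "compose (carrier L) g f ` carrier L = carrier P"
    using EpiD(2) [OF f] EpiD(2) [OF g] by (simp add: surj_compose)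
  then show ?thesis
    using f' g' by (auto simp: Epi_def Hom_def compose_eq L.smult_closed PiE_iff)
qed

lemma Iso_compose:
  assumes L: "left_module R L" and f: "f \<in> Iso R L N" and g: "g \<in> Iso R N P"
  shows "compose (carrier L) g f \<in> Iso R L P"
  using Epi_compose [OF L Iso_imp_Epi [OF f] Iso_imp_Epi [OF g]] f g
    FuncSet.bij_betw_compose [of f "carrier L" "carrier N" g "carrier P"]
  by (simp add: Iso_def Epi_def)

lemma id_in_Iso: "finite_module R L \<Longrightarrow> (\<lambda>x \<in> carrier L. x) \<in> Iso R L L"
  using id_in_Epi [of R L] by (auto simp: Iso_def Epi_def bij_betw_def inj_on_def)

lemma finite_Hom: "finite_module R L \<Longrightarrow> finite_module R N \<Longrightarrow> finite (Hom R L N)"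
  by (rule finite_subset [of _ "carrier L \<rightarrow>\<^sub>E carrier N"]) (auto simp: Hom_def finite_module_def intro: finite_PiE)

lemma finite_Epi: "finite_module R L \<Longrightarrow> finite_module R N \<Longrightarrow> finite (Epi R L N)"
  by (rule finite_subset [OF _ finite_Hom [of R L N]]) (auto simp: Epi_def)

lemma finite_Iso: "finite_module R L \<Longrightarrow> finite_module R N \<Longrightarrow> finite (Iso R L N)"
  by (rule finite_subset [OF _ finite_Hom [of R L N]]) (auto simp: Iso_def)

lemma card_Aut_pos: "finite_module R L \<Longrightarrow> card (Aut R L) > 0"
  using finite_Iso [of R L L] id_in_Iso [of R L] by (auto simp: card_gt_0_iff)

lemma Iso_inv:
  assumes L: "left_module R L" and N: "left_module R N" and f: "f \<in> Iso R L N"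
  shows "(\<lambda>y \<in> carrier N. inv_into (carrier L) f y) \<in> Iso R N L"
proof -
  interpret L: left_module R L by fact
  interpret N: left_module R N by fact
  let ?g = "inv_into (carrier L) f"
  have b: "bij_betw f (carrier L) (carrier N)" and f1: "f \<in> Hom R L N" using f by (auto simp: Iso_def)
  note f' = HomD [OF f1]
  have gb: "bij_betw ?g (carrier N) (carrier L)" using b by (rule bij_betw_inv_into)
  have gL: "?g y \<in> carrier L" and fg: "f (?g y) = y" if "y \<in> carrier N" for y
    using gb b that by (auto simp: bij_betw_def f_inv_into_f)
  have inj: "x = y" if "f x = f y" "x \<in> carrier L" "y \<in> carrier L" for x y
    using b that by (auto simp: bij_betw_def inj_on_def)
  have "?g (x \<oplus>\<^bsub>N\<^esub> y) = ?g x \<oplus>\<^bsub>L\<^esub> ?g y" if "x \<in> carrier N" "y \<in> carrier N" for x y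
    by (rule inj) (use that gL fg f' in auto)
  moreover have "?g (a \<odot>\<^bsub>N\<^esub> y) = a \<odot>\<^bsub>L\<^esub> ?g y" if "a \<in> carrier R" "y \<in> carrier N" for a y
    by (rule inj) (use that gL fg f' in \<open>auto simp: L.smult_closed N.smult_closed\<close>)
  ultimately show ?thesis using gb gL by (auto simp: Iso_def Hom_def N.smult_closed)
qed

text \<open>
  All module axioms are equations between terms, except for the existence of inverses, so they pass
  to the image of any surjection that respects the operations.
\<close>

lemma left_module_image:
  assumes L: "left_module R L"
    and p: "p ` carrier L = carrier Q" "p \<zero>\<^bsub>L\<^esub> = \<zero>\<^bsub>Q\<^esub>"
      "\<And>x y. x \<in> carrier L \<Longrightarrow> y \<in> carrier L \<Longrightarrow> p (x \<oplus>\<^bsub>L\<^esub> y) = p x \<oplus>\<^bsub>Q\<^esub> p y"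
      "\<And>a x. a \<in> carrier R \<Longrightarrow> x \<in> carrier L \<Longrightarrow> p (a \<odot>\<^bsub>L\<^esub> x) = a \<odot>\<^bsub>Q\<^esub> p x"
  shows "left_module R Q"
proof -
  interpret L: left_module R L by fact
  have ex: "\<exists>x \<in> carrier L. y = p x" if "y \<in> carrier Q" for y
    using p(1) that by blast
  have pc: "p x \<in> carrier Q" if "x \<in> carrier L" for x using p(1) that by blast
  note p' = p(3,4) [symmetric]
  have "abelian_group Q"
  proof (rule abelian_groupI)
    show "x \<oplus>\<^bsub>Q\<^esub> y \<in> carrier Q" if "x \<in> carrier Q" "y \<in> carrier Q" for x y
      using ex [OF that(1)] ex [OF that(2)] by (auto simp: p' pc)
    show "\<zero>\<^bsub>Q\<^esub> \<in> carrier Q" using pc p(2) by (metis L.M.zero_closed)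
    show "(x \<oplus>\<^bsub>Q\<^esub> y) \<oplus>\<^bsub>Q\<^esub> z = x \<oplus>\<^bsub>Q\<^esub> (y \<oplus>\<^bsub>Q\<^esub> z)"
      if "x \<in> carrier Q" "y \<in> carrier Q" "z \<in> carrier Q" for x y z
      using ex [OF that(1)] ex [OF that(2)] ex [OF that(3)] by (auto simp: p' L.M.a_assoc)
    show "x \<oplus>\<^bsub>Q\<^esub> y = y \<oplus>\<^bsub>Q\<^esub> x" if "x \<in> carrier Q" "y \<in> carrier Q" for x y
      using ex [OF that(1)] ex [OF that(2)] by (auto simp: p' L.M.a_comm)
    show "\<zero>\<^bsub>Q\<^esub> \<oplus>\<^bsub>Q\<^esub> x = x" if x: "x \<in> carrier Q" for x
    proof -
      obtain u where u: "u \<in> carrier L" "x = p u" using ex [OF x] by blast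
      show ?thesis using p(3) [of "\<zero>\<^bsub>L\<^esub>" u] u p(2) by (metis L.M.l_zero L.M.zero_closed)
    qed
    show "\<exists>y \<in> carrier Q. y \<oplus>\<^bsub>Q\<^esub> x = \<zero>\<^bsub>Q\<^esub>" if x: "x \<in> carrier Q" for x
    proof -
      obtain u where u: "u \<in> carrier L" "x = p u" using ex [OF x] by blast
      show ?thesis
      proof
        have "p (\<ominus>\<^bsub>L\<^esub> u) \<oplus>\<^bsub>Q\<^esub> p u = p (\<ominus>\<^bsub>L\<^esub> u \<oplus>\<^bsub>L\<^esub> u)"
          by (rule p(3) [symmetric]) (use u(1) in simp_all)
        also have "\<dots> = \<zero>\<^bsub>Q\<^esub>" using u p(2) by (simp add: L.M.l_neg)
        finally show "p (\<ominus>\<^bsub>L\<^esub> u) \<oplus>\<^bsub>Q\<^esub> x = \<zero>\<^bsub>Q\<^esub>" by (simp only: u)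
        show "p (\<ominus>\<^bsub>L\<^esub> u) \<in> carrier Q" using u pc by simp
      qed
    qed
  qed
  then interpret Q: abelian_group Q .
  show ?thesis
  proof (unfold_locales, goal_cases)
    case (1 a x) then show ?case using ex [OF 1(2)] by (auto simp: p' pc L.smult_closed)
  next
    case (2 a b x) then show ?case using ex [OF 2(3)] by (auto simp: p' L.smult_l_distr L.smult_closed)
  next
    case (3 a x y) then show ?case using ex [OF 3(2)] ex [OF 3(3)]
      by (auto simp: p' L.smult_r_distr L.smult_closed)
  next
    case (4 a b x) then show ?case using ex [OF 4(3)] by (auto simp: p' L.smult_assoc L.smult_closed)
  next
    case (5 x) then show ?case using ex [OF 5(1)] by (auto simp: p' L.smult_one)
  qed
qed

text \<open>
  The least element of each coset of \<open>U\<close> represents that coset, so that the quotient module has a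
  carrier of natural numbers again.
\<close>

lemma ex_quotient:
  assumes L: "finite_module R L" and U: "U \<in> submodules R L"
  obtains Q p where "finite_module R Q" "p \<in> Epi R L Q" "ker L p = U"
proof -
  interpret L: left_module R L using L by (rule finite_moduleD)
  note U' = L.submoduleD [OF U]
  define p where "p = (\<lambda>x \<in> carrier L. LEAST y. y \<in> carrier L \<and> x \<ominus>\<^bsub>L\<^esub> y \<in> U)"
  have swap: "y \<ominus>\<^bsub>L\<^esub> x \<in> U" if "x \<ominus>\<^bsub>L\<^esub> y \<in> U" "x \<in> carrier L" "y \<in> carrier L" for x y
  proof -
    have "\<ominus>\<^bsub>L\<^esub> (x \<ominus>\<^bsub>L\<^esub> y) = y \<ominus>\<^bsub>L\<^esub> x"
      using that by (simp add: a_minus_def L.M.minus_add L.M.a_comm)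
    then show ?thesis using U'(5) [OF that(1)] by simp
  qed
  have trans: "x \<ominus>\<^bsub>L\<^esub> z \<in> U" if "x \<ominus>\<^bsub>L\<^esub> y \<in> U" "y \<ominus>\<^bsub>L\<^esub> z \<in> U" "x \<in> carrier L" "y \<in> carrier L" "z \<in> carrier L" for x y z
  proof -
    have "(x \<ominus>\<^bsub>L\<^esub> y) \<oplus>\<^bsub>L\<^esub> (y \<ominus>\<^bsub>L\<^esub> z) = x \<ominus>\<^bsub>L\<^esub> z"
      using that by (simp add: a_minus_def L.M.a_ac L.M.r_neg1 L.M.r_neg2)
    then show ?thesis using U'(3) [OF that(1,2)] by simp
  qed
  have p: "p x \<in> carrier L \<and> x \<ominus>\<^bsub>L\<^esub> p x \<in> U" if x: "x \<in> carrier L" for x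
  proof -
    have "x \<in> carrier L \<and> x \<ominus>\<^bsub>L\<^esub> x \<in> U" using x U'(2) by (simp add: a_minus_def L.M.r_neg)
    from LeastI [of "\<lambda>y. y \<in> carrier L \<and> x \<ominus>\<^bsub>L\<^esub> y \<in> U", OF this] show ?thesis
      using x by (simp add: p_def)
  qed
  have p_eq: "p x = p y \<longleftrightarrow> x \<ominus>\<^bsub>L\<^esub> y \<in> U" if xy: "x \<in> carrier L" "y \<in> carrier L" for x y
  proof
    assume "p x = p y"
    then show "x \<ominus>\<^bsub>L\<^esub> y \<in> U" using p [OF xy(1)] p [OF xy(2)] swap trans xy by metis
  next
    assume "x \<ominus>\<^bsub>L\<^esub> y \<in> U"
    then have "(z \<in> carrier L \<and> x \<ominus>\<^bsub>L\<^esub> z \<in> U) \<longleftrightarrow> (z \<in> carrier L \<and> y \<ominus>\<^bsub>L\<^esub> z \<in> U)" for z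
      using xy swap trans by meson
    then show "p x = p y" using xy by (simp add: p_def)
  qed
  define Q :: "('a, nat) module" where "Q = \<lparr>carrier = p ` carrier L, monoid.mult = (\<lambda>_ _. 0), one = 0, zero = p \<zero>\<^bsub>L\<^esub>,
    add = (\<lambda>x y. p (x \<oplus>\<^bsub>L\<^esub> y)), smult = (\<lambda>a x. p (a \<odot>\<^bsub>L\<^esub> x))\<rparr>"
  have add: "p (x \<oplus>\<^bsub>L\<^esub> y) = p x \<oplus>\<^bsub>Q\<^esub> p y" if xy: "x \<in> carrier L" "y \<in> carrier L" for x y
  proof -
    have "(x \<oplus>\<^bsub>L\<^esub> y) \<ominus>\<^bsub>L\<^esub> (p x \<oplus>\<^bsub>L\<^esub> p y) = (x \<ominus>\<^bsub>L\<^esub> p x) \<oplus>\<^bsub>L\<^esub> (y \<ominus>\<^bsub>L\<^esub> p y)"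
      using xy p by (simp add: a_minus_def L.M.minus_add L.M.a_ac)
    then have "(x \<oplus>\<^bsub>L\<^esub> y) \<ominus>\<^bsub>L\<^esub> (p x \<oplus>\<^bsub>L\<^esub> p y) \<in> U" using p U'(3) xy by simp
    then show ?thesis using xy p p_eq by (simp add: Q_def)
  qed
  have smult: "p (a \<odot>\<^bsub>L\<^esub> x) = a \<odot>\<^bsub>Q\<^esub> p x" if ax: "a \<in> carrier R" "x \<in> carrier L" for a x
  proof -
    have "a \<odot>\<^bsub>L\<^esub> x \<ominus>\<^bsub>L\<^esub> a \<odot>\<^bsub>L\<^esub> p x \<in> U"
      using ax p U'(4) [OF ax(1), of "x \<ominus>\<^bsub>L\<^esub> p x"] by (simp add: L.smult_minus_right)
    then show ?thesis using ax p p_eq by (simp add: Q_def L.smult_closed)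
  qed
  have "left_module R Q"
    by (rule left_module_image [OF L.left_module_axioms, of p]) (simp_all add: add smult, simp_all add: Q_def)
  then have 1: "finite_module R Q"
    using finite_moduleD(2) [OF L] by (simp add: finite_module_def Q_def)
  have "p \<in> Hom R L Q"
    using add smult by (auto simp: Hom_def Q_def p_def)
  then have 2: "p \<in> Epi R L Q" by (simp add: Epi_def) (simp add: Q_def)
  have "ker L p = U"
    using U'(1) p_eq [of _ "\<zero>\<^bsub>L\<^esub>"] by (auto simp: ker_def L.minus_zero_right)
  then show ?thesis using that 1 2 by blast
qed

text \<open>
  The class of \<open>L/U\<close> in the quotient lattice. It does not depend on how the quotient module is
  realised (\<open>quotient_class_quo\<close>).
\<close>

section \<open>The quotient lattice as the dual of the submodule lattice\<close>

definition quo :: "('r, 'x) ring_scheme \<Rightarrow> ('r, nat) module \<Rightarrow> nat set \<Rightarrow> (('r, nat) module \<times> (nat \<Rightarrow> nat)) set" where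
  "quo R L U = (SOME Q. \<exists>H h. finite_module R H \<and> h \<in> Epi R L H \<and> ker L h = U \<and>
     Q = quotient_class R L H h)"

lemma Epi_eq_iff:
  assumes "finite_module R L" "finite_module R H" "h \<in> Epi R L H" "x \<in> carrier L" "y \<in> carrier L"
  shows "h x = h y \<longleftrightarrow> x \<ominus>\<^bsub>L\<^esub> y \<in> ker L h"
  using Hom_eq_iff [OF finite_moduleD(1) finite_moduleD(1) EpiD(1)] assms by blast

lemma kernel_subset_iff:
  assumes L: "finite_module R L" and H: "finite_module R H" "h \<in> Epi R L H"
    and H': "finite_module R H'" "h' \<in> Epi R L H'"
  shows "ker L h \<subseteq> ker L h' \<longleftrightarrow> (\<forall>x \<in> carrier L. \<forall>y \<in> carrier L. h x = h y \<longrightarrow> h' x = h' y)"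
proof -
  interpret L: left_module R L using L by (rule finite_moduleD)
  show ?thesis (is "?l \<longleftrightarrow> ?r")
  proof
    show "?l \<Longrightarrow> ?r" using Epi_eq_iff [OF L H] Epi_eq_iff [OF L H'] by blast
    show "?r \<Longrightarrow> ?l" unfolding ker_def using L.M.zero_closed by blast
  qed
qed

lemma quotient_class_quo:
  assumes L: "finite_module R L" and H: "finite_module R H" "h \<in> Epi R L H"
  shows "quotient_class R L H h = quo R L (ker L h)"
proof -
  have "\<exists>Q G g. finite_module R G \<and> g \<in> Epi R L G \<and> ker L g = ker L h \<and> Q = quotient_class R L G g"
    using H by blast
  from someI_ex [OF this] obtain G g where G: "finite_module R G" "g \<in> Epi R L G" "ker L g = ker L h"
    and q: "quo R L (ker L h) = quotient_class R L G g"
    unfolding quo_def by blast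
  show ?thesis
    unfolding q quotient_class_eq_iff [OF L H G(1,2)]
    using G kernel_subset_iff [OF L H G(1,2)] kernel_subset_iff [OF L G(1,2) H] by blast
qed

lemma quo_obtain:
  assumes L: "finite_module R L" and U: "U \<in> submodules R L"
  obtains H h where "finite_module R H" "h \<in> Epi R L H" "ker L h = U" "quo R L U = quotient_class R L H h"
  using ex_quotient [OF L U] quotient_class_quo [OF L] by metis

text \<open>
  With \<open>quo_carrier\<close> this is the anti-isomorphism between submodules and quotients through which all
  lattice-theoretic data of the quotient lattice are computed below.
\<close>

lemma quo_le_iff:
  assumes L: "finite_module R L" and U: "U \<in> submodules R L" and W: "W \<in> submodules R L"
  shows "quo R L U \<sqsubseteq>\<^bsub>quotient_lattice R L\<^esub> quo R L W \<longleftrightarrow> W \<subseteq> U"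
proof -
  obtain H h where H: "finite_module R H" "h \<in> Epi R L H" "ker L h = U" "quo R L U = quotient_class R L H h"
    using quo_obtain [OF L U] .
  obtain G g where G: "finite_module R G" "g \<in> Epi R L G" "ker L g = W" "quo R L W = quotient_class R L G g"
    using quo_obtain [OF L W] .
  show ?thesis
    unfolding H(4) G(4) le_quotient_class_iff [OF L G(1,2) H(1,2)] kernel_subset_iff [OF L G(1,2) H(1,2), symmetric]
      H(3) G(3) ..
qed

lemma quo_carrier:
  assumes L: "finite_module R L"
  shows "carrier (quotient_lattice R L) = quo R L ` submodules R L"
proof (intro equalityI subsetI)
  fix Q assume "Q \<in> carrier (quotient_lattice R L)"
  then obtain H h where H: "finite_module R H" "h \<in> Epi R L H" "Q = quotient_class R L H h"
    by (auto simp: quotient_lattice_def)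
  then show "Q \<in> quo R L ` submodules R L"
    using quotient_class_quo [OF L H(1,2)]
      kernel_submodule [OF finite_moduleD(1) [OF L] finite_moduleD(1) [OF H(1)] EpiD(1) [OF H(2)]] by blast
next
  fix Q assume "Q \<in> quo R L ` submodules R L"
  then show "Q \<in> carrier (quotient_lattice R L)"
    using quo_obtain [OF L] by (force simp: quotient_lattice_def)
qed

lemma quo_in_carrier:
  "finite_module R L \<Longrightarrow> U \<in> submodules R L \<Longrightarrow> quo R L U \<in> carrier (quotient_lattice R L)"
  by (simp add: quo_carrier)

lemma quo_eq_iff:
  assumes L: "finite_module R L" and U: "U \<in> submodules R L" and W: "W \<in> submodules R L"
  shows "quo R L U = quo R L W \<longleftrightarrow> U = W"
  using quo_le_iff [OF L U W] quo_le_iff [OF L W U] quo_le_iff [OF L U U] by auto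

lemma inj_on_quo: "finite_module R L \<Longrightarrow> inj_on (quo R L) (submodules R L)"
  by (auto simp: inj_on_def quo_eq_iff)

lemma kernel_in_submodules:
  "finite_module R L \<Longrightarrow> finite_module R H \<Longrightarrow> h \<in> Epi R L H \<Longrightarrow> ker L h \<in> submodules R L"
  using kernel_submodule [OF finite_moduleD(1) finite_moduleD(1) EpiD(1)] by blast

lemma top_quotient_quo:
  assumes L: "finite_module R L"
  shows "top_quotient R L = quo R L {\<zero>\<^bsub>L\<^esub>}"
proof -
  interpret L: left_module R L using L by (rule finite_moduleD)
  have "ker L (\<lambda>x \<in> carrier L. x) = {\<zero>\<^bsub>L\<^esub>}" by (auto simp: ker_def)
  then show ?thesis
    using quotient_class_quo [OF L L id_in_Epi [OF L]] by (simp add: top_quotient_def)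
qed

lemma join_quo:
  assumes L: "finite_module R L" and U: "U \<in> submodules R L" and W: "W \<in> submodules R L"
  shows "quo R L U \<squnion>\<^bsub>quotient_lattice R L\<^esub> quo R L W = quo R L (U \<inter> W)"
proof -
  let ?P = "quotient_lattice R L"
  interpret P: partial_order ?P by (rule partial_order_quotient_lattice [OF L])
  interpret L: left_module R L using L by (rule finite_moduleD)
  have UW: "U \<inter> W \<in> submodules R L" by (rule L.Int_submodule [OF U W])
  have l: "least ?P (quo R L (U \<inter> W)) (Upper ?P {quo R L U, quo R L W})"
    using UW U W by (auto simp: least_def Upper_def quo_carrier [OF L] quo_le_iff [OF L])
  show ?thesis
    unfolding join_def sup_def
    by (rule some_equality, rule l) (use l P.least_unique in blast)
qed

lemma meet_quo:
  assumes L: "finite_module R L" and U: "U \<in> submodules R L" and W: "W \<in> submodules R L"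
  shows "quo R L U \<sqinter>\<^bsub>quotient_lattice R L\<^esub> quo R L W = quo R L (submodule_sum L U W)"
proof -
  let ?P = "quotient_lattice R L"
  interpret P: partial_order ?P by (rule partial_order_quotient_lattice [OF L])
  interpret L: left_module R L using L by (rule finite_moduleD)
  have UW: "submodule_sum L U W \<in> submodules R L" by (rule L.sum_submodule [OF U W])
  have l: "greatest ?P (quo R L (submodule_sum L U W)) (Lower ?P {quo R L U, quo R L W})"
    using UW U W L.sum_upper [OF U W] L.sum_least
    by (auto simp: greatest_def Lower_def quo_carrier [OF L] quo_le_iff [OF L])
  show ?thesis
    unfolding meet_def inf_def
    by (rule some_equality, rule l) (use l P.greatest_unique in blast)
qed

text \<open>
  This is \<open>\<mu>(L/U \<rightarrow> L/K)\<close> for submodules \<open>U \<subseteq> K\<close>, computed in the quotient lattice of the fixed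
  module \<open>L\<close>; varying \<open>U\<close> makes recursions over the submodules of \<open>K\<close> possible.
\<close>

section \<open>The Moebius function of the submodule lattice\<close>

definition mob :: "('r, 'x) ring_scheme \<Rightarrow> ('r, nat) module \<Rightarrow> nat set \<Rightarrow> nat set \<Rightarrow> int" where
  "mob R L K U = moebius (quotient_lattice R L) (quo R L K) (quo R L U)"

definition maximal_submodules :: "('r, 'x) ring_scheme \<Rightarrow> ('r, nat) module \<Rightarrow> nat set \<Rightarrow> nat set set" where
  "maximal_submodules R L K =
    {V \<in> submodules R L. V \<subset> K \<and> (\<forall>W \<in> submodules R L. V \<subset> W \<and> W \<subseteq> K \<longrightarrow> W = K)}"

text \<open>
  For \<open>V\<close> maximal in \<open>K\<close> these are the complements of \<open>V\<close> in \<open>K\<close>: a nonzero \<open>T\<close> that meets \<open>V\<close>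
  in zero is not contained in \<open>V\<close>, so that \<open>T + V = K\<close>.
\<close>

definition complements :: "('r, 'x) ring_scheme \<Rightarrow> ('r, nat) module \<Rightarrow> nat set \<Rightarrow> nat set \<Rightarrow> nat set set" where
  "complements R L K V = {T \<in> submodules R L. T \<subseteq> K \<and> T \<noteq> {\<zero>\<^bsub>L\<^esub>} \<and> T \<inter> V = {\<zero>\<^bsub>L\<^esub>}}"

lemma mu_eq_mob:
  assumes "finite_module R L" "finite_module R N" "\<pi> \<in> Epi R L N"
  shows "mu R L N \<pi> = mob R L (ker L \<pi>) {\<zero>\<^bsub>L\<^esub>}"
  using assms by (simp add: mu_def mob_def top_quotient_quo quotient_class_quo)

lemma finite_submodules: "finite_module R L \<Longrightarrow> finite (submodules R L)"
  by (rule finite_subset [of _ "Pow (carrier L)"]) (auto simp: submodules_def finite_module_def)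

lemma finite_submodule: "finite_module R L \<Longrightarrow> U \<in> submodules R L \<Longrightarrow> finite U"
  by (auto simp: submodules_def finite_module_def intro: finite_subset)

lemma mob_sum:
  assumes L: "finite_module R L" and K: "K \<in> submodules R L" and U: "U \<in> submodules R L" and UK: "U \<subseteq> K"
  shows "(\<Sum>W \<in> {W \<in> submodules R L. U \<subseteq> W \<and> W \<subseteq> K}. mob R L K W) = (if U = K then 1 else 0)"
proof (cases "U = K")
  case True
  have eq: "{W \<in> submodules R L. U \<subseteq> W \<and> W \<subseteq> K} = {K}" using True K by auto
  have "mob R L K K = 1"
    unfolding mob_def moebius.simps [of _ "quo R L K" "quo R L K"]
    using partial_order_quotient_lattice [OF L] finite_carrier_quotient_lattice [OF L] quo_in_carrier [OF L K]
      quo_le_iff [OF L K K] by simp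
  then show ?thesis unfolding eq using True by simp
next
  case False
  let ?P = "quotient_lattice R L"
  let ?S = "{W \<in> submodules R L. U \<subseteq> W \<and> W \<subseteq> K}"
  have fin: "finite ?S" using finite_submodules [OF L] by simp
  have img: "{z \<in> \<lbrace>quo R L K..quo R L U\<rbrace>\<^bsub>?P\<^esub>. z \<noteq> quo R L U} = quo R L ` (?S - {U})"
    using K U by (auto simp: at_least_at_most_def quo_carrier [OF L] quo_le_iff [OF L] quo_eq_iff [OF L])
  have inj: "inj_on (quo R L) (?S - {U})"
    by (rule inj_on_subset [OF inj_on_quo [OF L]]) auto
  have "mob R L K U = - (\<Sum>z \<in> {z \<in> \<lbrace>quo R L K..quo R L U\<rbrace>\<^bsub>?P\<^esub>. z \<noteq> quo R L U}. moebius ?P (quo R L K) z)"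
    unfolding mob_def moebius.simps [of _ "quo R L K" "quo R L U"]
    using partial_order_quotient_lattice [OF L] finite_carrier_quotient_lattice [OF L] quo_in_carrier [OF L K]
      quo_in_carrier [OF L U] quo_le_iff [OF L K U] quo_eq_iff [OF L K U] UK False by auto
  also have "\<dots> = - (\<Sum>W \<in> ?S - {U}. mob R L K W)"
    unfolding img sum.reindex [OF inj] by (simp add: mob_def)
  finally show ?thesis
    using False sum.remove [OF fin, of U "mob R L K"] U UK by simp
qed

text \<open>
  Weisner's theorem, dualised to submodules. Summing the left-hand side over all \<open>W'\<close> between \<open>W\<close> and
  \<open>V\<close> yields the sum of \<open>mob\<close> over the interval from \<open>W\<close> to \<open>K\<close>, which vanishes as \<open>W \<noteq> K\<close>;
  the terms with \<open>W' \<noteq> W\<close> vanish by induction on the distance from \<open>V\<close>.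
\<close>

lemma weisner:
  assumes L: "finite_module R L" and K: "K \<in> submodules R L" and V: "V \<in> submodules R L" "V \<subset> K"
    and W: "W \<in> submodules R L" "W \<subseteq> V"
  shows "(\<Sum>U \<in> {U \<in> submodules R L. U \<subseteq> K \<and> U \<inter> V = W}. mob R L K U) = 0"
  using W
proof (induction "card V - card W" arbitrary: W rule: less_induct)
  case less
  interpret L: left_module R L using L by (rule finite_moduleD)
  let ?s = "\<lambda>W. \<Sum>U \<in> {U \<in> submodules R L. U \<subseteq> K \<and> U \<inter> V = W}. mob R L K U"
  let ?D = "{W' \<in> submodules R L. W \<subseteq> W' \<and> W' \<subseteq> V}"
  let ?S = "{U \<in> submodules R L. W \<subseteq> U \<and> U \<subseteq> K}"
  have fin: "finite ?D" "finite ?S" using finite_submodules [OF L] by simp_all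
  have fibre: "{U \<in> ?S. U \<inter> V = W'} = {U \<in> submodules R L. U \<subseteq> K \<and> U \<inter> V = W'}" if "W' \<in> ?D" for W'
    using that by auto
  have "(\<Sum>W' \<in> ?D. \<Sum>U \<in> {U \<in> ?S. U \<inter> V = W'}. mob R L K U) = (\<Sum>U \<in> ?S. mob R L K U)"
    by (rule sum.group) (use fin V less.prems L.Int_submodule in auto)
  moreover have "(\<Sum>U \<in> ?S. mob R L K U) = 0"
    using mob_sum [OF L K less.prems(1)] less.prems V by auto
  moreover have "(\<Sum>W' \<in> ?D. \<Sum>U \<in> {U \<in> ?S. U \<inter> V = W'}. mob R L K U) = (\<Sum>W' \<in> ?D. ?s W')"
    by (rule sum.cong [OF refl]) (simp only: fibre)
  moreover have "(\<Sum>W' \<in> ?D. ?s W') = ?s W + (\<Sum>W' \<in> ?D - {W}. ?s W')"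
    by (rule sum.remove) (use fin less.prems in auto)
  moreover have "(\<Sum>W' \<in> ?D - {W}. ?s W') = 0"
  proof (rule sum.neutral, rule ballI)
    fix W' assume W': "W' \<in> ?D - {W}"
    have "card W < card W'" "card W' \<le> card V"
      using W' finite_submodule [OF L] V by (auto intro!: psubset_card_mono card_mono)
    then show "?s W' = 0" using W' by (intro less.hyps) auto
  qed
  ultimately show ?case by linarith
qed

lemma maximal_submodulesD:
  assumes "V \<in> maximal_submodules R L K"
  shows "V \<in> submodules R L" "V \<subset> K" "\<And>W. W \<in> submodules R L \<Longrightarrow> V \<subset> W \<Longrightarrow> W \<subseteq> K \<Longrightarrow> W = K"
  using assms by (auto simp: maximal_submodules_def)

text \<open>
  In Weisner's theorem for \<open>V\<close> and \<open>W = 0\<close>, the summands other than the one at \<open>0\<close> belong exactly to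
  the complements of \<open>V\<close>.
\<close>

lemma abs_mob_le_sum_complements:
  assumes L: "finite_module R L" and K: "K \<in> submodules R L" and V: "V \<in> maximal_submodules R L K"
  shows "\<bar>mob R L K {\<zero>\<^bsub>L\<^esub>}\<bar> \<le> (\<Sum>T \<in> complements R L K V. \<bar>mob R L K T\<bar>)"
proof -
  interpret L: left_module R L using L by (rule finite_moduleD)
  note V' = maximal_submodulesD [OF V]
  let ?S = "{U \<in> submodules R L. U \<subseteq> K \<and> U \<inter> V = {\<zero>\<^bsub>L\<^esub>}}"
  have fin: "finite ?S" using finite_submodules [OF L] by simp
  have 0: "{\<zero>\<^bsub>L\<^esub>} \<in> ?S"
    using L.zero_submodule L.submoduleD(2) [OF K] L.submoduleD(2) [OF V'(1)] by auto
  have c: "?S - {{\<zero>\<^bsub>L\<^esub>}} = complements R L K V" by (auto simp: complements_def)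
  have "0 = (\<Sum>U \<in> ?S. mob R L K U)"
    using weisner [OF L K V'(1,2) L.zero_submodule] L.submoduleD(2) [OF V'(1)] by simp
  also have "\<dots> = mob R L K {\<zero>\<^bsub>L\<^esub>} + (\<Sum>T \<in> complements R L K V. mob R L K T)"
    using sum.remove [OF fin 0, of "mob R L K"] by (simp only: c)
  finally have "mob R L K {\<zero>\<^bsub>L\<^esub>} = - (\<Sum>T \<in> complements R L K V. mob R L K T)" by simp
  then show ?thesis using sum_abs [of "mob R L K" "complements R L K V"] by simp
qed

lemma ex_maximal_submodule:
  assumes L: "finite_module R L" and K: "K \<in> submodules R L" and U: "U \<in> submodules R L" "U \<subset> K"
  obtains V where "V \<in> maximal_submodules R L K" "U \<subseteq> V"
proof -
  let ?S = "{V \<in> submodules R L. U \<subseteq> V \<and> V \<subset> K}"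
  have "finite ?S" "U \<in> ?S" using finite_submodules [OF L] U by auto
  then obtain V where V: "V \<in> ?S" "\<forall>W \<in> ?S. V \<subseteq> W \<longrightarrow> V = W"
    using finite_has_maximal2 [of ?S U] by meson
  have "W = K" if "W \<in> submodules R L" "V \<subset> W" "W \<subseteq> K" for W
    using V that by blast
  then have "V \<in> maximal_submodules R L K"
    unfolding maximal_submodules_def using V(1) by blast
  then show ?thesis using that V(1) by blast
qed

lemma maximal_sum:
  assumes L: "finite_module R L" and K: "K \<in> submodules R L" and V: "V \<in> maximal_submodules R L K"
    and T: "T \<in> submodules R L" "T \<subseteq> K" "\<not> T \<subseteq> V"
  shows "submodule_sum L T V = K"
proof -
  interpret L: left_module R L using L by (rule finite_moduleD)
  note V' = maximal_submodulesD [OF V]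
  show ?thesis
    using V'(3) [OF L.sum_submodule [OF T(1) V'(1)]] L.sum_upper [OF T(1) V'(1)] T
      L.sum_least [OF K T(2), of V] V'(2) by blast
qed

text \<open>
  \<open>Rx + V\<close> is larger than the maximal submodule \<open>V\<close>, hence it is \<open>K\<close>; now apply the modular law.
  So \<open>W\<close> is generated over \<open>W \<inter> V\<close> by a single element, which bounds its size.
\<close>

lemma maximal_cyclic_cover:
  assumes L: "finite_module R L" and K: "K \<in> submodules R L" and V: "V \<in> maximal_submodules R L K"
    and W: "W \<in> submodules R L" "W \<subseteq> K" and x: "x \<in> W" "x \<notin> V"
  shows "W \<subseteq> submodule_sum L (cyclic_submodule R L x) (W \<inter> V)"
proof
  interpret L: left_module R L using L by (rule finite_moduleD)
  note V' = maximal_submodulesD [OF V]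
  note W' = L.submoduleD [OF W(1)]
  have xL: "x \<in> carrier L" using x W' by blast
  have cW: "cyclic_submodule R L x \<subseteq> W" using x W' by (auto simp: cyclic_submodule_def)
  have s: "submodule_sum L (cyclic_submodule R L x) V = K"
    by (rule maximal_sum [OF L K V L.cyclic_submodule [OF xL]])
      (use cW W(2) L.mem_cyclic_submodule [OF xL] x in auto)
  fix w assume w: "w \<in> W"
  then obtain y v where yv: "y \<in> cyclic_submodule R L x" "v \<in> V" "w = y \<oplus>\<^bsub>L\<^esub> v"
    using s W(2) by (auto simp: submodule_sum_def)
  have c: "y \<in> carrier L" "v \<in> carrier L" "w \<in> carrier L" "y \<in> W"
    using yv cW W'(1) L.submoduleD(1) [OF V'(1)] w by auto
  have "w \<ominus>\<^bsub>L\<^esub> y = v" using c yv(3) by (simp add: a_minus_def L.M.a_ac L.M.r_neg L.M.r_neg1 L.M.r_neg2)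
  then have "v \<in> W" using W'(6) [OF w c(4)] by simp
  then show "w \<in> submodule_sum L (cyclic_submodule R L x) (W \<inter> V)"
    using yv by (auto simp: submodule_sum_def)
qed

lemma card_submodule_sum_le:
  assumes "finite U" "finite W"
  shows "card (submodule_sum L U W) \<le> card U * card W"
proof -
  have "submodule_sum L U W = (\<lambda>(x, y). x \<oplus>\<^bsub>L\<^esub> y) ` (U \<times> W)" by (auto simp: submodule_sum_def)
  then show ?thesis using card_image_le [of "U \<times> W"] assms by (simp add: card_cartesian_product)
qed

lemma card_le_maximal_cyclic:
  assumes L: "finite_module R L" and K: "K \<in> submodules R L" and V: "V \<in> maximal_submodules R L K"
    and W: "W \<in> submodules R L" "W \<subseteq> K" "\<not> W \<subseteq> V"
    and B: "\<And>x. x \<in> carrier L \<Longrightarrow> card (cyclic_submodule R L x) \<le> B"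
  shows "card W \<le> card (W \<inter> V) * B"
proof -
  interpret L: left_module R L using L by (rule finite_moduleD)
  obtain x where x: "x \<in> W" "x \<notin> V" using W(3) by blast
  have xL: "x \<in> carrier L" using x L.submoduleD(1) [OF W(1)] by blast
  have fin: "finite W" "finite (cyclic_submodule R L x)"
    using finite_submodule [OF L] W(1) L.cyclic_submodule [OF xL] by auto
  have "card W \<le> card (submodule_sum L (cyclic_submodule R L x) (W \<inter> V))"
    using maximal_cyclic_cover [OF L K V W(1,2) x] fin
    by (intro card_mono) (auto simp: submodule_sum_def intro!: finite_image_set2)
  also have "\<dots> \<le> card (cyclic_submodule R L x) * card (W \<inter> V)"
    using fin by (intro card_submodule_sum_le) auto
  also have "\<dots> \<le> B * card (W \<inter> V)" using B [OF xL] by simp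
  finally show ?thesis by (simp add: mult.commute)
qed

lemma complements_card_le:
  assumes L: "finite_module R L" and K: "K \<in> submodules R L" and V: "V \<in> maximal_submodules R L K"
    and T: "T \<in> complements R L K V"
    and B: "\<And>x. x \<in> carrier L \<Longrightarrow> card (cyclic_submodule R L x) \<le> B"
  shows "card T \<le> B" "submodule_sum L T V = K"
proof -
  have T': "T \<in> submodules R L" "T \<subseteq> K" "\<not> T \<subseteq> V" "T \<inter> V = {\<zero>\<^bsub>L\<^esub>}"
    using T by (auto simp: complements_def)
  show "card T \<le> B" using card_le_maximal_cyclic [OF L K V T'(1-3) B] T'(4) by simp
  show "submodule_sum L T V = K" by (rule maximal_sum [OF L K V T'(1-3)])
qed

text \<open>
  A nonzero Moebius value forces many maximal submodules. By Weisner's theorem for a maximal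
  \<open>V \<supseteq> U\<close>, some \<open>W \<noteq> U\<close> with \<open>W \<inter> V = U\<close> has a nonzero value too. Passing from \<open>U\<close> to \<open>W\<close> multiplies
  the cardinality by at most \<open>B\<close> and loses at least the maximal submodule \<open>V\<close>, since \<open>V\<close> contains \<open>U\<close>
  but not \<open>W\<close>. Continue until \<open>K\<close> is reached.
\<close>

lemma card_le_of_mob_nonzero:
  assumes L: "finite_module R L" and K: "K \<in> submodules R L"
    and U: "U \<in> submodules R L" "U \<subseteq> K" "mob R L K U \<noteq> 0"
    and B: "\<And>x. x \<in> carrier L \<Longrightarrow> card (cyclic_submodule R L x) \<le> B"
  shows "card K \<le> card U * B ^ card {V \<in> maximal_submodules R L K. U \<subseteq> V}"
  using U
proof (induction "card K - card U" arbitrary: U rule: less_induct)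
  case less
  interpret L: left_module R L using L by (rule finite_moduleD)
  have fmax: "finite (maximal_submodules R L K)"
    using finite_submodules [OF L] by (simp add: maximal_submodules_def)
  have "B > 0"
    using B [OF L.M.zero_closed] finite_submodule [OF L L.cyclic_submodule [OF L.M.zero_closed]]
      L.mem_cyclic_submodule [OF L.M.zero_closed] by (metis card_gt_0_iff empty_iff less_le_trans)
  show ?case
  proof (cases "U = K")
    case True
    then show ?thesis using \<open>B > 0\<close> by simp
  next
    case False
    obtain V where V: "V \<in> maximal_submodules R L K" "U \<subseteq> V"
      using ex_maximal_submodule [OF L K less.prems(1)] less.prems(2) False by blast
    note V' = maximal_submodulesD [OF V(1)]
    let ?S = "{W \<in> submodules R L. W \<subseteq> K \<and> W \<inter> V = U}"
    have fin: "finite ?S" using finite_submodules [OF L] by simp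
    have UV: "U \<in> ?S" using less.prems V by auto
    have "(\<Sum>W \<in> ?S. mob R L K W) = 0" by (rule weisner [OF L K V'(1,2) less.prems(1) V(2)])
    then have "(\<Sum>W \<in> ?S - {U}. mob R L K W) \<noteq> 0"
      using sum.remove [OF fin UV, of "mob R L K"] less.prems(3) by auto
    then obtain W where W: "W \<in> ?S - {U}" "mob R L K W \<noteq> 0" by (meson sum.neutral)
    have W': "W \<in> submodules R L" "W \<subseteq> K" "W \<inter> V = U" "W \<noteq> U" using W by auto
    have UW: "U \<subset> W" "\<not> W \<subseteq> V" using W' by auto
    have "card U < card W" "card W \<le> card K"
      using UW W' finite_submodule [OF L] K by (auto intro!: psubset_card_mono card_mono)
    then have "card K \<le> card W * B ^ card {V \<in> maximal_submodules R L K. W \<subseteq> V}"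
      using W' W(2) by (intro less.hyps) auto
    also have "\<dots> \<le> (card U * B) * B ^ card {V \<in> maximal_submodules R L K. W \<subseteq> V}"
      using card_le_maximal_cyclic [OF L K V(1) W'(1,2) UW(2) B] W'(3) by simp
    also have "\<dots> = card U * B ^ Suc (card {V \<in> maximal_submodules R L K. W \<subseteq> V})" by simp
    also have "\<dots> \<le> card U * B ^ card {V \<in> maximal_submodules R L K. U \<subseteq> V}"
    proof (intro mult_left_mono power_increasing)
      show "Suc (card {V \<in> maximal_submodules R L K. W \<subseteq> V}) \<le> card {V \<in> maximal_submodules R L K. U \<subseteq> V}"
        unfolding Suc_le_eq by (rule psubset_card_mono) (use fmax V UW in auto)
    qed (use \<open>B > 0\<close> in auto)
    finally show ?thesis .
  qed
qed

lemma image_submodule: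
  assumes L: "finite_module R L" and L': "finite_module R L'" and p: "p \<in> Epi R L L'"
    and U: "U \<in> submodules R L"
  shows "p ` U \<in> submodules R L'"
proof -
  interpret L: left_module R L using L by (rule finite_moduleD)
  note p' = HomD [OF EpiD(1) [OF p]]
  note U' = L.submoduleD [OF U]
  have z: "p \<zero>\<^bsub>L\<^esub> = \<zero>\<^bsub>L'\<^esub>" using Hom_zero finite_moduleD(1) L L' EpiD(1) p by blast
  have "p x \<oplus>\<^bsub>L'\<^esub> p y \<in> p ` U" if "x \<in> U" "y \<in> U" for x y
    using p'(2) [of x y] U'(1) U'(3) [OF that] that by (metis image_eqI subset_iff)
  moreover have "a \<odot>\<^bsub>L'\<^esub> p x \<in> p ` U" if "a \<in> carrier R" "x \<in> U" for a x
    using p'(3) [of a x] U'(1) U'(4) [OF that] that by (metis image_eqI subset_iff)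
  ultimately show ?thesis
    using U'(1,2) p'(1) z by (auto simp: submodules_def image_iff intro: sym)
qed

lemma vimage_submodule:
  assumes L: "finite_module R L" and L': "finite_module R L'" and p: "p \<in> Epi R L L'"
    and U: "U \<in> submodules R L'"
  shows "{x \<in> carrier L. p x \<in> U} \<in> submodules R L"
proof -
  interpret L: left_module R L using L by (rule finite_moduleD)
  interpret L': left_module R L' using L' by (rule finite_moduleD)
  note p' = HomD [OF EpiD(1) [OF p]]
  note U' = L'.submoduleD [OF U]
  have z: "p \<zero>\<^bsub>L\<^esub> = \<zero>\<^bsub>L'\<^esub>" using Hom_zero finite_moduleD(1) L L' EpiD(1) p by blast
  show ?thesis using p' U' z by (auto simp: submodules_def L.smult_closed)
qed

lemma image_subset_image_iff:
  assumes L: "finite_module R L" and L': "finite_module R L'" and p: "p \<in> Epi R L L'"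
    and U: "U \<in> submodules R L" and W: "W \<in> submodules R L" "ker L p \<subseteq> W"
  shows "p ` U \<subseteq> p ` W \<longleftrightarrow> U \<subseteq> W"
proof
  interpret L: left_module R L using L by (rule finite_moduleD)
  note W' = L.submoduleD [OF W(1)] and U' = L.submoduleD [OF U]
  assume s: "p ` U \<subseteq> p ` W"
  show "U \<subseteq> W"
  proof
    fix x assume x: "x \<in> U"
    then obtain y where y: "y \<in> W" "p x = p y" using s by blast
    have c: "x \<in> carrier L" "y \<in> carrier L" using x y U' W' by auto
    have "x \<ominus>\<^bsub>L\<^esub> y \<in> W" using Epi_eq_iff [OF L L' p c] y W by blast
    then have "(x \<ominus>\<^bsub>L\<^esub> y) \<oplus>\<^bsub>L\<^esub> y \<in> W" using W'(3) y by blast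
    then show "x \<in> W" using c by (simp add: a_minus_def L.M.a_assoc L.M.l_neg)
  qed
qed blast

lemma image_vimage_submodule:
  assumes L': "finite_module R L'" and p: "p \<in> Epi R L L'" and U: "U \<in> submodules R L'"
  shows "p ` {x \<in> carrier L. p x \<in> U} = U"
proof -
  interpret L': left_module R L' using L' by (rule finite_moduleD)
  have "y \<in> p ` {x \<in> carrier L. p x \<in> U}" if y: "y \<in> U" for y
  proof -
    have "y \<in> p ` carrier L" using y L'.submoduleD(1) [OF U] by (auto simp: EpiD(2) [OF p])
    then show ?thesis using y by blast
  qed
  then show ?thesis by blast
qed

text \<open>
  The submodules of \<open>L'\<close> correspond to the submodules of \<open>L\<close> that contain the kernel of \<open>p\<close>, and the
  Moebius function only depends on the interval.
\<close>

lemma mob_image: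
  assumes L: "finite_module R L" and L': "finite_module R L'" and p: "p \<in> Epi R L L'"
    and K: "K \<in> submodules R L" and U: "U \<in> submodules R L" "ker L p \<subseteq> U" "U \<subseteq> K"
  shows "mob R L' (p ` K) (p ` U) = mob R L K U"
  using U
proof (induction "card K - card U" arbitrary: U rule: less_induct)
  case less
  interpret L: left_module R L using L by (rule finite_moduleD)
  interpret L': left_module R L' using L' by (rule finite_moduleD)
  note sub = image_subset_image_iff [OF L L' p]
  have kK: "ker L p \<subseteq> K" using less.prems by blast
  let ?S = "{W \<in> submodules R L. U \<subseteq> W \<and> W \<subseteq> K}"
  let ?S' = "{W \<in> submodules R L'. p ` U \<subseteq> W \<and> W \<subseteq> p ` K}"
  have fin: "finite ?S" "finite ?S'" using finite_submodules [OF L] finite_submodules [OF L'] by auto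
  have "inj_on ((`) p) ?S"
  proof (rule inj_onI)
    fix W W' assume WW': "W \<in> ?S" "W' \<in> ?S" "p ` W = p ` W'"
    then have "ker L p \<subseteq> W" "ker L p \<subseteq> W'" using less.prems(2) by auto
    then show "W = W'" using WW' sub [of W W'] sub [of W' W] by auto
  qed
  moreover have "(`) p ` ?S = ?S'"
  proof (intro equalityI subsetI)
    fix W' assume "W' \<in> (`) p ` ?S"
    then show "W' \<in> ?S'" using image_submodule [OF L L' p] by blast
  next
    fix W' assume W': "W' \<in> ?S'"
    let ?W = "{x \<in> carrier L. p x \<in> W'}"
    have W: "?W \<in> submodules R L" using vimage_submodule [OF L L' p] W' by blast
    have i: "p ` ?W = W'" using image_vimage_submodule [OF L' p] W' by blast
    have "\<zero>\<^bsub>L'\<^esub> \<in> W'" using W' by (simp add: submodules_def)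
    moreover have "p \<zero>\<^bsub>L\<^esub> = \<zero>\<^bsub>L'\<^esub>"
      using Hom_zero finite_moduleD(1) L L' EpiD(1) p by blast
    ultimately have kW: "ker L p \<subseteq> ?W" by (auto simp: ker_def)
    have "U \<subseteq> ?W" using sub [OF less.prems(1) W kW] i W' by blast
    moreover have "?W \<subseteq> K" using sub [OF W K kK] i W' by blast
    ultimately show "W' \<in> (`) p ` ?S" using i W by blast
  qed
  ultimately have bij: "bij_betw ((`) p) ?S ?S'" by (simp add: bij_betw_def)
  have UK: "p ` U = p ` K \<longleftrightarrow> U = K"
    using sub [OF less.prems(1) K kK] sub [OF K less.prems(1,2)] by auto
  have "(\<Sum>W' \<in> ?S'. mob R L' (p ` K) W') = (\<Sum>W \<in> ?S. mob R L' (p ` K) (p ` W))"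
    using sum.reindex_bij_betw [OF bij, of "mob R L' (p ` K)"] by simp
  then have "(\<Sum>W \<in> ?S. mob R L' (p ` K) (p ` W)) = (\<Sum>W \<in> ?S. mob R L K W)"
    using mob_sum [OF L K less.prems(1,3)] UK
      mob_sum [OF L' image_submodule [OF L L' p K] image_submodule [OF L L' p less.prems(1)]
        image_mono [OF less.prems(3)]]
    by simp
  moreover have "(\<Sum>W \<in> ?S - {U}. mob R L' (p ` K) (p ` W)) = (\<Sum>W \<in> ?S - {U}. mob R L K W)"
  proof (rule sum.cong [OF refl])
    fix W assume W: "W \<in> ?S - {U}"
    have "card U < card W" "card W \<le> card K"
      using W finite_submodule [OF L] K by (auto intro!: psubset_card_mono card_mono)
    then show "mob R L' (p ` K) (p ` W) = mob R L K W" using W less.prems by (intro less.hyps) auto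
  qed
  moreover have U: "U \<in> ?S" using less.prems by blast
  ultimately show ?case
    using sum.remove [OF fin(1) U, of "mob R L K"]
      sum.remove [OF fin(1) U, of "\<lambda>W. mob R L' (p ` K) (p ` W)"] by simp
qed

lemma mu_quotient:
  assumes L: "finite_module R L" and L': "finite_module R L'" and N: "finite_module R N"
    and p: "p \<in> Epi R L L'" and \<pi>: "\<pi> \<in> Epi R L N" and \<pi>': "\<pi>' \<in> Epi R L' N"
    and eq: "\<And>x. x \<in> carrier L \<Longrightarrow> \<pi>' (p x) = \<pi> x"
  shows "mu R L' N \<pi>' = mob R L (ker L \<pi>) (ker L p)"
proof -
  interpret L: left_module R L using L by (rule finite_moduleD)
  have k: "ker L \<pi> \<in> submodules R L" "ker L p \<in> submodules R L"
    using kernel_in_submodules L L' N p \<pi> by blast+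
  have z: "p \<zero>\<^bsub>L\<^esub> = \<zero>\<^bsub>L'\<^esub>" using Hom_zero finite_moduleD(1) L L' EpiD(1) p by blast
  have pc: "p ` carrier L = carrier L'" using EpiD(2) [OF p] .
  have "ker L' \<pi>' = p ` ker L \<pi>"
    unfolding ker_def pc [symmetric] z [symmetric] using eq L.M.zero_closed by (auto simp: image_iff)
  moreover have "p ` ker L p = {\<zero>\<^bsub>L'\<^esub>}"
    using z L.M.zero_closed by (auto simp: ker_def image_iff)
  moreover have "ker L p \<subseteq> ker L \<pi>"
    using eq [OF L.M.zero_closed] eq by (fastforce simp: ker_def)
  ultimately show ?thesis
    using mob_image [OF L L' p k(1) k(2)] mu_eq_mob [OF L' N \<pi>'] by simp
qed

text \<open>
  Joins of quotients are intersections of kernels and meets are sums, so this is the condition that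
  defines \<open>Z\<close>, read on kernels.
\<close>

section \<open>Distributive submodules\<close>

definition distributive_submodules :: "('r, 'x) ring_scheme \<Rightarrow> ('r, nat) module \<Rightarrow> nat set \<Rightarrow> nat set set" where
  "distributive_submodules R L K = {U \<in> submodules R L. U \<subseteq> K \<and>
     (\<forall>A \<in> submodules R L. \<forall>B \<in> submodules R L. A \<subseteq> K \<longrightarrow> B \<subseteq> K \<longrightarrow>
       U \<inter> submodule_sum L A B = submodule_sum L (U \<inter> A) (U \<inter> B))}"

lemma Z_eq_card_distributive:
  assumes L: "finite_module R L" and N: "finite_module R N" and \<pi>: "\<pi> \<in> Epi R L N"
  shows "Z R L N \<pi> = card (distributive_submodules R L (ker L \<pi>))"
proof -
  interpret L: left_module R L using L by (rule finite_moduleD)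
  let ?K = "ker L \<pi>" and ?P = "quotient_lattice R L"
  let ?S = "{U \<in> submodules R L. U \<subseteq> ?K}"
  have K: "?K \<in> submodules R L" by (rule kernel_in_submodules [OF L N \<pi>])
  have qa: "quotients_above R L N \<pi> = quo R L ` ?S"
    using K by (auto simp: quotients_above_def quo_carrier [OF L] quotient_class_quo [OF L N \<pi>] quo_le_iff [OF L])
  have law: "quo R L U \<squnion>\<^bsub>?P\<^esub> (quo R L A \<sqinter>\<^bsub>?P\<^esub> quo R L B)
      = (quo R L U \<squnion>\<^bsub>?P\<^esub> quo R L A) \<sqinter>\<^bsub>?P\<^esub> (quo R L U \<squnion>\<^bsub>?P\<^esub> quo R L B) \<longleftrightarrow>
      U \<inter> submodule_sum L A B = submodule_sum L (U \<inter> A) (U \<inter> B)"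
    if "U \<in> submodules R L" "A \<in> submodules R L" "B \<in> submodules R L" for U A B
    using that by (simp add: join_quo [OF L] meet_quo [OF L] quo_eq_iff [OF L] L.Int_submodule L.sum_submodule)
  have image: "{H \<in> g ` S. \<forall>K \<in> g ` S. \<forall>K' \<in> g ` S. P H K K'}
      = g ` {U \<in> S. \<forall>A \<in> S. \<forall>B \<in> S. P (g U) (g A) (g B)}" for g :: "nat set \<Rightarrow> 'c" and S P
    by auto
  have "{U \<in> ?S. \<forall>A \<in> ?S. \<forall>B \<in> ?S. quo R L U \<squnion>\<^bsub>?P\<^esub> (quo R L A \<sqinter>\<^bsub>?P\<^esub> quo R L B)
      = (quo R L U \<squnion>\<^bsub>?P\<^esub> quo R L A) \<sqinter>\<^bsub>?P\<^esub> (quo R L U \<squnion>\<^bsub>?P\<^esub> quo R L B)}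
      = {U \<in> ?S. \<forall>A \<in> ?S. \<forall>B \<in> ?S. U \<inter> submodule_sum L A B = submodule_sum L (U \<inter> A) (U \<inter> B)}"
    by (intro Collect_cong conj_cong refl ball_cong law) simp_all
  also have "\<dots> = distributive_submodules R L ?K"
    by (auto simp: distributive_submodules_def)
  finally have "Z R L N \<pi> = card (quo R L ` distributive_submodules R L ?K)"
    unfolding Z_def Let_def qa image by (rule arg_cong)
  also have "\<dots> = card (distributive_submodules R L ?K)"
    by (rule card_image, rule inj_on_subset [OF inj_on_quo [OF L]]) (auto simp: distributive_submodules_def)
  finally show ?thesis .
qed

text \<open>
  Take a counterexample with \<open>A\<close> minimal and let \<open>A\<^sub>0 = {a \<in> A. f a \<in> U}\<close>; by minimality every proper
  submodule of \<open>A\<close> lies in \<open>A\<^sub>0\<close>. Let \<open>D = {a + f a | a \<in> A}\<close>. Since \<open>A \<subseteq> U \<inter> (f A + D)\<close>,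
  distributivity gives \<open>A \<subseteq> U \<inter> f A + U \<inter> D\<close>, from which \<open>A = A\<^sub>0 + A \<inter> f A\<^sub>0\<close> follows. If
  \<open>A \<inter> f A\<^sub>0\<close> is proper, it lies in \<open>A\<^sub>0\<close>, so \<open>A = A\<^sub>0\<close>, a contradiction. Otherwise \<open>A \<subseteq> f A\<^sub>0\<close>, which
  is impossible as \<open>|f A\<^sub>0| \<le> |A\<^sub>0| < |A|\<close>.
\<close>

lemma distributive_hom_invariant:
  assumes L: "finite_module R L" and K: "K \<in> submodules R L" and U: "U \<in> distributive_submodules R L K"
    and A: "A \<in> submodules R L" "A \<subseteq> U"
    and f: "\<And>x. x \<in> A \<Longrightarrow> f x \<in> K" "\<And>x y. x \<in> A \<Longrightarrow> y \<in> A \<Longrightarrow> f (x \<oplus>\<^bsub>L\<^esub> y) = f x \<oplus>\<^bsub>L\<^esub> f y"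
      "\<And>a x. a \<in> carrier R \<Longrightarrow> x \<in> A \<Longrightarrow> f (a \<odot>\<^bsub>L\<^esub> x) = a \<odot>\<^bsub>L\<^esub> f x"
  shows "f ` A \<subseteq> U"
  using A f
proof (induction "card A" arbitrary: A rule: less_induct)
  case less
  interpret L: left_module R L using L by (rule finite_moduleD)
  note A' = L.submoduleD [OF less.prems(1)] and K' = L.submoduleD [OF K]
  note fK = less.prems(3) and fadd = less.prems(4) and fsm = less.prems(5)
  have U': "U \<in> submodules R L" "U \<subseteq> K"
    using U by (auto simp: distributive_submodules_def)
  have dist: "U \<inter> submodule_sum L A B = submodule_sum L (U \<inter> A) (U \<inter> B)"
      if "A \<in> submodules R L" "B \<in> submodules R L" "A \<subseteq> K" "B \<subseteq> K" for A B
    using U that by (auto simp: distributive_submodules_def)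
  note U'' = L.submoduleD [OF U'(1)]
  have fL: "f x \<in> carrier L" if "x \<in> A" for x using fK K'(1) that by blast
  have AL: "x \<in> carrier L" if "x \<in> A" for x using A'(1) that by blast
  have AU: "x \<in> U" if "x \<in> A" for x using less.prems(2) that by blast
  have f0: "f \<zero>\<^bsub>L\<^esub> = \<zero>\<^bsub>L\<^esub>"
    using fsm [OF L.R.zero_closed A'(2)] fL [OF A'(2)] by (simp add: L.smult_zero_left)
  have fneg: "f (\<ominus>\<^bsub>L\<^esub> x) = \<ominus>\<^bsub>L\<^esub> f x" if x: "x \<in> A" for x
    using fsm [of "\<ominus>\<^bsub>R\<^esub> \<one>\<^bsub>R\<^esub>" x] x AL [OF x] fL [OF x] by (simp add: L.smult_l_minus L.smult_one)
  let ?A0 = "{a \<in> A. f a \<in> U}"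
  have A0: "?A0 \<in> submodules R L"
    unfolding submodules_def using A'(1,2) A'(3) [of x y for x y] A'(4) U''(2) U''(3,4) f0
    by (auto simp: fadd fsm)
  have img: "f ` B \<in> submodules R L" if B: "B \<in> submodules R L" "B \<subseteq> A" for B
  proof -
    note B' = L.submoduleD [OF B(1)]
    have "f x \<oplus>\<^bsub>L\<^esub> f y \<in> f ` B" if "x \<in> B" "y \<in> B" for x y
      using fadd [of x y] B(2) B'(3) [OF that] that by (metis image_eqI subset_iff)
    moreover have "a \<odot>\<^bsub>L\<^esub> f x \<in> f ` B" if "a \<in> carrier R" "x \<in> B" for a x
      using fsm [of a x] B(2) B'(4) [OF that] that by (metis image_eqI subset_iff)
    ultimately show ?thesis
      using B(2) B'(2) fL f0 by (auto simp: submodules_def image_iff intro: sym)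
  qed
  show ?case
  proof (rule ccontr)
    assume "\<not> f ` A \<subseteq> U"
    then have A0_less: "?A0 \<subset> A" by auto
    have proper: "B \<subseteq> ?A0" if B: "B \<in> submodules R L" "B \<subset> A" for B
    proof -
      have BA: "\<And>x. x \<in> B \<Longrightarrow> x \<in> A" using B(2) by blast
      have "f ` B \<subseteq> U"
      proof (rule less.hyps)
        show "card B < card A" using B finite_submodule [OF L less.prems(1)] by (simp add: psubset_card_mono)
      qed (use B(1) BA less.prems(2) in \<open>auto simp: fK fadd fsm\<close>)
      then show ?thesis using B by auto
    qed
    let ?D = "(\<lambda>a. a \<oplus>\<^bsub>L\<^esub> f a) ` A"
    have D: "?D \<in> submodules R L"
    proof -
      have "(x \<oplus>\<^bsub>L\<^esub> f x) \<oplus>\<^bsub>L\<^esub> (y \<oplus>\<^bsub>L\<^esub> f y) \<in> ?D" if xy: "x \<in> A" "y \<in> A" for x y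
      proof (rule image_eqI)
        show "(x \<oplus>\<^bsub>L\<^esub> f x) \<oplus>\<^bsub>L\<^esub> (y \<oplus>\<^bsub>L\<^esub> f y) = (x \<oplus>\<^bsub>L\<^esub> y) \<oplus>\<^bsub>L\<^esub> f (x \<oplus>\<^bsub>L\<^esub> y)"
          using xy AL fL by (simp add: fadd L.M.a_ac)
        show "x \<oplus>\<^bsub>L\<^esub> y \<in> A" using A'(3) xy .
      qed
      moreover have "a \<odot>\<^bsub>L\<^esub> (x \<oplus>\<^bsub>L\<^esub> f x) \<in> ?D" if ax: "a \<in> carrier R" "x \<in> A" for a x
      proof (rule image_eqI)
        show "a \<odot>\<^bsub>L\<^esub> (x \<oplus>\<^bsub>L\<^esub> f x) = (a \<odot>\<^bsub>L\<^esub> x) \<oplus>\<^bsub>L\<^esub> f (a \<odot>\<^bsub>L\<^esub> x)"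
          using ax AL fL by (simp add: fsm L.smult_r_distr)
        show "a \<odot>\<^bsub>L\<^esub> x \<in> A" using A'(4) ax .
      qed
      moreover have "\<zero>\<^bsub>L\<^esub> \<in> ?D"
        by (rule image_eqI [where x = "\<zero>\<^bsub>L\<^esub>"]) (use f0 A'(2) in auto)
      ultimately show ?thesis using AL fL by (auto simp: submodules_def)
    qed
    have DK: "?D \<subseteq> K" using AU U'(2) fK K'(3) by blast
    have fAK: "f ` A \<subseteq> K" using fK by blast
    let ?E = "A \<inter> f ` ?A0"
    have E: "?E \<in> submodules R L"
      by (rule L.Int_submodule [OF less.prems(1) img [OF A0]]) auto
    have split: "\<exists>b \<in> ?A0. a \<ominus>\<^bsub>L\<^esub> b \<in> ?E" if a: "a \<in> A" for a
    proof -
      \<comment> \<open>The obvious decomposition of \<open>a\<close> in \<open>f A + D\<close>; distributivity replaces it by one inside \<open>U\<close>.\<close>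
      have "a = f (\<ominus>\<^bsub>L\<^esub> a) \<oplus>\<^bsub>L\<^esub> (a \<oplus>\<^bsub>L\<^esub> f a)"
        using a AL fL fneg by (simp add: L.M.a_ac L.M.r_neg1 L.M.r_neg2 L.M.l_neg L.M.r_neg)
      moreover have "f (\<ominus>\<^bsub>L\<^esub> a) \<in> f ` A" "a \<oplus>\<^bsub>L\<^esub> f a \<in> ?D" using a A'(5) by blast+
      ultimately have "a \<in> submodule_sum L (f ` A) ?D"
        unfolding submodule_sum_def by blast
      then have "a \<in> U \<inter> submodule_sum L (f ` A) ?D" using AU [OF a] by blast
      then have "a \<in> submodule_sum L (U \<inter> f ` A) (U \<inter> ?D)"
        using dist [OF img [OF less.prems(1)] D fAK DK] by simp
      then obtain c b where cb: "c \<in> A" "f c \<in> U" "b \<in> A" "b \<oplus>\<^bsub>L\<^esub> f b \<in> U" "a = f c \<oplus>\<^bsub>L\<^esub> (b \<oplus>\<^bsub>L\<^esub> f b)"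
        by (auto simp: submodule_sum_def)
      note cl = AL [OF cb(1)] AL [OF cb(3)] fL [OF cb(1)] fL [OF cb(3)] AL [OF a]
      have "(b \<oplus>\<^bsub>L\<^esub> f b) \<ominus>\<^bsub>L\<^esub> b = f b" using cl by (simp add: L.add_minus_cancel)
      then have "f b \<in> U" using U''(6) [OF cb(4) AU [OF cb(3)]] by simp
      then have b: "b \<in> ?A0" using cb by simp
      have "a = (f c \<oplus>\<^bsub>L\<^esub> f b) \<oplus>\<^bsub>L\<^esub> b" unfolding cb(5) using cl by (simp add: L.M.a_ac)
      then have "a \<ominus>\<^bsub>L\<^esub> b = f c \<oplus>\<^bsub>L\<^esub> f b" using cl by (simp add: L.add_minus_cancel)
      also have "\<dots> = f (c \<oplus>\<^bsub>L\<^esub> b)" using fadd cb by simp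
      finally have "a \<ominus>\<^bsub>L\<^esub> b \<in> f ` ?A0"
        using L.submoduleD(3) [OF A0, of c b] b cb by blast
      then show ?thesis using b A'(6) [OF a cb(3)] by blast
    qed
    show False
    proof (cases "?E = A")
      case True
      have fin: "finite ?A0" using finite_submodule [OF L A0] .
      have "card A \<le> card (f ` ?A0)" using True fin by (intro card_mono) auto
      also have "\<dots> \<le> card ?A0" using fin by (rule card_image_le)
      also have "\<dots> < card A" using A0_less finite_submodule [OF L less.prems(1)] by (rule psubset_card_mono [rotated])
      finally show False by simp
    next
      case False
      then have EA: "?E \<subseteq> ?A0" using proper [OF E] by blast
      have "a \<in> ?A0" if a: "a \<in> A" for a
      proof -
        obtain b where b: "b \<in> ?A0" "a \<ominus>\<^bsub>L\<^esub> b \<in> ?E" using split [OF a] by blast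
        have "(a \<ominus>\<^bsub>L\<^esub> b) \<oplus>\<^bsub>L\<^esub> b \<in> ?A0" using L.submoduleD(3) [OF A0] b EA by blast
        moreover have "(a \<ominus>\<^bsub>L\<^esub> b) \<oplus>\<^bsub>L\<^esub> b = a"
          using AL [OF a] AL b(1) by (simp add: a_minus_def L.M.a_assoc L.M.l_neg)
        ultimately show ?thesis by simp
      qed
      then show False using A0_less by blast
    qed
  qed
qed

text \<open>
  If \<open>x\<close> and \<open>y\<close> have the same annihilator, \<open>a x \<mapsto> a y\<close> is a well-defined homomorphism on \<open>Rx\<close>.
\<close>

lemma distributive_annihilator:
  assumes L: "finite_module R L" and K: "K \<in> submodules R L" and U: "U \<in> distributive_submodules R L K"
    and x: "x \<in> U" and y: "y \<in> K" and ann: "annihilator R L x = annihilator R L y"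
  shows "y \<in> U"
proof -
  interpret L: left_module R L using L by (rule finite_moduleD)
  have U': "U \<in> submodules R L" "U \<subseteq> K" using U by (auto simp: distributive_submodules_def)
  have xL: "x \<in> carrier L" and yL: "y \<in> carrier L"
    using L.submoduleD(1) [OF K] U' x y by auto
  define f where "f = (\<lambda>z. (SOME a. a \<in> carrier R \<and> a \<odot>\<^bsub>L\<^esub> x = z) \<odot>\<^bsub>L\<^esub> y)"
  have f: "f (a \<odot>\<^bsub>L\<^esub> x) = a \<odot>\<^bsub>L\<^esub> y" if a: "a \<in> carrier R" for a
  proof -
    define b where "b = (SOME b. b \<in> carrier R \<and> b \<odot>\<^bsub>L\<^esub> x = a \<odot>\<^bsub>L\<^esub> x)"
    have b: "b \<in> carrier R \<and> b \<odot>\<^bsub>L\<^esub> x = a \<odot>\<^bsub>L\<^esub> x"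
      unfolding b_def by (rule someI [where x = a]) (use a in simp)
    have "b \<ominus>\<^bsub>R\<^esub> a \<in> annihilator R L x"
      using a b xL by (simp add: annihilator_def L.smult_minus_left L.minus_eq_zero_iff L.smult_closed)
    then have "b \<odot>\<^bsub>L\<^esub> y = a \<odot>\<^bsub>L\<^esub> y"
      unfolding ann using a b yL by (simp add: annihilator_def L.smult_minus_left L.minus_eq_zero_iff L.smult_closed)
    then show ?thesis by (simp add: f_def b_def)
  qed
  let ?A = "cyclic_submodule R L x"
  have "f ` ?A \<subseteq> U"
  proof (rule distributive_hom_invariant [OF L K U L.cyclic_submodule [OF xL]])
    show "?A \<subseteq> U" using L.submoduleD(4) [OF U'(1)] x by (auto simp: cyclic_submodule_def)
    show "f z \<in> K" if "z \<in> ?A" for z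
      using that f L.submoduleD(4) [OF K] y by (auto simp: cyclic_submodule_def)
    show "f (z \<oplus>\<^bsub>L\<^esub> w) = f z \<oplus>\<^bsub>L\<^esub> f w" if zw: "z \<in> ?A" "w \<in> ?A" for z w
    proof -
      obtain a b where ab: "a \<in> carrier R" "b \<in> carrier R" "z = a \<odot>\<^bsub>L\<^esub> x" "w = b \<odot>\<^bsub>L\<^esub> x"
        using zw by (auto simp: cyclic_submodule_def)
      have "z \<oplus>\<^bsub>L\<^esub> w = (a \<oplus>\<^bsub>R\<^esub> b) \<odot>\<^bsub>L\<^esub> x" using ab xL by (simp add: L.smult_l_distr)
      then show ?thesis using ab yL by (simp add: f L.smult_l_distr)
    qed
    show "f (a \<odot>\<^bsub>L\<^esub> z) = a \<odot>\<^bsub>L\<^esub> f z" if az: "a \<in> carrier R" "z \<in> ?A" for a z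
    proof -
      obtain b where b: "b \<in> carrier R" "z = b \<odot>\<^bsub>L\<^esub> x"
        using az by (auto simp: cyclic_submodule_def)
      have "a \<odot>\<^bsub>L\<^esub> z = (a \<otimes>\<^bsub>R\<^esub> b) \<odot>\<^bsub>L\<^esub> x" using az b xL by (simp add: L.smult_assoc)
      then show ?thesis using az b yL by (simp add: f L.smult_assoc)
    qed
  qed
  moreover have "f x = y" using f [OF L.R.one_closed] xL yL by (simp add: L.smult_one)
  ultimately show ?thesis using L.mem_cyclic_submodule [OF xL] by blast
qed

text \<open>
  By the previous lemma a distributive submodule \<open>U\<close> consists of all elements of the kernel of \<open>\<pi>\<close>
  whose annihilator is among those of elements of \<open>U\<close>.
\<close>

lemma Z_le:
  assumes L: "finite_module R L" and N: "finite_module R N" and \<pi>: "\<pi> \<in> Epi R L N"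
    and \<A>: "finite \<A>" "\<And>x. x \<in> carrier L \<Longrightarrow> annihilator R L x \<in> \<A>"
  shows "Z R L N \<pi> \<le> 2 ^ card \<A>"
proof -
  interpret L: left_module R L using L by (rule finite_moduleD)
  let ?K = "ker L \<pi>"
  let ?D = "distributive_submodules R L ?K"
  have K: "?K \<in> submodules R L" by (rule kernel_in_submodules [OF L N \<pi>])
  have sub: "U \<subseteq> W" if UW: "U \<in> ?D" "W \<in> ?D" "annihilator R L ` U = annihilator R L ` W" for U W
  proof
    fix y assume y: "y \<in> U"
    then have "annihilator R L y \<in> annihilator R L ` W" using UW(3) by blast
    then obtain x where x: "x \<in> W" "annihilator R L x = annihilator R L y" by force
    have "y \<in> ?K" using UW(1) y by (auto simp: distributive_submodules_def)
    then show "y \<in> W" using distributive_annihilator [OF L K UW(2) x(1) _ x(2)] by simp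
  qed
  have "card ?D \<le> card (Pow \<A>)"
  proof (rule card_inj_on_le)
    show "inj_on (\<lambda>U. annihilator R L ` U) ?D"
      by (intro inj_onI equalityI sub) (simp_all only:)
    show "(\<lambda>U. annihilator R L ` U) ` ?D \<subseteq> Pow \<A>"
      using \<A>(2) by (auto simp: distributive_submodules_def submodules_def)
  qed (use \<A> in simp)
  then show ?thesis using \<A> by (simp add: Z_eq_card_distributive [OF L N \<pi>] card_Pow)
qed

section \<open>Fibre products of two quotients\<close>

lemma factor_Epi:
  assumes L: "finite_module R L" and H: "finite_module R H" and N: "finite_module R N"
    and p: "p \<in> Epi R L H" and \<pi>: "\<pi> \<in> Epi R L N" and k: "ker L p \<subseteq> ker L \<pi>"
  shows "\<exists>\<pi>' \<in> Epi R H N. \<forall>x \<in> carrier L. \<pi>' (p x) = \<pi> x"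
proof -
  obtain f where f: "f \<in> Hom R H N" "\<forall>x \<in> carrier L. f (p x) = \<pi> x"
    using factor_iff [OF L p \<pi>] kernel_subset_iff [OF L H p N \<pi>] k by blast
  have "f ` carrier H = (\<lambda>x. f (p x)) ` carrier L"
    unfolding EpiD(2) [OF p, symmetric] by (simp add: image_image)
  also have "\<dots> = \<pi> ` carrier L" using f(2) by (intro image_cong) auto
  finally show ?thesis using f EpiD(2) [OF \<pi>] by (auto simp: Epi_def)
qed

lemma card_le_mult_fibres:
  assumes "finite A" "finite B" "f ` A \<subseteq> B" "\<And>y. y \<in> B \<Longrightarrow> card {x \<in> A. f x = y} \<le> k"
  shows "card A \<le> card B * k"
proof -
  have "card A = (\<Sum>y \<in> B. card {x \<in> A. f x = y})"
    using sum.group [OF assms(1-3), of "\<lambda>_. 1 :: nat"] by simp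
  also have "\<dots> \<le> card B * k" using sum_bounded_above [of B _ k] assms(4) by simp
  finally show ?thesis .
qed

lemma card_le_card_kernel:
  assumes L: "finite_module R L" and H: "finite_module R H" and p: "p \<in> Epi R L H"
  shows "card (carrier L) \<le> card (carrier H) * card (ker L p)"
proof (rule card_le_mult_fibres [of _ _ p])
  interpret L: left_module R L using L by (rule finite_moduleD)
  show "finite (carrier L)" "finite (carrier H)" using finite_moduleD L H by blast+
  show "p ` carrier L \<subseteq> carrier H" using EpiD(2) [OF p] by simp
  fix y assume "y \<in> carrier H"
  show "card {x \<in> carrier L. p x = y} \<le> card (ker L p)"
  proof (cases "{x \<in> carrier L. p x = y} = {}")
    case False
    then obtain z where z: "z \<in> carrier L" "p z = y" by blast
    show ?thesis
    proof (rule card_inj_on_le)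
      show "inj_on (\<lambda>x. x \<ominus>\<^bsub>L\<^esub> z) {x \<in> carrier L. p x = y}"
      proof (rule inj_onI)
        fix x x' assume x: "x \<in> {x \<in> carrier L. p x = y}" "x' \<in> {x \<in> carrier L. p x = y}" "x \<ominus>\<^bsub>L\<^esub> z = x' \<ominus>\<^bsub>L\<^esub> z"
        then show "x = x'" using z by (simp add: a_minus_def L.M.add.right_cancel)
      qed
      show "(\<lambda>x. x \<ominus>\<^bsub>L\<^esub> z) ` {x \<in> carrier L. p x = y} \<subseteq> ker L p"
        using z Epi_eq_iff [OF L H p _ z(1)] by auto
      show "finite (ker L p)" using finite_submodule [OF L kernel_in_submodules [OF L H p]] .
    qed
  next
    case True
    then show ?thesis by (simp only: card.empty)
  qed
qed

text \<open>
  The pairs of projections that exhibit \<open>L\<close> as the fibre product of \<open>\<pi>' : L' \<rightarrow> N\<close> and \<open>\<epsilon> : E \<rightarrow> N\<close>.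
\<close>

definition fibre_product_maps :: "('r, 'x) ring_scheme \<Rightarrow> ('r, nat) module \<Rightarrow> ('r, nat) module \<Rightarrow> (nat \<Rightarrow> nat) \<Rightarrow>
    ('r, nat) module \<Rightarrow> (nat \<Rightarrow> nat) \<Rightarrow> ((nat \<Rightarrow> nat) \<times> (nat \<Rightarrow> nat)) set" where
  "fibre_product_maps R L L' \<pi>' E \<epsilon> = {(p, q). p \<in> Epi R L L' \<and> q \<in> Epi R L E \<and>
     bij_betw (\<lambda>x. (p x, q x)) (carrier L) {(l, e) \<in> carrier L' \<times> carrier E. \<pi>' l = \<epsilon> e}}"

lemma fibre_product_mapsD:
  assumes "(p, q) \<in> fibre_product_maps R L L' \<pi>' E \<epsilon>"
  shows "p \<in> Epi R L L'" "q \<in> Epi R L E"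
    "bij_betw (\<lambda>x. (p x, q x)) (carrier L) {(l, e) \<in> carrier L' \<times> carrier E. \<pi>' l = \<epsilon> e}"
    "\<And>x. x \<in> carrier L \<Longrightarrow> \<pi>' (p x) = \<epsilon> (q x)"
    "\<And>x y. x \<in> carrier L \<Longrightarrow> y \<in> carrier L \<Longrightarrow> p x = p y \<Longrightarrow> q x = q y \<Longrightarrow> x = y"
proof -
  show pq: "p \<in> Epi R L L'" "q \<in> Epi R L E"
    and b: "bij_betw (\<lambda>x. (p x, q x)) (carrier L) {(l, e) \<in> carrier L' \<times> carrier E. \<pi>' l = \<epsilon> e}"
    using assms by (auto simp: fibre_product_maps_def)
  show "\<pi>' (p x) = \<epsilon> (q x)" if "x \<in> carrier L" for x
    using bij_betwE [OF b] that by blast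
  show "x = y" if "x \<in> carrier L" "y \<in> carrier L" "p x = p y" "q x = q y" for x y
    using inj_onD [OF bij_betw_imp_inj_on [OF b], of x y] that by simp
qed

lemma finite_fibre_product_maps:
  assumes "finite_module R L" "finite_module R L'" "finite_module R E"
  shows "finite (fibre_product_maps R L L' \<pi>' E \<epsilon>)"
  by (rule finite_subset [of _ "Epi R L L' \<times> Epi R L E"])
    (use assms finite_Epi in \<open>auto simp: fibre_product_maps_def\<close>)

text \<open>
  Both modules are identified with the same set of compatible pairs, and the operations on that set
  are forced, because the projections are homomorphisms.
\<close>

lemma fibre_product_unique:
  assumes L: "left_module R L" and M: "left_module R M"
    and pq: "(p, q) \<in> fibre_product_maps R L L' \<pi>' E \<epsilon>" and pq': "(p', q') \<in> fibre_product_maps R M L' \<pi>' E \<epsilon>"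
  shows "\<exists>f \<in> Iso R L M. \<forall>x \<in> carrier L. p' (f x) = p x \<and> q' (f x) = q x"
proof -
  interpret L: left_module R L by fact
  interpret M: left_module R M by fact
  note D = fibre_product_mapsD [OF pq] and D' = fibre_product_mapsD [OF pq']
  note p = HomD [OF EpiD(1) [OF D(1)]] and q = HomD [OF EpiD(1) [OF D(2)]]
  note p' = HomD [OF EpiD(1) [OF D'(1)]] and q' = HomD [OF EpiD(1) [OF D'(2)]]
  let ?F = "{(l, e) \<in> carrier L' \<times> carrier E. \<pi>' l = \<epsilon> e}"
  \<comment> \<open>The compatible pairs \<open>?F\<close> serve as a common coordinate set for \<open>L\<close> and \<open>M\<close>.\<close>
  define g where "g = inv_into (carrier M) (\<lambda>x. (p' x, q' x))"
  define f where "f = (\<lambda>x \<in> carrier L. g (p x, q x))"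
  have g: "bij_betw g ?F (carrier M)" unfolding g_def by (rule bij_betw_inv_into [OF D'(3)])
  have "bij_betw (\<lambda>x. g (p x, q x)) (carrier L) (carrier M)"
    using bij_betw_trans [OF D(3) g] by (simp add: o_def)
  then have fb: "bij_betw f (carrier L) (carrier M)" unfolding f_def by simp
  have fM: "f x \<in> carrier M" if "x \<in> carrier L" for x using bij_betwE [OF fb] that by blast
  have f: "p' (f x) = p x \<and> q' (f x) = q x" if x: "x \<in> carrier L" for x
  proof -
    have "(p x, q x) \<in> (\<lambda>x. (p' x, q' x)) ` carrier M"
      using bij_betwE [OF D(3)] x bij_betw_imp_surj_on [OF D'(3)] by blast
    then have "(\<lambda>x. (p' x, q' x)) (g (p x, q x)) = (p x, q x)" unfolding g_def by (rule f_inv_into_f)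
    then show ?thesis using x by (simp add: f_def)
  qed
  have "f (x \<oplus>\<^bsub>L\<^esub> y) = f x \<oplus>\<^bsub>M\<^esub> f y" if xy: "x \<in> carrier L" "y \<in> carrier L" for x y
    by (rule D'(5)) (use xy fM f p(2) q(2) p'(2) q'(2) in simp_all)
  moreover have "f (a \<odot>\<^bsub>L\<^esub> x) = a \<odot>\<^bsub>M\<^esub> f x" if ax: "a \<in> carrier R" "x \<in> carrier L" for a x
    by (rule D'(5)) (use ax fM f p(3) q(3) p'(3) q'(3) in \<open>simp_all add: L.smult_closed M.smult_closed\<close>)
  ultimately have "f \<in> Iso R L M" using fb fM by (auto simp: Iso_def Hom_def f_def)
  then show ?thesis using f by blast
qed

text \<open>
  For a fixed pair of projections \<open>(p, q)\<close>, every other pair is \<open>(p \<circ> f, q \<circ> f)\<close> for an automorphism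
  \<open>f\<close>. This is what makes the weights \<open>1 / |Aut L|\<close> disappear in the final count.
\<close>

lemma card_fibre_product_maps_le:
  assumes L: "finite_module R L"
  shows "card (fibre_product_maps R L L' \<pi>' E \<epsilon>) \<le> card (Aut R L)"
proof (cases "fibre_product_maps R L L' \<pi>' E \<epsilon> = {}")
  case False
  then obtain p q where pq: "(p, q) \<in> fibre_product_maps R L L' \<pi>' E \<epsilon>" by fast
  have Lm: "left_module R L" using L by (rule finite_moduleD)
  let ?g = "\<lambda>f. (compose (carrier L) p f, compose (carrier L) q f)"
  have "fibre_product_maps R L L' \<pi>' E \<epsilon> \<subseteq> ?g ` Aut R L"
  proof (rule subsetI, unfold split_paired_all)
    fix p' q' assume pq': "(p', q') \<in> fibre_product_maps R L L' \<pi>' E \<epsilon>"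
    obtain f where f: "f \<in> Aut R L" "\<forall>x \<in> carrier L. p (f x) = p' x \<and> q (f x) = q' x"
      using fibre_product_unique [OF Lm Lm pq' pq] by blast
    have e: "p' \<in> extensional (carrier L)" "q' \<in> extensional (carrier L)"
      using HomD(4) EpiD(1) fibre_product_mapsD(1,2) [OF pq'] by blast+
    have "compose (carrier L) p f = p'" "compose (carrier L) q f = q'"
      using f(2) e by (auto intro!: extensionalityI [where A = "carrier L"] simp: compose_eq)
    then show "(p', q') \<in> ?g ` Aut R L" using f(1) by blast
  qed
  then have "card (fibre_product_maps R L L' \<pi>' E \<epsilon>) \<le> card (?g ` Aut R L)"
    using finite_Iso [OF L L] by (intro card_mono) auto
  also have "\<dots> \<le> card (Aut R L)" using finite_Iso [OF L L] by (rule card_image_le)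
  finally show ?thesis .
qed simp

text \<open>
  The kernel of the projection \<open>p\<close> to \<open>L'\<close> is mapped injectively into the kernel of \<open>\<epsilon>\<close> by the other
  projection.
\<close>

lemma card_le_fibre_product:
  assumes L: "finite_module R L" and L': "finite_module R L'" and E: "finite_module R E" and N: "finite_module R N"
    and \<epsilon>: "\<epsilon> \<in> Epi R E N" and pq: "(p, q) \<in> fibre_product_maps R L L' \<pi>' E \<epsilon>"
  shows "card (carrier L) \<le> card (carrier L') * card (ker E \<epsilon>)"
proof -
  interpret L: left_module R L using L by (rule finite_moduleD)
  note D = fibre_product_mapsD [OF pq]
  have q0: "q \<zero>\<^bsub>L\<^esub> = \<zero>\<^bsub>E\<^esub>" using Hom_zero finite_moduleD(1) L E EpiD(1) D(2) by blast
  have "card (ker L p) \<le> card (ker E \<epsilon>)"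
  proof (rule card_inj_on_le)
    show "inj_on q (ker L p)" using D(5) by (auto simp: inj_on_def ker_def)
    show "q ` ker L p \<subseteq> ker E \<epsilon>"
    proof
      fix y assume "y \<in> q ` ker L p"
      then obtain x where x: "x \<in> carrier L" "p x = p \<zero>\<^bsub>L\<^esub>" "y = q x" by (auto simp: ker_def)
      have "\<epsilon> y = \<epsilon> (q \<zero>\<^bsub>L\<^esub>)" using D(4) [OF x(1)] D(4) [OF L.M.zero_closed] x by simp
      then show "y \<in> ker E \<epsilon>"
        using x HomD(1) [OF EpiD(1) [OF D(2)]] q0 by (simp add: ker_def)
    qed
    show "finite (ker E \<epsilon>)" using finite_submodule [OF E kernel_in_submodules [OF E N \<epsilon>]] .
  qed
  then show ?thesis
    using card_le_card_kernel [OF L L' D(1)] by (meson le_trans mult_le_mono2)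
qed

text \<open>
  If \<open>T\<close> and \<open>V\<close> are complementary in the kernel of \<open>\<pi>\<close>, then \<open>L\<close> is the fibre product of \<open>L/T\<close> and
  \<open>L/V\<close> over \<open>N\<close>: given \<open>a + T\<close> and \<open>b + V\<close> with \<open>\<pi> a = \<pi> b\<close>, write \<open>a - b = t + v\<close>; then \<open>v + b\<close>
  lies in both cosets.
\<close>

lemma fibre_product_of_complement:
  assumes L: "finite_module R L" and L': "finite_module R L'" and E: "finite_module R E" and N: "finite_module R N"
    and \<pi>: "\<pi> \<in> Epi R L N" and p: "p \<in> Epi R L L'" and q: "q \<in> Epi R L E"
    and \<pi>': "\<And>x. x \<in> carrier L \<Longrightarrow> \<pi>' (p x) = \<pi> x" and \<epsilon>: "\<And>x. x \<in> carrier L \<Longrightarrow> \<epsilon> (q x) = \<pi> x"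
    and disj: "ker L p \<inter> ker L q = {\<zero>\<^bsub>L\<^esub>}"
    and sum: "submodule_sum L (ker L p) (ker L q) = ker L \<pi>"
  shows "(p, q) \<in> fibre_product_maps R L L' \<pi>' E \<epsilon>"
proof -
  interpret L: left_module R L using L by (rule finite_moduleD)
  let ?F = "{(l, e) \<in> carrier L' \<times> carrier E. \<pi>' l = \<epsilon> e}"
  note p' = HomD [OF EpiD(1) [OF p]] and q' = HomD [OF EpiD(1) [OF q]]
  have inj: "inj_on (\<lambda>x. (p x, q x)) (carrier L)"
  proof (rule inj_onI)
    fix x y assume xy: "x \<in> carrier L" "y \<in> carrier L" "(p x, q x) = (p y, q y)"
    then have "x \<ominus>\<^bsub>L\<^esub> y \<in> ker L p \<inter> ker L q"
      using Epi_eq_iff [OF L L' p xy(1,2)] Epi_eq_iff [OF L E q xy(1,2)] by simp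
    then show "x = y" using xy by (simp add: disj L.minus_eq_zero_iff)
  qed
  have cover: "(l, e) \<in> (\<lambda>x. (p x, q x)) ` carrier L" if le: "(l, e) \<in> ?F" for l e
  proof -
    have "l \<in> p ` carrier L" "e \<in> q ` carrier L" using le by (auto simp: EpiD(2) [OF p] EpiD(2) [OF q])
    then obtain a b where ab: "a \<in> carrier L" "l = p a" "b \<in> carrier L" "e = q b" by blast
    have "\<pi> a = \<pi> b" using le ab \<pi>' \<epsilon> by simp
    then have "a \<ominus>\<^bsub>L\<^esub> b \<in> submodule_sum L (ker L p) (ker L q)"
      using Epi_eq_iff [OF L N \<pi> ab(1,3)] by (simp add: sum)
    then obtain t v where tv: "t \<in> ker L p" "v \<in> ker L q" "a \<ominus>\<^bsub>L\<^esub> b = t \<oplus>\<^bsub>L\<^esub> v"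
      by (auto simp: submodule_sum_def)
    have c: "t \<in> carrier L" "v \<in> carrier L" using tv by (auto simp: ker_def)
    have "a = (a \<ominus>\<^bsub>L\<^esub> b) \<oplus>\<^bsub>L\<^esub> b" using ab by (simp add: a_minus_def L.M.a_assoc L.M.l_neg)
    then have a: "a = t \<oplus>\<^bsub>L\<^esub> (v \<oplus>\<^bsub>L\<^esub> b)" unfolding tv(3) using ab c by (simp add: L.M.a_assoc)
    let ?x = "v \<oplus>\<^bsub>L\<^esub> b"
    have x: "?x \<in> carrier L" using ab c by simp
    have "p a = p ?x"
      unfolding Epi_eq_iff [OF L L' p ab(1) x] using a tv(1) c x L.add_minus_cancel(2) [OF c(1) x] by simp
    moreover have "q ?x = q b"
      unfolding Epi_eq_iff [OF L E q x ab(3)] using tv(2) L.add_minus_cancel(2) [OF c(2) ab(3)] by simp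
    ultimately have "(l, e) = (p ?x, q ?x)" by (simp only: ab(2,4))
    then show ?thesis using x by blast
  qed
  have "(\<lambda>x. (p x, q x)) ` carrier L = ?F"
  proof (rule equalityI)
    show "(\<lambda>x. (p x, q x)) ` carrier L \<subseteq> ?F"
      by (rule image_subsetI) (simp add: p'(1) q'(1) \<pi>' \<epsilon>)
    show "?F \<subseteq> (\<lambda>x. (p x, q x)) ` carrier L" by (rule subrelI) (rule cover)
  qed
  then have "bij_betw (\<lambda>x. (p x, q x)) (carrier L) ?F"
    using inj by (simp only: bij_betw_def)
  then show ?thesis using p q by (simp add: fibre_product_maps_def)
qed

section \<open>Families of modules with finitely many scalars\<close>

lemma card_bijection:
  assumes "finite A"
  obtains b :: "'a \<Rightarrow> nat" where "bij_betw b A {..<card A}"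
  using ex_bij_betw_finite_nat [OF assms] by (auto simp: atLeast0LessThan)

text \<open>
  Transporting two modules to a common index set, isomorphism is detected by equality of the
  addition and multiplication tables. As there are only finitely many tables of a given size, this
  yields finiteness of the number of modules of that size.
\<close>

lemma Iso_of_equal_tables:
  assumes L: "left_module R L" and M: "left_module R M"
    and b: "bij_betw b (carrier L) I" and c: "bij_betw c (carrier M) I"
    and add: "\<And>i j. i \<in> I \<Longrightarrow> j \<in> I \<Longrightarrow>
      b (inv_into (carrier L) b i \<oplus>\<^bsub>L\<^esub> inv_into (carrier L) b j) = c (inv_into (carrier M) c i \<oplus>\<^bsub>M\<^esub> inv_into (carrier M) c j)"
    and smult: "\<And>a i. a \<in> carrier R \<Longrightarrow> i \<in> I \<Longrightarrow>
      b (a \<odot>\<^bsub>L\<^esub> inv_into (carrier L) b i) = c (a \<odot>\<^bsub>M\<^esub> inv_into (carrier M) c i)"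
  shows "Iso R L M \<noteq> {}"
proof -
  interpret L: left_module R L by fact
  interpret M: left_module R M by fact
  define f where "f = (\<lambda>x \<in> carrier L. inv_into (carrier M) c (b x))"
  have fb: "bij_betw f (carrier L) (carrier M)"
    using bij_betw_trans [OF b bij_betw_inv_into [OF c]] by (simp add: f_def o_def)
  have fM: "f x \<in> carrier M" if "x \<in> carrier L" for x using bij_betwE [OF fb] that by blast
  have bI: "b x \<in> I" if "x \<in> carrier L" for x using bij_betwE [OF b] that by blast
  have bi: "inv_into (carrier L) b (b x) = x" if "x \<in> carrier L" for x
    using bij_betw_inv_into_left [OF b that] .
  have cf: "inv_into (carrier M) c (b x) = f x" if "x \<in> carrier L" for x using that by (simp add: f_def)
  have ci: "inv_into (carrier M) c (c y) = y" if "y \<in> carrier M" for y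
    using bij_betw_inv_into_left [OF c that] .
  have "f (x \<oplus>\<^bsub>L\<^esub> y) = f x \<oplus>\<^bsub>M\<^esub> f y" if xy: "x \<in> carrier L" "y \<in> carrier L" for x y
  proof -
    have "b (x \<oplus>\<^bsub>L\<^esub> y) = c (f x \<oplus>\<^bsub>M\<^esub> f y)"
      using add [OF bI [OF xy(1)] bI [OF xy(2)]] xy by (simp add: bi cf)
    then show ?thesis using cf [of "x \<oplus>\<^bsub>L\<^esub> y"] xy fM ci by simp
  qed
  moreover have "f (a \<odot>\<^bsub>L\<^esub> x) = a \<odot>\<^bsub>M\<^esub> f x" if ax: "a \<in> carrier R" "x \<in> carrier L" for a x
  proof -
    have "b (a \<odot>\<^bsub>L\<^esub> x) = c (a \<odot>\<^bsub>M\<^esub> f x)"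
      using smult [OF ax(1) bI [OF ax(2)]] ax by (simp add: bi cf)
    then show ?thesis using cf [of "a \<odot>\<^bsub>L\<^esub> x"] ax fM ci by (simp add: L.smult_closed M.smult_closed)
  qed
  ultimately have "f \<in> Iso R L M" using fb fM by (auto simp: Iso_def Hom_def f_def)
  then show ?thesis by blast
qed

text \<open>
  What is needed of the members of a level: one finite module per isomorphism class, closed under
  quotients, with \<open>R\<close> acting through finitely many scalars, uniformly over the family.
\<close>

locale module_family =
  fixes R :: "('r, 'x) ring_scheme" and \<M> :: "('r, nat) module set" and F :: "'r set"
  assumes modules: "L \<in> \<M> \<Longrightarrow> finite_module R L"
    and non_isomorphic: "L \<in> \<M> \<Longrightarrow> L' \<in> \<M> \<Longrightarrow> Iso R L L' \<noteq> {} \<Longrightarrow> L = L'"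
    and quotients: "L \<in> \<M> \<Longrightarrow> U \<in> submodules R L \<Longrightarrow> \<exists>L' \<in> \<M>. \<exists>p \<in> Epi R L L'. ker L p = U"
    and finite_scalars: "finite F" and scalars_closed: "F \<subseteq> carrier R"
    and scalars: "a \<in> carrier R \<Longrightarrow> \<exists>b \<in> F. \<forall>L \<in> \<M>. \<forall>x \<in> carrier L. a \<odot>\<^bsub>L\<^esub> x = b \<odot>\<^bsub>L\<^esub> x"
begin

lemma card_cyclic_le:
  assumes "L \<in> \<M>" "x \<in> carrier L"
  shows "card (cyclic_submodule R L x) \<le> card F"
proof -
  have "cyclic_submodule R L x \<subseteq> (\<lambda>b. b \<odot>\<^bsub>L\<^esub> x) ` F"
    unfolding cyclic_submodule_def using scalars assms by fastforce
  then show ?thesis using finite_scalars by (meson card_image_le card_mono finite_imageI le_trans)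
qed

lemma finite_annihilators: "\<exists>\<A>. finite \<A> \<and> (\<forall>L \<in> \<M>. \<forall>x \<in> carrier L. annihilator R L x \<in> \<A>)"
proof (intro exI conjI ballI)
  \<comment> \<open>An annihilator is the set of all scalars that act like one of its elements from \<open>F\<close>.\<close>
  let ?E = "\<lambda>S. {a \<in> carrier R. \<exists>b \<in> S. \<forall>L \<in> \<M>. \<forall>x \<in> carrier L. a \<odot>\<^bsub>L\<^esub> x = b \<odot>\<^bsub>L\<^esub> x}"
  show "finite (?E ` Pow F)" using finite_scalars by simp
  fix L x assume Lx: "L \<in> \<M>" "x \<in> carrier L"
  have "annihilator R L x = ?E {b \<in> F. b \<odot>\<^bsub>L\<^esub> x = \<zero>\<^bsub>L\<^esub>}"
    unfolding annihilator_def using scalars Lx by fastforce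
  then show "annihilator R L x \<in> ?E ` Pow F" by blast
qed

text \<open>
  A module with \<open>k\<close> elements is determined up to isomorphism by its tables on \<open>{..<k}\<close>, in which
  only the scalars from the finite set \<open>F\<close> have to be recorded.
\<close>

lemma finite_bounded_card: "finite {L \<in> \<M>. card (carrier L) \<le> m}"
proof -
  let ?S = "{L \<in> \<M>. card (carrier L) \<le> m}"
  define b where "b = (\<lambda>L :: ('r, nat) module. SOME b. bij_betw b (carrier L) {..<card (carrier L)})"
  have b: "bij_betw (b L) (carrier L) {..<card (carrier L)}" if "L \<in> \<M>" for L
    unfolding b_def using card_bijection [OF finite_moduleD(2) [OF modules [OF that]]] by (metis someI_ex)
  let ?i = "\<lambda>L. inv_into (carrier L) (b L)"
  define tab where "tab = (\<lambda>L. (card (carrier L),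
    (\<lambda>(i, j) \<in> {..<card (carrier L)} \<times> {..<card (carrier L)}. b L (?i L i \<oplus>\<^bsub>L\<^esub> ?i L j)),
    (\<lambda>(a, i) \<in> F \<times> {..<card (carrier L)}. b L (a \<odot>\<^bsub>L\<^esub> ?i L i))))"
  let ?T = "SIGMA k:{..m}. ({..<k} \<times> {..<k} \<rightarrow>\<^sub>E {..<k}) \<times> (F \<times> {..<k} \<rightarrow>\<^sub>E {..<k})"
  have "tab ` ?S \<subseteq> ?T"
  proof (rule image_subsetI)
    fix L assume L: "L \<in> ?S"
    interpret L: left_module R L using L modules finite_moduleD by blast
    have bc: "b L x < card (carrier L)" if "x \<in> carrier L" for x
      using bij_betwE [OF b] L that by auto
    have ic: "?i L i \<in> carrier L" if "i < card (carrier L)" for i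
      using bij_betwE [OF bij_betw_inv_into [OF b]] L that by auto
    show "tab L \<in> ?T"
      using L bc ic scalars_closed by (auto simp: tab_def L.smult_closed subset_iff)
  qed
  moreover have "finite ?T" using finite_scalars by (auto intro!: finite_SigmaI finite_PiE)
  moreover have "inj_on tab ?S"
  proof (rule inj_onI)
    fix L M assume L: "L \<in> ?S" and M: "M \<in> ?S" and eq: "tab L = tab M"
    have LM: "left_module R L" "left_module R M" using L M modules finite_moduleD by blast+
    have k: "card (carrier L) = card (carrier M)" using eq by (simp add: tab_def)
    have "Iso R L M \<noteq> {}"
    proof (rule Iso_of_equal_tables [OF LM b [of L]])
      show "bij_betw (b M) (carrier M) {..<card (carrier L)}" using b [of M] M k by simp
      show "b L (?i L i \<oplus>\<^bsub>L\<^esub> ?i L j) = b M (?i M i \<oplus>\<^bsub>M\<^esub> ?i M j)"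
        if "i \<in> {..<card (carrier L)}" "j \<in> {..<card (carrier L)}" for i j
        using arg_cong [OF eq, of "\<lambda>t. fst (snd t) (i, j)"] that k by (simp add: tab_def)
      show "b L (a \<odot>\<^bsub>L\<^esub> ?i L i) = b M (a \<odot>\<^bsub>M\<^esub> ?i M i)"
        if a: "a \<in> carrier R" and i: "i \<in> {..<card (carrier L)}" for a i
      proof -
        obtain a' where a': "a' \<in> F" "\<forall>L \<in> \<M>. \<forall>x \<in> carrier L. a \<odot>\<^bsub>L\<^esub> x = a' \<odot>\<^bsub>L\<^esub> x"
          using scalars [OF a] by blast
        have "?i L i \<in> carrier L" "?i M i \<in> carrier M"
          using bij_betwE [OF bij_betw_inv_into [OF b]] L M i k by auto
        then show ?thesis
          using arg_cong [OF eq, of "\<lambda>t. snd (snd t) (a', i)"] i k a' L M by (simp add: tab_def)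
      qed
    qed (use L in simp)
    then show "L = M" using non_isomorphic L M by blast
  qed
  ultimately show ?thesis using inj_on_finite by blast
qed

end

section \<open>Levels\<close>

lemma iso_class_self: "finite_module R L \<Longrightarrow> L \<in> iso_class R L"
  using id_in_Iso [of R L] by (auto simp: iso_class_def)

lemma iso_class_eq_iff:
  assumes L: "finite_module R L" and M: "finite_module R M"
  shows "iso_class R L = iso_class R M \<longleftrightarrow> Iso R L M \<noteq> {}"
proof
  assume "iso_class R L = iso_class R M"
  then have "M \<in> iso_class R L" using iso_class_self [OF M] by simp
  then show "Iso R L M \<noteq> {}" by (simp add: iso_class_def)
next
  assume "Iso R L M \<noteq> {}"
  then obtain f where f: "f \<in> Iso R L M" by blast
  have LM: "left_module R L" "left_module R M" using L M finite_moduleD by blast+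
  have "Iso R L K \<noteq> {} \<longleftrightarrow> Iso R M K \<noteq> {}" for K
    using Iso_compose [OF LM(1) f] Iso_compose [OF LM(2) Iso_inv [OF LM f]] by blast
  then show "iso_class R L = iso_class R M" by (simp add: iso_class_def)
qed

lemma mem_quo:
  assumes L: "finite_module R L" and U: "U \<in> submodules R L" and J: "(J, j) \<in> quo R L U"
  shows "finite_module R J" "j \<in> Epi R L J" "ker L j = U"
proof -
  obtain H h where H: "finite_module R H" "h \<in> Epi R L H" "ker L h = U" "quo R L U = quotient_class R L H h"
    using quo_obtain [OF L U] .
  have J': "finite_module R J \<and> j \<in> Epi R L J \<and> (\<forall>x \<in> carrier L. \<forall>y \<in> carrier L. h x = h y \<longleftrightarrow> j x = j y)"
    using J unfolding H(4) mem_quotient_class_iff [OF L H(2)] .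
  then show "finite_module R J" "j \<in> Epi R L J" by blast+
  then show "ker L j = U"
    using H(3) kernel_subset_iff [OF L H(1,2), of J j] kernel_subset_iff [OF L _ _ H(1,2), of J j] J' by blast
qed

lemma generated_level_iso_class:
  assumes G: "\<forall>N \<in> G. finite_module R N" and C: "C \<in> generated_level R G"
  shows "\<exists>N. finite_module R N \<and> C = iso_class R N"
  using C
proof cases
  case (join L H h F f J j)
  have k: "ker L h \<in> submodules R L" "ker L f \<in> submodules R L"
    using kernel_in_submodules join by blast+
  interpret L: left_module R L using join finite_moduleD by blast
  have "(J, j) \<in> quo R L (ker L h \<inter> ker L f)"
    using join by (simp add: quotient_class_quo join_quo k)
  then show ?thesis using mem_quo(1) [OF join(2) L.Int_submodule [OF k]] join by blast
qed (use G in auto)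

lemma Epi_annihilated:
  assumes L: "finite_module R L" and N: "finite_module R N" and p: "p \<in> Epi R L N" and a: "a \<in> carrier R"
    and ann: "\<forall>x \<in> carrier L. a \<odot>\<^bsub>L\<^esub> x = \<zero>\<^bsub>L\<^esub>"
  shows "\<forall>x \<in> carrier N. a \<odot>\<^bsub>N\<^esub> x = \<zero>\<^bsub>N\<^esub>"
proof
  fix y assume "y \<in> carrier N"
  then obtain x where x: "x \<in> carrier L" "y = p x" using EpiD(2) [OF p] by blast
  have "a \<odot>\<^bsub>N\<^esub> y = p (a \<odot>\<^bsub>L\<^esub> x)" using HomD(3) [OF EpiD(1) [OF p] a x(1)] x by simp
  then show "a \<odot>\<^bsub>N\<^esub> y = \<zero>\<^bsub>N\<^esub>"
    using ann x Hom_zero [OF finite_moduleD(1) [OF L] finite_moduleD(1) [OF N] EpiD(1) [OF p]] by simp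
qed

text \<open>
  The scalars that annihilate all generators annihilate the whole level: this property passes to
  quotients, and to joins because the kernel of a join is the intersection of the two kernels.
\<close>

lemma generated_level_annihilated:
  assumes G: "\<forall>N \<in> G. finite_module R N"
    and a: "a \<in> carrier R" "\<forall>N \<in> G. \<forall>x \<in> carrier N. a \<odot>\<^bsub>N\<^esub> x = \<zero>\<^bsub>N\<^esub>"
    and C: "C \<in> generated_level R G"
  shows "\<forall>L \<in> C. \<forall>x \<in> carrier L. a \<odot>\<^bsub>L\<^esub> x = \<zero>\<^bsub>L\<^esub>"
  using C
proof induction
  \<comment> \<open>It suffices to treat one module of each isomorphism class.\<close>
  have whole: "\<forall>L \<in> iso_class R N. \<forall>x \<in> carrier L. a \<odot>\<^bsub>L\<^esub> x = \<zero>\<^bsub>L\<^esub>"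
    if N: "finite_module R N" "\<forall>x \<in> carrier N. a \<odot>\<^bsub>N\<^esub> x = \<zero>\<^bsub>N\<^esub>" for N
    using Epi_annihilated [OF N(1) _ Iso_imp_Epi a(1) N(2)] by (auto simp: iso_class_def)
  {
    case (generator N)
    then show ?case using whole G a(2) by blast
  next
    case (zero N)
    interpret N: left_module R N using zero finite_moduleD by blast
    have "\<forall>x \<in> carrier N. a \<odot>\<^bsub>N\<^esub> x = \<zero>\<^bsub>N\<^esub>" using zero(2) N.smult_closed [OF a(1)] by blast
    then show ?case using whole zero(1) by blast
  next
    case (quotient L N)
    have "\<forall>x \<in> carrier L. a \<odot>\<^bsub>L\<^esub> x = \<zero>\<^bsub>L\<^esub>"
      using quotient.IH iso_class_self [OF quotient.hyps(1)] by blast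
    moreover obtain p where "p \<in> Epi R L N" using quotient.hyps by blast
    ultimately have "\<forall>x \<in> carrier N. a \<odot>\<^bsub>N\<^esub> x = \<zero>\<^bsub>N\<^esub>"
      using Epi_annihilated [OF quotient.hyps(1,3) _ a(1)] by blast
    then show ?case by (rule whole [OF quotient.hyps(3)])
  next
    case (join L H h F f J j)
    note L = join.hyps(1) and H = join.hyps(2,3) and F = join.hyps(5,6)
    interpret L: left_module R L using L finite_moduleD by blast
    have k: "ker L h \<in> submodules R L" "ker L f \<in> submodules R L"
      using kernel_in_submodules L H F by blast+
    have "(J, j) \<in> quo R L (ker L h \<inter> ker L f)"
      using join.hyps by (simp add: quotient_class_quo join_quo k)
    note J = mem_quo [OF L L.Int_submodule [OF k] this]
    have HF: "\<forall>x \<in> carrier H. a \<odot>\<^bsub>H\<^esub> x = \<zero>\<^bsub>H\<^esub>" "\<forall>x \<in> carrier F. a \<odot>\<^bsub>F\<^esub> x = \<zero>\<^bsub>F\<^esub>"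
      using join.IH iso_class_self H(1) F(1) by blast+
    have lm: "left_module R L" "left_module R H" "left_module R F" "left_module R J"
      using L H F J finite_moduleD by blast+
    have "a \<odot>\<^bsub>J\<^esub> y = \<zero>\<^bsub>J\<^esub>" if y: "y \<in> carrier J" for y
    proof -
      obtain x where x: "x \<in> carrier L" "y = j x" using EpiD(2) [OF J(2)] y by blast
      have "a \<odot>\<^bsub>L\<^esub> x \<in> ker L h"
        using kernel_iff [OF lm(1,2) EpiD(1) [OF H(2)]] HF(1) HomD(1,3) [OF EpiD(1) [OF H(2)]] a(1) x
        by (simp add: L.smult_closed)
      moreover have "a \<odot>\<^bsub>L\<^esub> x \<in> ker L f"
        using kernel_iff [OF lm(1,3) EpiD(1) [OF F(2)]] HF(2) HomD(1,3) [OF EpiD(1) [OF F(2)]] a(1) x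
        by (simp add: L.smult_closed)
      ultimately have "a \<odot>\<^bsub>L\<^esub> x \<in> ker L j" using J(3) by blast
      then show ?thesis
        using kernel_iff [OF lm(1,4) EpiD(1) [OF J(2)]] HomD(3) [OF EpiD(1) [OF J(2)] a(1) x(1)] x by simp
    qed
    then show ?case using whole J(1) by blast
  }
qed

text \<open>
  There are only finitely many ways for a scalar to act on the carriers of finitely many finite
  modules; choose one scalar for each of them.
\<close>

lemma finite_scalars_of_finite_set:
  assumes G: "finite G" "\<forall>N \<in> G. finite_module R N"
  shows "\<exists>F. finite F \<and> F \<subseteq> carrier R \<and> (\<forall>a \<in> carrier R. \<exists>b \<in> F. \<forall>N \<in> G. \<forall>x \<in> carrier N. a \<odot>\<^bsub>N\<^esub> x = b \<odot>\<^bsub>N\<^esub> x)"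
proof -
  let ?act = "\<lambda>a. \<lambda>N \<in> G. \<lambda>x \<in> carrier N. a \<odot>\<^bsub>N\<^esub> x"
  let ?P = "\<Pi>\<^sub>E N \<in> G. carrier N \<rightarrow>\<^sub>E carrier N"
  have "?act ` carrier R \<subseteq> ?P"
    using G(2) left_module.smult_closed by (fastforce simp: finite_module_def)
  moreover have "finite ?P" using G by (auto intro!: finite_PiE simp: finite_module_def)
  ultimately have "finite (?act ` carrier R)" by (rule finite_subset)
  then obtain F where F: "F \<subseteq> carrier R" "finite F" "?act ` carrier R = ?act ` F"
    using finite_subset_image [of "?act ` carrier R" ?act "carrier R"] by blast
  have "\<exists>b \<in> F. \<forall>N \<in> G. \<forall>x \<in> carrier N. a \<odot>\<^bsub>N\<^esub> x = b \<odot>\<^bsub>N\<^esub> x" if "a \<in> carrier R" for a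
  proof -
    have "?act a \<in> ?act ` F" using F(3) that by blast
    then obtain b where b: "b \<in> F" "?act a = ?act b" by blast
    have "a \<odot>\<^bsub>N\<^esub> x = b \<odot>\<^bsub>N\<^esub> x" if "N \<in> G" "x \<in> carrier N" for N x
      using fun_cong [OF fun_cong [OF b(2), of N], of x] that by simp
    then show ?thesis using b(1) by blast
  qed
  then show ?thesis using F by blast
qed

definition representatives :: "('r, nat) module set set \<Rightarrow> ('r, nat) module set" where
  "representatives \<L> = (\<lambda>C. SOME L. L \<in> C) ` \<L>"

lemma representative:
  assumes G: "\<forall>N \<in> G. finite_module R N" and C: "C \<in> generated_level R G"
  shows "finite_module R (SOME L. L \<in> C)" "iso_class R (SOME L. L \<in> C) = C"
proof -
  obtain N where N: "finite_module R N" "C = iso_class R N" using generated_level_iso_class [OF assms] by blast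
  have "(SOME L. L \<in> C) \<in> C" by (rule someI [where x = N]) (use N iso_class_self in blast)
  then have *: "finite_module R (SOME L. L \<in> C)" "Iso R N (SOME L. L \<in> C) \<noteq> {}"
    unfolding N(2) iso_class_def by auto
  show "finite_module R (SOME L. L \<in> C)" using * by blast
  show "iso_class R (SOME L. L \<in> C) = C" using iso_class_eq_iff [OF N(1) *(1)] *(2) N(2) by simp
qed

text \<open>
  If \<open>a\<close> and \<open>b\<close> act in the same way on the finitely many generators, \<open>a - b\<close> annihilates the
  generators, hence the level. So scalars representing all actions on the generators represent all
  actions on the level.
\<close>

lemma level_module_family:
  assumes R: "ring R" and \<L>: "level R \<L>"
  shows "\<exists>F. module_family R (representatives \<L>) F"
    and "\<And>C. C \<in> \<L> \<Longrightarrow> iso_class R (SOME L. L \<in> C) = C"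
proof -
  obtain G where G: "finite G" "\<forall>N \<in> G. finite_module R N" "\<L> = generated_level R G"
    using \<L> unfolding level_def by blast
  note rep = representative [OF G(2), folded G(3)]
  show "\<And>C. C \<in> \<L> \<Longrightarrow> iso_class R (SOME L. L \<in> C) = C" by (rule rep)
  obtain F where F: "finite F" "F \<subseteq> carrier R"
    "\<And>a. a \<in> carrier R \<Longrightarrow> \<exists>b \<in> F. \<forall>N \<in> G. \<forall>x \<in> carrier N. a \<odot>\<^bsub>N\<^esub> x = b \<odot>\<^bsub>N\<^esub> x"
    using finite_scalars_of_finite_set [OF G(1,2)] by blast
  interpret R: ring R by fact
  have "module_family R (representatives \<L>) F"
  proof
    fix L assume "L \<in> representatives \<L>"
    then show "finite_module R L" using rep by (auto simp: representatives_def)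
  next
    fix L L' assume LL': "L \<in> representatives \<L>" "L' \<in> representatives \<L>" "Iso R L L' \<noteq> {}"
    then obtain C C' where C: "C \<in> \<L>" "C' \<in> \<L>" "L = (SOME L. L \<in> C)" "L' = (SOME L. L \<in> C')"
      by (auto simp: representatives_def)
    have "C = C'"
      using rep [OF C(1)] rep [OF C(2)] iso_class_eq_iff [of R L L'] LL'(3) C(3,4) by simp
    then show "L = L'" using C by simp
  next
    fix L U assume L: "L \<in> representatives \<L>" and U: "U \<in> submodules R L"
    obtain C where C: "C \<in> \<L>" "L = (SOME L. L \<in> C)" using L by (auto simp: representatives_def)
    have fL: "finite_module R L" and cL: "iso_class R L \<in> \<L>" using rep C by auto
    obtain Q p where Q: "finite_module R Q" "p \<in> Epi R L Q" "ker L p = U" using ex_quotient [OF fL U] .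
    have cQ: "iso_class R Q \<in> \<L>"
      unfolding G(3) by (rule generated_level.quotient [OF fL _ Q(1)]) (use cL G(3) Q in auto)
    let ?Q = "SOME L. L \<in> iso_class R Q"
    obtain f where f: "f \<in> Iso R Q ?Q"
      using rep [OF cQ] iso_class_eq_iff [OF Q(1)] by blast
    interpret L: left_module R L using fL by (rule finite_moduleD)
    have fp: "compose (carrier L) f p \<in> Epi R L ?Q"
      using Epi_compose [OF _ Q(2) Iso_imp_Epi [OF f]] fL finite_moduleD by blast
    have inj: "inj_on f (carrier Q)" using f by (auto simp: Iso_def bij_betw_def)
    have "ker L (compose (carrier L) f p) = ker L p"
      using inj_on_eq_iff [OF inj] HomD(1) [OF EpiD(1) [OF Q(2)]] by (auto simp: ker_def compose_eq)
    then show "\<exists>L' \<in> representatives \<L>. \<exists>p \<in> Epi R L L'. ker L p = U"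
      using fp cQ Q(3) by (auto simp: representatives_def)
  next
    show "finite F" "F \<subseteq> carrier R" by fact+
  next
    fix a assume a: "a \<in> carrier R"
    obtain b where b: "b \<in> F" "\<forall>N \<in> G. \<forall>x \<in> carrier N. a \<odot>\<^bsub>N\<^esub> x = b \<odot>\<^bsub>N\<^esub> x"
      using F(3) [OF a] by blast
    have bR: "b \<in> carrier R" using b F by blast
    have ann: "\<forall>N \<in> G. \<forall>x \<in> carrier N. (a \<ominus>\<^bsub>R\<^esub> b) \<odot>\<^bsub>N\<^esub> x = \<zero>\<^bsub>N\<^esub>"
    proof (intro ballI)
      fix N x assume N: "N \<in> G" "x \<in> carrier N"
      interpret N: left_module R N using N G(2) finite_moduleD by blast
      show "(a \<ominus>\<^bsub>R\<^esub> b) \<odot>\<^bsub>N\<^esub> x = \<zero>\<^bsub>N\<^esub>"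
        using b(2) N a bR by (simp add: N.smult_minus_left N.minus_eq_zero_iff N.smult_closed)
    qed
    have "a \<odot>\<^bsub>L\<^esub> x = b \<odot>\<^bsub>L\<^esub> x" if L: "L \<in> representatives \<L>" and x: "x \<in> carrier L" for L x
    proof -
      obtain C where C: "C \<in> \<L>" "L = (SOME L. L \<in> C)" using L by (auto simp: representatives_def)
      have fL: "finite_module R L" and LC: "L \<in> C" using rep [OF C(1)] C(2) iso_class_self by auto
      interpret L: left_module R L using fL by (rule finite_moduleD)
      have "(a \<ominus>\<^bsub>R\<^esub> b) \<odot>\<^bsub>L\<^esub> x = \<zero>\<^bsub>L\<^esub>"
        using generated_level_annihilated [OF G(2) R.minus_closed [OF a bR] ann] C(1) G(3) LC x by blast
      then show ?thesis
        using x a bR by (simp add: L.smult_minus_left L.minus_eq_zero_iff L.smult_closed)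
    qed
    then show "\<exists>b \<in> F. \<forall>L \<in> representatives \<L>. \<forall>x \<in> carrier L. a \<odot>\<^bsub>L\<^esub> x = b \<odot>\<^bsub>L\<^esub> x"
      using b(1) by blast
  qed
  then show "\<exists>F. module_family R (representatives \<L>) F" by blast
qed

section \<open>Boundedness of the moments\<close>

context module_family
begin

definition of_card_le :: "nat \<Rightarrow> ('r, nat) module set" where
  "of_card_le m = {L \<in> \<M>. card (carrier L) \<le> m}"

text \<open>
  For a maximal submodule \<open>V\<close> of the kernel of \<open>L \<rightarrow> N\<close>, the kernel of \<open>L/V \<rightarrow> N\<close> is simple, hence
  cyclic, and \<open>card F\<close> bounds the size of cyclic modules. So \<open>L/V \<rightarrow> N\<close> is of this kind.
\<close>

definition small_extensions :: "('r, nat) module \<Rightarrow> (('r, nat) module \<times> (nat \<Rightarrow> nat)) set" where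
  "small_extensions N = {(E, \<epsilon>). E \<in> \<M> \<and> \<epsilon> \<in> Epi R E N \<and> card (ker E \<epsilon>) \<le> card F}"

text \<open>
  The data \<open>(L', \<pi>', E, \<epsilon>)\<close> of which \<open>L\<close> is a fibre product over \<open>N\<close>.
\<close>

definition pieces :: "nat \<Rightarrow> ('r, nat) module \<Rightarrow>
    (('r, nat) module \<times> (nat \<Rightarrow> nat) \<times> ('r, nat) module \<times> (nat \<Rightarrow> nat)) set" where
  "pieces m N = (SIGMA L':of_card_le m. Epi R L' N \<times> small_extensions N)"

definition gluings :: "('r, nat) module \<Rightarrow> ('r, nat) module \<times> (nat \<Rightarrow> nat) \<times> ('r, nat) module \<times> (nat \<Rightarrow> nat)
    \<Rightarrow> ((nat \<Rightarrow> nat) \<times> (nat \<Rightarrow> nat)) set" where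
  "gluings L = (\<lambda>(L', \<pi>', E, \<epsilon>). fibre_product_maps R L L' \<pi>' E \<epsilon>)"

definition weight :: "('r, nat) module \<Rightarrow> ('r, nat) module \<times> (nat \<Rightarrow> nat) \<times> ('r, nat) module \<times> (nat \<Rightarrow> nat) \<Rightarrow> real" where
  "weight N = (\<lambda>(L', \<pi>', E, \<epsilon>). \<bar>real_of_int (mu R L' N \<pi>')\<bar> / real (card (Aut R L')))"

lemma of_card_le_module: "L \<in> of_card_le m \<Longrightarrow> finite_module R L"
  by (simp add: of_card_le_def modules)

lemma finite_of_card_le: "finite (of_card_le m)"
  by (simp add: of_card_le_def finite_bounded_card)

lemma finite_small_extensions:
  assumes N: "finite_module R N"
  shows "finite (small_extensions N)"
proof (rule finite_subset)
  show "small_extensions N \<subseteq> (SIGMA E:of_card_le (card (carrier N) * card F). Epi R E N)"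
  proof (rule subrelI)
    fix E \<epsilon> assume "(E, \<epsilon>) \<in> small_extensions N"
    then have E: "E \<in> \<M>" "\<epsilon> \<in> Epi R E N" "card (ker E \<epsilon>) \<le> card F" by (auto simp: small_extensions_def)
    have "card (carrier E) \<le> card (carrier N) * card (ker E \<epsilon>)"
      by (rule card_le_card_kernel [OF modules [OF E(1)] N E(2)])
    also have "\<dots> \<le> card (carrier N) * card F" using E(3) by simp
    finally show "(E, \<epsilon>) \<in> (SIGMA E:of_card_le (card (carrier N) * card F). Epi R E N)"
      using E by (simp add: of_card_le_def)
  qed
  show "finite (SIGMA E:of_card_le (card (carrier N) * card F). Epi R E N)"
    using finite_of_card_le finite_Epi [OF of_card_le_module N] by (rule finite_SigmaI)
qed

lemma finite_pieces: "finite_module R N \<Longrightarrow> finite (pieces m N)"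
  unfolding pieces_def
  using finite_of_card_le finite_Epi [OF of_card_le_module] finite_small_extensions by (auto intro!: finite_SigmaI)

lemma finite_gluings:
  assumes "finite_module R N" "L \<in> \<M>" "i \<in> pieces m N"
  shows "finite (gluings L i)"
  using assms by (auto simp: gluings_def pieces_def of_card_le_def small_extensions_def
      intro!: finite_fibre_product_maps modules)

lemma weight_nonneg: "weight N i \<ge> 0"
  by (simp add: weight_def split: prod.split)

text \<open>
  A pair \<open>(V, T)\<close> determines \<open>p : L \<rightarrow> L/T\<close> only up to automorphisms of \<open>L' = L/T\<close>, and distinct
  automorphisms give distinct \<open>p\<close>. So \<open>(\<pi>, V, T)\<close> comes from at least \<open>|Aut L'|\<close> elements of the index
  set on the right, each of weight \<open>|\<mu>(L' \<rightarrow> N)| / |Aut L'|\<close>, where \<open>\<mu>(L' \<rightarrow> N)\<close> is the Moebius value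
  at \<open>T\<close>.
\<close>

lemma mob_le_sum_gluings:
  assumes N: "finite_module R N" and L: "L \<in> of_card_le m" and \<pi>: "\<pi> \<in> Epi R L N"
    and V: "V \<in> maximal_submodules R L (ker L \<pi>)" and T: "T \<in> complements R L (ker L \<pi>) V"
  shows "\<bar>real_of_int (mob R L (ker L \<pi>) T)\<bar> \<le>
    (\<Sum>((L', \<pi>', E, \<epsilon>), (p, q)) \<in> {((L', \<pi>', E, \<epsilon>), (p, q)) \<in> Sigma (pieces m N) (gluings L).
        (compose (carrier L) \<epsilon> q, ker L q, ker L p) = (\<pi>, V, T)}. weight N (L', \<pi>', E, \<epsilon>))"
    (is "_ \<le> sum ?w ?\<Theta>")
proof -
  have LM: "L \<in> \<M>" "card (carrier L) \<le> m" using L by (auto simp: of_card_le_def)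
  have fL: "finite_module R L" by (rule modules [OF LM(1)])
  interpret L: left_module R L using fL by (rule finite_moduleD)
  let ?K = "ker L \<pi>"
  have K: "?K \<in> submodules R L" by (rule kernel_in_submodules [OF fL N \<pi>])
  note V' = maximal_submodulesD [OF V]
  have T': "T \<in> submodules R L" "T \<subseteq> ?K" "T \<inter> V = {\<zero>\<^bsub>L\<^esub>}" using T by (auto simp: complements_def)
  have Tc: "card T \<le> card F" "submodule_sum L T V = ?K"
    using complements_card_le [OF fL K V T] card_cyclic_le [OF LM(1)] by blast+
  obtain L' p where L': "L' \<in> \<M>" and p: "p \<in> Epi R L L'" "ker L p = T" using quotients [OF LM(1) T'(1)] by blast
  obtain E q where E: "E \<in> \<M>" and q: "q \<in> Epi R L E" "ker L q = V" using quotients [OF LM(1) V'(1)] by blast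
  have fL': "finite_module R L'" and fE: "finite_module R E" using modules L' E by blast+
  have "card (carrier L') \<le> card (carrier L)"
    using card_image_le [OF finite_moduleD(2) [OF fL], of p] EpiD(2) [OF p(1)] by simp
  then have bL': "L' \<in> of_card_le m" using L' LM by (simp add: of_card_le_def)
  have Vsub: "ker L q \<subseteq> ?K" using V'(2) q(2) by blast
  obtain \<epsilon> where \<epsilon>: "\<epsilon> \<in> Epi R E N" "\<forall>x \<in> carrier L. \<epsilon> (q x) = \<pi> x"
    using factor_Epi [OF fL fE N q(1) \<pi> Vsub] by blast
  have q0: "q \<zero>\<^bsub>L\<^esub> = \<zero>\<^bsub>E\<^esub>" using Hom_zero finite_moduleD(1) fL fE EpiD(1) q(1) by blast
  have "ker E \<epsilon> \<subseteq> q ` T"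
  proof
    fix y assume y: "y \<in> ker E \<epsilon>"
    then have "y \<in> q ` carrier L" by (simp add: ker_def EpiD(2) [OF q(1)])
    then obtain x where x: "x \<in> carrier L" "y = q x" by blast
    have "\<pi> x = \<pi> \<zero>\<^bsub>L\<^esub>" using y x \<epsilon>(2) q0 by (metis (mono_tags, lifting) L.M.zero_closed ker_def mem_Collect_eq)
    then have "x \<in> submodule_sum L T V" using x(1) by (simp add: Tc(2) ker_def)
    then obtain t v where tv: "t \<in> T" "v \<in> V" "x = t \<oplus>\<^bsub>L\<^esub> v" by (auto simp: submodule_sum_def)
    have c: "t \<in> carrier L" "v \<in> carrier L" using tv T'(1) V'(1) L.submoduleD(1) by blast+
    have "x \<ominus>\<^bsub>L\<^esub> t \<in> ker L q" using tv c by (simp add: L.add_minus_cancel q(2))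
    then have "q x = q t" using Epi_eq_iff [OF fL fE q(1) x(1) c(1)] by blast
    then show "y \<in> q ` T" using tv(1) x(2) by blast
  qed
  then have "card (ker E \<epsilon>) \<le> card T"
    using finite_submodule [OF fL T'(1)] by (meson card_image_le card_mono finite_imageI le_trans)
  then have ext: "(E, \<epsilon>) \<in> small_extensions N"
    using E \<epsilon> Tc(1) by (simp add: small_extensions_def)
  have comp: "compose (carrier L) \<epsilon> q = \<pi>"
    using \<epsilon>(2) HomD(4) [OF EpiD(1) [OF \<pi>]]
    by (auto intro!: extensionalityI [where A = "carrier L"] simp: compose_eq)
  define ps where "ps = (\<lambda>\<sigma> :: nat \<Rightarrow> nat. compose (carrier L) \<sigma> p)"
  have ps: "ps \<sigma> \<in> Epi R L L'" "ker L (ps \<sigma>) = T" if \<sigma>: "\<sigma> \<in> Aut R L'" for \<sigma>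
  proof -
    show "ps \<sigma> \<in> Epi R L L'"
      unfolding ps_def by (rule Epi_compose [OF L.left_module_axioms p(1) Iso_imp_Epi [OF \<sigma>]])
    have inj: "inj_on \<sigma> (carrier L')" using \<sigma> by (auto simp: Iso_def bij_betw_def)
    show "ker L (ps \<sigma>) = T"
      unfolding p(2) [symmetric] ps_def
      using inj_on_eq_iff [OF inj] HomD(1) [OF EpiD(1) [OF p(1)]] by (auto simp: ker_def compose_eq)
  qed
  \<comment> \<open>Twisting \<open>p\<close> by \<open>\<sigma>\<close> has to be compensated in the map \<open>L' \<rightarrow> N\<close> below \<open>\<pi>\<close>.\<close>
  define \<pi>s where "\<pi>s = (\<lambda>\<sigma>. SOME \<pi>'. \<pi>' \<in> Epi R L' N \<and> (\<forall>x \<in> carrier L. \<pi>' (ps \<sigma> x) = \<pi> x))"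
  have \<pi>s: "\<pi>s \<sigma> \<in> Epi R L' N \<and> (\<forall>x \<in> carrier L. \<pi>s \<sigma> (ps \<sigma> x) = \<pi> x)" if \<sigma>: "\<sigma> \<in> Aut R L'" for \<sigma>
  proof -
    have "ker L (ps \<sigma>) \<subseteq> ?K" using ps(2) [OF \<sigma>] T'(2) by simp
    then have "\<exists>\<pi>'. \<pi>' \<in> Epi R L' N \<and> (\<forall>x \<in> carrier L. \<pi>' (ps \<sigma> x) = \<pi> x)"
      using factor_Epi [OF fL fL' N ps(1) [OF \<sigma>] \<pi>] by blast
    then show ?thesis unfolding \<pi>s_def by (rule someI_ex)
  qed
  let ?g = "\<lambda>\<sigma>. ((L', \<pi>s \<sigma>, E, \<epsilon>), (ps \<sigma>, q))"
  have inj: "inj_on ?g (Aut R L')"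
  proof (rule inj_onI)
    fix \<sigma> \<tau> assume st: "\<sigma> \<in> Aut R L'" "\<tau> \<in> Aut R L'" "?g \<sigma> = ?g \<tau>"
    show "\<sigma> = \<tau>"
    proof (rule extensionalityI)
      show "\<sigma> \<in> extensional (carrier L')" "\<tau> \<in> extensional (carrier L')"
        using st HomD(4) by (auto simp: Iso_def)
      fix y assume "y \<in> carrier L'"
      then have "y \<in> p ` carrier L" by (simp add: EpiD(2) [OF p(1)])
      then obtain x where x: "x \<in> carrier L" "y = p x" by blast
      have "ps \<sigma> x = ps \<tau> x" using st(3) by simp
      then show "\<sigma> y = \<tau> y" using x by (simp add: ps_def compose_eq)
    qed
  qed
  have sub: "?g ` Aut R L' \<subseteq> ?\<Theta>"
  proof (rule image_subsetI)
    fix \<sigma> assume \<sigma>: "\<sigma> \<in> Aut R L'"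
    have "(ps \<sigma>, q) \<in> fibre_product_maps R L L' (\<pi>s \<sigma>) E \<epsilon>"
      by (rule fibre_product_of_complement [OF fL fL' fE N \<pi> ps(1) [OF \<sigma>] q(1)])
        (use \<pi>s [OF \<sigma>] \<epsilon>(2) ps(2) [OF \<sigma>] q(2) T'(3) Tc(2) in auto)
    then show "?g \<sigma> \<in> ?\<Theta>"
      using \<pi>s [OF \<sigma>] bL' ext comp q(2) ps(2) [OF \<sigma>] by (simp add: pieces_def gluings_def)
  qed
  have fin: "finite ?\<Theta>"
    by (rule finite_subset [of _ "Sigma (pieces m N) (gluings L)"])
      (use finite_pieces [OF N] finite_gluings [OF N LM(1)] in auto)
  have mu: "mu R L' N (\<pi>s \<sigma>) = mob R L ?K T" if \<sigma>: "\<sigma> \<in> Aut R L'" for \<sigma>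
    using mu_quotient [OF fL fL' N ps(1) [OF \<sigma>] \<pi>] \<pi>s [OF \<sigma>] ps(2) [OF \<sigma>] by simp
  have "\<bar>real_of_int (mob R L ?K T)\<bar> = (\<Sum>\<sigma> \<in> Aut R L'. \<bar>real_of_int (mob R L ?K T)\<bar> / real (card (Aut R L')))"
    using card_Aut_pos [OF fL'] by simp
  also have "\<dots> = (\<Sum>\<sigma> \<in> Aut R L'. ?w (?g \<sigma>))"
    by (rule sum.cong [OF refl]) (simp add: weight_def mu)
  also have "\<dots> = sum ?w (?g ` Aut R L')" by (simp add: sum.reindex [OF inj] o_def)
  also have "\<dots> \<le> sum ?w ?\<Theta>"
    by (rule sum_mono2 [OF fin sub]) (auto simp: weight_nonneg)
  finally show ?thesis .
qed

text \<open>
  Apply \<open>abs_mob_le_sum_complements\<close> to every maximal submodule \<open>V\<close> and the previous lemma to every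
  resulting triple \<open>(\<pi>, V, T)\<close>; distinct triples use disjoint parts of the index set, because
  \<open>(\<pi>, V, T)\<close> can be recovered from the projections and \<open>\<epsilon>\<close>.
\<close>

lemma sum_maximal_le_sum_gluings:
  assumes N: "finite_module R N" and L: "L \<in> of_card_le m"
  shows "(\<Sum>\<pi> \<in> Epi R L N. real (card (maximal_submodules R L (ker L \<pi>))) * \<bar>real_of_int (mu R L N \<pi>)\<bar>)
    \<le> (\<Sum>i \<in> pieces m N. weight N i * real (card (gluings L i)))"
proof -
  have LM: "L \<in> \<M>" using L by (simp add: of_card_le_def)
  have fL: "finite_module R L" by (rule modules [OF LM])
  let ?K = "\<lambda>\<pi>. ker L \<pi>" and ?max = "\<lambda>\<pi>. maximal_submodules R L (ker L \<pi>)"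
  let ?comp = "\<lambda>\<pi> V. complements R L (ker L \<pi>) V"
  have K: "?K \<pi> \<in> submodules R L" if "\<pi> \<in> Epi R L N" for \<pi> by (rule kernel_in_submodules [OF fL N that])
  have fm: "finite (?max \<pi>)" "finite (?comp \<pi> V)" for \<pi> V
    using finite_submodules [OF fL] by (auto simp: maximal_submodules_def complements_def)
  have fE: "finite (Epi R L N)" by (rule finite_Epi [OF fL N])
  let ?tri = "SIGMA \<pi>:Epi R L N. SIGMA V:?max \<pi>. ?comp \<pi> V"
  let ?\<Theta> = "Sigma (pieces m N) (gluings L)"
  define \<kappa> where "\<kappa> = (\<lambda>((L' :: ('r, nat) module, \<pi>' :: nat \<Rightarrow> nat, E :: ('r, nat) module, \<epsilon> :: nat \<Rightarrow> nat),
      (p :: nat \<Rightarrow> nat, q :: nat \<Rightarrow> nat)). (compose (carrier L) \<epsilon> q, ker L q, ker L p))"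
  define w where "w = (\<lambda>(i, g :: (nat \<Rightarrow> nat) \<times> (nat \<Rightarrow> nat)). weight N i)"
  have f\<Theta>: "finite ?\<Theta>" using finite_pieces [OF N] finite_gluings [OF N LM] by auto
  have ftri: "finite ?tri" by (intro finite_SigmaI fE fm)
  have "(\<Sum>\<pi> \<in> Epi R L N. real (card (?max \<pi>)) * \<bar>real_of_int (mu R L N \<pi>)\<bar>)
      \<le> (\<Sum>\<pi> \<in> Epi R L N. \<Sum>V \<in> ?max \<pi>. \<Sum>T \<in> ?comp \<pi> V. \<bar>real_of_int (mob R L (?K \<pi>) T)\<bar>)"
  proof (rule sum_mono)
    fix \<pi> assume \<pi>: "\<pi> \<in> Epi R L N"
    have "\<bar>real_of_int (mu R L N \<pi>)\<bar> \<le> (\<Sum>T \<in> ?comp \<pi> V. \<bar>real_of_int (mob R L (?K \<pi>) T)\<bar>)"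
      if V: "V \<in> ?max \<pi>" for V
    proof -
      have "real_of_int \<bar>mu R L N \<pi>\<bar> \<le> real_of_int (\<Sum>T \<in> ?comp \<pi> V. \<bar>mob R L (?K \<pi>) T\<bar>)"
        using abs_mob_le_sum_complements [OF fL K [OF \<pi>] V] mu_eq_mob [OF fL N \<pi>] by (simp only: of_int_le_iff)
      then show ?thesis by simp
    qed
    then have "(\<Sum>V \<in> ?max \<pi>. \<bar>real_of_int (mu R L N \<pi>)\<bar>)
        \<le> (\<Sum>V \<in> ?max \<pi>. \<Sum>T \<in> ?comp \<pi> V. \<bar>real_of_int (mob R L (?K \<pi>) T)\<bar>)" by (rule sum_mono)
    then show "real (card (?max \<pi>)) * \<bar>real_of_int (mu R L N \<pi>)\<bar>
        \<le> (\<Sum>V \<in> ?max \<pi>. \<Sum>T \<in> ?comp \<pi> V. \<bar>real_of_int (mob R L (?K \<pi>) T)\<bar>)" by simp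
  qed
  also have "\<dots> = (\<Sum>(\<pi>, V, T) \<in> ?tri. \<bar>real_of_int (mob R L (?K \<pi>) T)\<bar>)"
  proof -
    have pairs: "(\<Sum>V \<in> ?max \<pi>. \<Sum>T \<in> ?comp \<pi> V. \<bar>real_of_int (mob R L (?K \<pi>) T)\<bar>)
        = (\<Sum>(V, T) \<in> (SIGMA V:?max \<pi>. ?comp \<pi> V). \<bar>real_of_int (mob R L (?K \<pi>) T)\<bar>)" for \<pi>
      by (rule sum.Sigma) (use fm in auto)
    show ?thesis
      unfolding pairs by (intro sum.Sigma fE ballI finite_SigmaI fm)
  qed
  also have "\<dots> \<le> (\<Sum>t \<in> ?tri. sum w {\<theta> \<in> ?\<Theta>. \<kappa> \<theta> = t})"
  proof (rule sum_mono, unfold split_paired_all)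
    fix \<pi> V T assume t: "(\<pi>, V, T) \<in> ?tri"
    have eq: "{((L', \<pi>', E, \<epsilon>), (p, q)) \<in> ?\<Theta>. (compose (carrier L) \<epsilon> q, ker L q, ker L p) = (\<pi>, V, T)}
        = {\<theta> \<in> ?\<Theta>. \<kappa> \<theta> = (\<pi>, V, T)}"
      by (auto simp: \<kappa>_def)
    have "(\<lambda>((L', \<pi>', E, \<epsilon>), (p, q)). weight N (L', \<pi>', E, \<epsilon>)) = w" by (auto simp: w_def)
    then show "(case (\<pi>, V, T) of (\<pi>, V, T) \<Rightarrow> \<bar>real_of_int (mob R L (?K \<pi>) T)\<bar>) \<le> sum w {\<theta> \<in> ?\<Theta>. \<kappa> \<theta> = (\<pi>, V, T)}"
      using mob_le_sum_gluings [OF N L, of \<pi> V T] t unfolding eq by simp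
  qed
  also have "\<dots> = (\<Sum>t \<in> ?tri. sum w {\<theta> \<in> {\<theta> \<in> ?\<Theta>. \<kappa> \<theta> \<in> ?tri}. \<kappa> \<theta> = t})"
    by (rule sum.cong [OF refl], rule arg_cong2 [where f = sum]) auto
  also have "\<dots> = sum w {\<theta> \<in> ?\<Theta>. \<kappa> \<theta> \<in> ?tri}"
    by (rule sum.group) (use f\<Theta> ftri in auto)
  also have "\<dots> \<le> sum w ?\<Theta>"
    by (rule sum_mono2 [OF f\<Theta>]) (auto simp: w_def weight_nonneg)
  also have "\<dots> = (\<Sum>i \<in> pieces m N. \<Sum>g \<in> gluings L i. weight N i)"
    unfolding w_def by (rule sum.Sigma [symmetric]) (use finite_pieces [OF N] finite_gluings [OF N LM] in auto)
  also have "\<dots> = (\<Sum>i \<in> pieces m N. weight N i * real (card (gluings L i)))" by (simp add: mult.commute)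
  finally show ?thesis .
qed

text \<open>
  At most one \<open>L\<close> contributes, as fibre products are unique up to isomorphism and the family
  contains each isomorphism class once. For this \<open>L\<close> the number of pairs of projections is at most
  \<open>|Aut L|\<close>.
\<close>

lemma sum_gluings_le:
  assumes N: "finite_module R N" and i: "(L', \<pi>', E, \<epsilon>) \<in> pieces m N"
  shows "(\<Sum>L \<in> of_card_le m. real (card (gluings L (L', \<pi>', E, \<epsilon>))) * (real (card (carrier L)) ^ A / real (card (Aut R L))))
    \<le> (real (card (carrier L')) * real (card F)) ^ A"
proof (cases "\<exists>L \<in> of_card_le m. gluings L (L', \<pi>', E, \<epsilon>) \<noteq> {}")
  case False
  then show ?thesis by simp
next
  case True
  then obtain L p q where L: "L \<in> of_card_le m" and pq: "(p, q) \<in> gluings L (L', \<pi>', E, \<epsilon>)" by fast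
  have i': "finite_module R L'" "finite_module R E" "\<epsilon> \<in> Epi R E N" "card (ker E \<epsilon>) \<le> card F"
    using i modules by (auto simp: pieces_def of_card_le_def small_extensions_def)
  have fL: "finite_module R L" using of_card_le_module [OF L] .
  have other: "gluings M (L', \<pi>', E, \<epsilon>) = {}" if M: "M \<in> of_card_le m" "M \<noteq> L" for M
  proof (rule ccontr)
    assume "gluings M (L', \<pi>', E, \<epsilon>) \<noteq> {}"
    then obtain p' q' where "(p', q') \<in> gluings M (L', \<pi>', E, \<epsilon>)" by fast
    then have "Iso R M L \<noteq> {}"
      using fibre_product_unique [OF finite_moduleD(1) [OF of_card_le_module [OF M(1)]] finite_moduleD(1) [OF fL]] pq
      by (fastforce simp: gluings_def)
    then show False using non_isomorphic M L by (auto simp: of_card_le_def)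
  qed
  have "card (carrier L) \<le> card (carrier L') * card (ker E \<epsilon>)"
    using card_le_fibre_product [OF fL i'(1,2) N i'(3)] pq by (auto simp: gluings_def)
  also have "\<dots> \<le> card (carrier L') * card F" using i'(4) by simp
  finally have "real (card (carrier L)) \<le> real (card (carrier L')) * real (card F)"
    by (metis of_nat_le_iff of_nat_mult)
  then have size: "real (card (carrier L)) ^ A \<le> (real (card (carrier L')) * real (card F)) ^ A"
    by (rule power_mono) simp
  have "card (gluings L (L', \<pi>', E, \<epsilon>)) \<le> card (Aut R L)"
    using card_fibre_product_maps_le [OF fL] by (simp add: gluings_def)
  then have "real (card (gluings L (L', \<pi>', E, \<epsilon>))) * (real (card (carrier L)) ^ A / real (card (Aut R L)))
      \<le> real (card (Aut R L)) * (real (card (carrier L)) ^ A / real (card (Aut R L)))"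
    by (intro mult_right_mono) auto
  also have "\<dots> = real (card (carrier L)) ^ A" using card_Aut_pos [OF fL] by simp
  finally show ?thesis
    using size sum.remove [OF finite_of_card_le L, of "\<lambda>L. real (card (gluings L (L', \<pi>', E, \<epsilon>))) *
        (real (card (carrier L)) ^ A / real (card (Aut R L)))"]
    by (simp add: other)
qed

text \<open>
  The contribution of \<open>L\<close> to the sum in the definition of \<open>well_behaved\<close>, with \<open>|L| ^ A\<close> for the
  moment of \<open>L\<close> and without the factor \<open>Z\<close>.
\<close>

definition moment :: "nat \<Rightarrow> ('r, nat) module \<Rightarrow> ('r, nat) module \<Rightarrow> real" where
  "moment A N L = (\<Sum>\<pi> \<in> Epi R L N. \<bar>real_of_int (mu R L N \<pi>)\<bar>) * (real (card (carrier L)) ^ A / real (card (Aut R L)))"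

lemma moment_nonneg: "moment A N L \<ge> 0"
  by (simp add: moment_def sum_nonneg)

text \<open>
  The self-bound of the sum: weighting every \<open>\<pi>\<close> with the number of maximal submodules of its
  kernel costs only a constant factor. Decompose each \<open>L\<close> into pieces and sum over \<open>L\<close> first. The
  constant is the number of choices of \<open>(E, \<epsilon>)\<close> times the bound on \<open>(|L| / |L'|) ^ A\<close>.
\<close>

lemma weighted_moment_le:
  assumes N: "finite_module R N"
  shows "(\<Sum>L \<in> of_card_le m. (\<Sum>\<pi> \<in> Epi R L N. real (card (maximal_submodules R L (ker L \<pi>))) *
        \<bar>real_of_int (mu R L N \<pi>)\<bar>) * (real (card (carrier L)) ^ A / real (card (Aut R L))))
    \<le> real (card (small_extensions N) * card F ^ A) * (\<Sum>L \<in> of_card_le m. moment A N L)"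
proof -
  let ?c = "\<lambda>L. real (card (carrier L)) ^ A / real (card (Aut R L))"
  have "(\<Sum>L \<in> of_card_le m. (\<Sum>\<pi> \<in> Epi R L N. real (card (maximal_submodules R L (ker L \<pi>))) *
        \<bar>real_of_int (mu R L N \<pi>)\<bar>) * ?c L)
      \<le> (\<Sum>L \<in> of_card_le m. (\<Sum>i \<in> pieces m N. weight N i * real (card (gluings L i))) * ?c L)"
    by (intro sum_mono mult_right_mono sum_maximal_le_sum_gluings [OF N]) auto
  also have "\<dots> = (\<Sum>L \<in> of_card_le m. \<Sum>i \<in> pieces m N. weight N i * (real (card (gluings L i)) * ?c L))"
    by (simp only: sum_distrib_right mult.assoc)
  also have "\<dots> = (\<Sum>i \<in> pieces m N. weight N i * (\<Sum>L \<in> of_card_le m. real (card (gluings L i)) * ?c L))"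
    by (subst sum.swap) (simp add: sum_distrib_left)
  also have "\<dots> \<le> (\<Sum>i \<in> pieces m N. weight N i * (real (card (carrier (fst i))) * real (card F)) ^ A)"
  proof (rule sum_mono)
    fix i assume i: "i \<in> pieces m N"
    obtain L' \<pi>' E \<epsilon> where "i = (L', \<pi>', E, \<epsilon>)" by (cases i)
    then show "weight N i * (\<Sum>L \<in> of_card_le m. real (card (gluings L i)) * ?c L)
        \<le> weight N i * (real (card (carrier (fst i))) * real (card F)) ^ A"
      using sum_gluings_le [OF N] i weight_nonneg by (simp add: mult_left_mono)
  qed
  also have "\<dots> = (\<Sum>L' \<in> of_card_le m. \<Sum>y \<in> Epi R L' N \<times> small_extensions N.
      weight N (L', y) * (real (card (carrier L')) * real (card F)) ^ A)"
    using sum.Sigma [of "of_card_le m" "\<lambda>L'. Epi R L' N \<times> small_extensions N"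
        "\<lambda>L' y. weight N (L', y) * (real (card (carrier L')) * real (card F)) ^ A"]
      finite_of_card_le finite_Epi [OF of_card_le_module N] finite_small_extensions [OF N]
    by (simp add: pieces_def split_def)
  also have "\<dots> = (\<Sum>L' \<in> of_card_le m. real (card (small_extensions N) * card F ^ A) * moment A N L')"
  proof (rule sum.cong [OF refl])
    fix L' assume L': "L' \<in> of_card_le m"
    have "(\<Sum>y \<in> Epi R L' N \<times> small_extensions N.
        weight N (L', y) * (real (card (carrier L')) * real (card F)) ^ A)
        = (\<Sum>\<pi>' \<in> Epi R L' N. \<Sum>e \<in> small_extensions N.
          weight N (L', \<pi>', e) * (real (card (carrier L')) * real (card F)) ^ A)"
      by (simp add: sum.cartesian_product split_def)
    also have "\<dots> = (\<Sum>\<pi>' \<in> Epi R L' N. \<bar>real_of_int (mu R L' N \<pi>')\<bar> *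
        (?c L' * real (card (small_extensions N) * card F ^ A)))"
      by (rule sum.cong [OF refl]) (simp add: weight_def split_def power_mult_distrib)
    also have "\<dots> = real (card (small_extensions N) * card F ^ A) * moment A N L'"
      unfolding moment_def sum_distrib_right [symmetric] by simp
    finally show "(\<Sum>y \<in> Epi R L' N \<times> small_extensions N.
        weight N (L', y) * (real (card (carrier L')) * real (card F)) ^ A)
        = real (card (small_extensions N) * card F ^ A) * moment A N L'" .
  qed
  finally show ?thesis by (simp add: sum_distrib_left)
qed

text \<open>
  Let \<open>d\<close> be the constant of the self-bound. Every \<open>L\<close> with more than \<open>m0 = |N| |F| ^ g\<close> elements has,
  for each \<open>\<pi>\<close> with nonzero Moebius value, at least \<open>g\<close> maximal submodules in the kernel. So for the
  sum \<open>S\<close> over modules of size at most \<open>m\<close> and the sum \<open>S\<^sub>0\<close> over those of size at most \<open>m0\<close> one has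
  \<open>g S \<le> d S + g S\<^sub>0\<close>. The choice \<open>g = 2 d + 1\<close> gives \<open>(d + 1) S \<le> g S\<^sub>0\<close>, a bound independent of \<open>m\<close>.
\<close>

lemma sum_moment_bounded:
  assumes N: "finite_module R N"
  shows "\<exists>c. \<forall>m. (\<Sum>L \<in> of_card_le m. moment A N L) \<le> c"
proof -
  define d where "d = card (small_extensions N) * card F ^ A"
  define g where "g = 2 * d + 1"
  define m0 where "m0 = card (carrier N) * card F ^ g"
  let ?c = "\<lambda>L. real (card (carrier L)) ^ A / real (card (Aut R L))"
  let ?t = "\<lambda>L. (\<Sum>\<pi> \<in> Epi R L N. real (card (maximal_submodules R L (ker L \<pi>))) *
        \<bar>real_of_int (mu R L N \<pi>)\<bar>) * ?c L"
  have t0: "?t L \<ge> 0" for L by (intro mult_nonneg_nonneg sum_nonneg) auto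
  have big: "real g * moment A N L \<le> ?t L" if L: "L \<in> \<M>" "m0 < card (carrier L)" for L
  proof -
    have fL: "finite_module R L" by (rule modules [OF L(1)])
    interpret L: left_module R L using fL by (rule finite_moduleD)
    have pointwise: "real g * \<bar>real_of_int (mu R L N \<pi>)\<bar> \<le> real (card (maximal_submodules R L (ker L \<pi>))) * \<bar>real_of_int (mu R L N \<pi>)\<bar>"
      if \<pi>: "\<pi> \<in> Epi R L N" for \<pi>
    proof (cases "mu R L N \<pi> = 0")
      case False
      let ?K = "ker L \<pi>"
      have K: "?K \<in> submodules R L" by (rule kernel_in_submodules [OF fL N \<pi>])
      have z: "{\<zero>\<^bsub>L\<^esub>} \<subseteq> ?K" using L.submoduleD(2) [OF K] by simp
      have all: "{V \<in> maximal_submodules R L ?K. {\<zero>\<^bsub>L\<^esub>} \<subseteq> V} = maximal_submodules R L ?K"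
        using L.submoduleD(2) by (auto simp: maximal_submodules_def)
      have F: "card F > 0" using scalars [OF L.R.zero_closed] finite_scalars by (auto simp: card_gt_0_iff)
      have "card ?K \<le> card {\<zero>\<^bsub>L\<^esub>} * card F ^ card {V \<in> maximal_submodules R L ?K. {\<zero>\<^bsub>L\<^esub>} \<subseteq> V}"
        by (rule card_le_of_mob_nonzero [OF fL K L.zero_submodule z])
          (use False mu_eq_mob [OF fL N \<pi>] card_cyclic_le [OF L(1)] in auto)
      then have kc: "card ?K \<le> card F ^ card (maximal_submodules R L ?K)" unfolding all by simp
      have "g \<le> card (maximal_submodules R L ?K)"
      proof (rule ccontr)
        assume "\<not> g \<le> card (maximal_submodules R L ?K)"
        then have "card F ^ card (maximal_submodules R L ?K) \<le> card F ^ g"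
          using F by (intro power_increasing) auto
        then have "card (carrier L) \<le> m0"
          using card_le_card_kernel [OF fL N \<pi>] kc unfolding m0_def by (meson le_trans mult_le_mono2)
        then show False using L(2) by simp
      qed
      then show ?thesis by (intro mult_right_mono) auto
    qed simp
    have "(\<Sum>\<pi> \<in> Epi R L N. real g * \<bar>real_of_int (mu R L N \<pi>)\<bar>) * ?c L \<le> ?t L"
      by (rule mult_right_mono [OF sum_mono [OF pointwise]]) auto
    then show ?thesis by (simp add: moment_def sum_distrib_left [symmetric] mult.assoc)
  qed
  have "(\<Sum>L \<in> of_card_le m. moment A N L) \<le> real g * (\<Sum>L \<in> of_card_le m0. moment A N L)" for m
  proof -
    let ?S = "\<Sum>L \<in> of_card_le m. moment A N L"
    have "real g * ?S = (\<Sum>L \<in> of_card_le m. real g * moment A N L)" by (simp add: sum_distrib_left)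
    \<comment> \<open>Large modules are dominated by \<open>?t\<close>; small ones are kept as they are.\<close>
    also have "\<dots> \<le> (\<Sum>L \<in> of_card_le m. ?t L + (if card (carrier L) \<le> m0 then real g * moment A N L else 0))"
      by (rule sum_mono) (use big t0 in \<open>auto simp: of_card_le_def\<close>)
    also have "\<dots> = (\<Sum>L \<in> of_card_le m. ?t L) + (\<Sum>L \<in> {L \<in> of_card_le m. card (carrier L) \<le> m0}. real g * moment A N L)"
      by (simp add: sum.distrib sum.inter_filter [OF finite_of_card_le])
    also have "\<dots> \<le> real d * ?S + real g * (\<Sum>L \<in> of_card_le m0. moment A N L)"
    proof (rule add_mono)
      show "(\<Sum>L \<in> of_card_le m. ?t L) \<le> real d * ?S" unfolding d_def by (rule weighted_moment_le [OF N])
      show "(\<Sum>L \<in> {L \<in> of_card_le m. card (carrier L) \<le> m0}. real g * moment A N L)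
          \<le> real g * (\<Sum>L \<in> of_card_le m0. moment A N L)"
        unfolding sum_distrib_left
        by (rule sum_mono2 [OF finite_of_card_le]) (auto simp: of_card_le_def moment_nonneg)
    qed
    finally have "(real d + 1) * ?S \<le> real g * (\<Sum>L \<in> of_card_le m0. moment A N L)"
      by (simp add: g_def algebra_simps)
    moreover have "?S \<le> (real d + 1) * ?S"
      using sum_nonneg [of "of_card_le m" "moment A N"] moment_nonneg by (simp add: algebra_simps)
    ultimately show ?thesis by linarith
  qed
  then show ?thesis by blast
qed

end

section \<open>Polynomial growth implies well-behavedness\<close>

theorem corollary6p5:
  fixes R :: "('r, 'x) ring_scheme"
    and M :: "('r, nat) module set \<Rightarrow> real"
    and n :: real
  assumes "ring R"
    and "\<exists>c. \<forall>N. finite_module R N \<longrightarrow>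
           \<bar>M (iso_class R N)\<bar> \<le> c * real (card (carrier N)) powr n"
  shows "well_behaved R M"
  unfolding well_behaved_def
proof (intro allI impI)
  fix \<L> N assume \<L>: "level R \<L>" and "finite_module R N \<and> iso_class R N \<in> \<L>"
  then have N: "finite_module R N" by blast
  obtain F where "module_family R (representatives \<L>) F" using level_module_family(1) [OF assms(1) \<L>] by blast
  then interpret module_family R "representatives \<L>" F .
  note class_rep = level_module_family(2) [OF assms(1) \<L>]
  obtain c where c: "\<And>N. finite_module R N \<Longrightarrow> \<bar>M (iso_class R N)\<bar> \<le> c * real (card (carrier N)) powr n"
    using assms(2) by blast
  obtain \<A> where \<A>: "finite \<A>" "\<And>L x. L \<in> representatives \<L> \<Longrightarrow> x \<in> carrier L \<Longrightarrow> annihilator R L x \<in> \<A>"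
    using finite_annihilators by blast
  \<comment> \<open>Rounding the exponent up only enlarges the bound, as modules have at least one element.\<close>
  define A where "A = nat \<lceil>n\<rceil>"
  define z where "z = real (2 ^ card \<A>) ^ 3 * \<bar>c\<bar>"
  obtain b where b: "\<And>m. (\<Sum>L \<in> of_card_le m. moment A N L) \<le> b" using sum_moment_bounded [OF N] by blast
  let ?rep = "\<lambda>C :: ('r, nat) module set. SOME L. L \<in> C"
  let ?f = "\<lambda>C. let L = ?rep C in \<Sum>\<pi> \<in> Epi R L N.
      \<bar>real_of_int (mu R L N \<pi>)\<bar> / real (card (Aut R L)) * real (Z R L N \<pi>) ^ 3 * \<bar>M C\<bar>"
  have f_le: "?f C \<le> z * moment A N (?rep C)" if C: "C \<in> \<L>" for C
  proof -
    define L where "L = ?rep C"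
    have L: "L \<in> representatives \<L>" using C by (simp add: L_def representatives_def)
    have fL: "finite_module R L" by (rule modules [OF L])
    interpret L: left_module R L using fL by (rule finite_moduleD)
    have "card (carrier L) > 0" using finite_moduleD(2) [OF fL] L.M.zero_closed by (auto simp: card_gt_0_iff)
    then have one: "real (card (carrier L)) \<ge> 1" by simp
    have "real (card (carrier L)) powr n \<le> real (card (carrier L)) powr real A"
      using one real_nat_ceiling_ge [of n] by (intro powr_mono) (auto simp: A_def)
    also have "\<dots> = real (card (carrier L)) ^ A" using one by (simp add: powr_realpow)
    finally have pw: "real (card (carrier L)) powr n \<le> real (card (carrier L)) ^ A" .
    have "\<bar>M C\<bar> \<le> c * real (card (carrier L)) powr n"
      using c [OF fL] class_rep [OF C] by (simp add: L_def)
    also have "\<dots> \<le> \<bar>c\<bar> * real (card (carrier L)) ^ A" by (intro mult_mono pw) auto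
    finally have MC: "\<bar>M C\<bar> \<le> \<bar>c\<bar> * real (card (carrier L)) ^ A" .
    have summand: "\<bar>real_of_int (mu R L N \<pi>)\<bar> / real (card (Aut R L)) * real (Z R L N \<pi>) ^ 3 * \<bar>M C\<bar>
        \<le> \<bar>real_of_int (mu R L N \<pi>)\<bar> / real (card (Aut R L)) * real (2 ^ card \<A>) ^ 3 * (\<bar>c\<bar> * real (card (carrier L)) ^ A)"
      if \<pi>: "\<pi> \<in> Epi R L N" for \<pi>
    proof -
      have "Z R L N \<pi> \<le> 2 ^ card \<A>" by (rule Z_le [OF fL N \<pi> \<A>(1)]) (rule \<A>(2) [OF L])
      then have "real (Z R L N \<pi>) ^ 3 \<le> real (2 ^ card \<A>) ^ 3" by (intro power_mono of_nat_mono) auto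
      then show ?thesis by (intro mult_mono MC) auto
    qed
    have "?f C \<le> (\<Sum>\<pi> \<in> Epi R L N. \<bar>real_of_int (mu R L N \<pi>)\<bar> / real (card (Aut R L)) *
        real (2 ^ card \<A>) ^ 3 * (\<bar>c\<bar> * real (card (carrier L)) ^ A))"
      unfolding Let_def L_def [symmetric] by (rule sum_mono) (rule summand)
    also have "\<dots> = (\<Sum>\<pi> \<in> Epi R L N. \<bar>real_of_int (mu R L N \<pi>)\<bar> *
        (z * (real (card (carrier L)) ^ A / real (card (Aut R L)))))"
      by (rule sum.cong [OF refl]) (simp add: z_def)
    also have "\<dots> = z * moment A N L"
      unfolding moment_def sum_distrib_right [symmetric] by simp
    finally show ?thesis by (simp add: L_def)
  qed
  show "?f summable_on \<L>"
  proof (rule nonneg_bdd_above_summable_on)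
    show "0 \<le> ?f C" for C unfolding Let_def by (intro sum_nonneg mult_nonneg_nonneg) auto
    have inj: "inj_on ?rep \<L>" by (rule inj_onI) (metis class_rep)
    have "sum ?f X \<le> z * b" if X: "X \<subseteq> \<L>" "finite X" for X
    proof -
      define m where "m = (\<Sum>C \<in> X. card (carrier (?rep C)))"
      have "?rep ` X \<subseteq> of_card_le m"
      proof (rule image_subsetI)
        fix C assume C: "C \<in> X"
        have "card (carrier (?rep C)) \<le> m"
          unfolding m_def by (rule member_le_sum [OF C _ X(2)]) simp
        moreover have "?rep C \<in> representatives \<L>" using C X(1) by (auto simp: representatives_def)
        ultimately show "?rep C \<in> of_card_le m" by (simp add: of_card_le_def)
      qed
      then have le_b: "(\<Sum>L \<in> ?rep ` X. moment A N L) \<le> b"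
        using sum_mono2 [OF finite_of_card_le, of "?rep ` X" m "moment A N"] b [of m] moment_nonneg by fastforce
      have "sum ?f X \<le> (\<Sum>C \<in> X. z * moment A N (?rep C))"
        by (rule sum_mono, rule f_le) (use X in blast)
      also have "\<dots> = z * (\<Sum>L \<in> ?rep ` X. moment A N L)"
        using sum.reindex [OF inj_on_subset [OF inj X(1)], of "moment A N"] by (simp add: sum_distrib_left o_def)
      also have "\<dots> \<le> z * b" by (rule mult_left_mono [OF le_b]) (simp add: z_def)
      finally show ?thesis .
    qed
    then show "bdd_above (sum ?f ` {X. X \<subseteq> \<L> \<and> finite X})" by (intro bdd_aboveI2 [where M = "z * b"]) auto
  qed
qed

end
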